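(* Consider hypercube detection in $\mathbb{V}_m=\{1,\dots,m\}^d$ with hypercubes of sidelength $[m^\alpha]$, $0<\alpha<1$, and signal parameters $\theta_m>0$. Let $t\in\mathbb{R}$ be fixed such that $0<p_0(t)<p_c$. Then the test based on $S_m(t)$ is asymptotically powerful if $$\liminf_{m\to\infty}\theta_m>\theta_*(t),$$ and asymptotically powerless if $$\limsup_{m\to\infty}\theta_m<\theta_*(t),$$ where $\theta_*(t)$ is the unique solution $\theta$ to $\zeta_{p_\theta(t)}=\alpha\,\zeta_{p_0(t)}$.
   Context: Let $d\ge 1$; $\mathbb{V}_m=\{1,\dots,m\}^d$ carries the nearest-neighbour graph structure of $\mathbb{Z}^d$. $F_0$ is a distribution function on $\mathbb{R}$ with finite non-zero variance such that $\varphi(\theta)=\int e^{x\theta}\,dF_0(x)$ is finite for $\theta\in[0,\theta_\infty)$, where $\theta_\infty>0$; $F_\theta$ is the distribution with density $\exp(\theta x-\log\varphi(\theta))$ with respect to $F_0$, $\theta\in[0,\theta_\infty)$. Write $p_\theta(t)=\mathbb{P}(X>t)$ for $X\sim F_\theta$. Testing problem: independent variables $(X_v)_{v\in\mathbb{V}_m}$ are observed. Under $\mathbb{H}_0^m$, $X_v\sim F_0$ for all $v$. For $K$ in a class $\mathcal{K}_m$ of connected node subsets, under $\mathbb{H}_{1,K}^m$, $X_v\sim F_{\theta_m}$ for $v\in K$ and $X_v\sim F_0$ for $v\notin K$. In hypercube detection, $\mathcal{K}_m$ is the class of all hypercubes (products of $d$ integer intervals of equal length) within $\mathbb{V}_m$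 of sidelength $[m^\alpha]$, $[\cdot]$ being the integer part. The worst-case risk of a $\{0,1\}$-valued test $T$ is $\gamma_m(T)=\mathbb{P}(T=1\mid\mathbb{H}_0^m)+\max_{K\in\mathcal{K}_m}\mathbb{P}(T=0\mid\mathbb{H}_{1,K}^m)$. A sequence $(T_m)$ is asymptotically powerful if $\gamma_m(T_m)\to0$, and asymptotically powerless if $\liminf_m\gamma_m(T_m)\ge1$. The test based on a statistic rejects for large values of it (value above a critical value $c_m$): it is called asymptotically powerful if this holds for some choice of $(c_m)$ and asymptotically powerless if this holds for every choice of $(c_m)$. $S_m(t)$ is the size of the largest open cluster at threshold $t$, i.e. of the largest connected component of the subgraph of $\mathbb{V}_m$ induced by $\{v: X_v>t\}$. Percolation: in site percolation on $\mathbb{Z}^d$ with parameter $p$ (nodes open independently with probability $p$), $S$ is the size of the open cluster containing the origin ($0$ if the origin is closed), and $p_c$ is the supremum of $p\in(0,1)$ with $S<\infty$ almost surely. For $0<p<p_c$, $\zeta_p=-\lim_{k\to\infty}\frac1k\log\mathbb{P}(S\ge k)=-\lim_{k\to\infty}\frac1k\log\mathbb{P}(S=k)$ (the limits exist), and $\zeta_p=0$ for $p\ge p_c$. The function $\zeta_p$ is continuous and strictly decreasing on $(0,p_c]$, and $p_\theta(t)$ is continuous and strictly increasing in $\theta$.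
   Formalization: The existence of a solution θ_*(t) in [0,θ_∞) is assumed, since it can fail when θ_∞ is finite (e.g. d=1, F_0=N(0,1), t=0, α=1/2, θ_∞=0.5); its uniqueness is proved. *)

theory Defs
  imports "HOL-Probability.Probability"
begin

text \<open>Sites of the \<open>d\<close>-dimensional integer lattice are vectors of type \<open>int ^ 'd\<close>, where
  \<open>d = CARD('d) \<ge> 1\<close>. Quantities that depend on the dimension only through the lattice take an
  argument of type \<open>'d itself\<close>.\<close>

subsection \<open>The lattice and its clusters\<close>

definition grid :: "nat \<Rightarrow> (int ^ 'd::finite) set" where
  "grid m = {v. \<forall>i. 1 \<le> v $ i \<and> v $ i \<le> int m}"

definition lattice_adj :: "int ^ 'd::finite \<Rightarrow> int ^ 'd \<Rightarrow> bool" where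
  "lattice_adj u v \<longleftrightarrow> (\<Sum>i\<in>UNIV. \<bar>u $ i - v $ i\<bar>) = 1"

text \<open>The connected component of \<open>v\<close> in the subgraph induced by the set \<open>A\<close>; it is empty if
  \<open>v \<notin> A\<close>.\<close>

definition cluster :: "(int ^ 'd::finite) set \<Rightarrow> int ^ 'd \<Rightarrow> (int ^ 'd) set" where
  "cluster A v = {u. v \<in> A \<and> (v, u) \<in> {(x, y). x \<in> A \<and> y \<in> A \<and> lattice_adj x y}\<^sup>*}"

text \<open>Only meant for finite \<open>A\<close>; the value is \<open>0\<close> for the empty set.\<close>

definition largest_cluster :: "(int ^ 'd::finite) set \<Rightarrow> nat" where
  "largest_cluster A = Max (insert 0 ((\<lambda>v. card (cluster A v)) ` A))"

subsection \<open>Site percolation\<close>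

definition site_percolation :: "'d::finite itself \<Rightarrow> real \<Rightarrow> (int ^ 'd \<Rightarrow> bool) measure" where
  "site_percolation D p = (\<Pi>\<^sub>M v\<in>UNIV. measure_pmf (bernoulli_pmf p))"

definition origin_cluster_size :: "(int ^ 'd::finite \<Rightarrow> bool) \<Rightarrow> enat" where
  "origin_cluster_size \<omega> =
     (let C = cluster {v. \<omega> v} 0 in if finite C then enat (card C) else \<infinity>)"

definition p_crit :: "'d::finite itself \<Rightarrow> real" where
  "p_crit D = Sup {p. 0 < p \<and> p < 1 \<and>
     (AE \<omega> in site_percolation D p. origin_cluster_size \<omega> < \<infinity>)}"

definition zeta :: "'d::finite itself \<Rightarrow> real \<Rightarrow> real" where
  "zeta D p = (if p \<ge> p_crit D then 0 else
     - lim (\<lambda>k::nat. (1 / real k) * ln (measure (site_percolation D p)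
         {\<omega> \<in> space (site_percolation D p). enat k \<le> origin_cluster_size \<omega>})))"

subsection \<open>The exponential family\<close>

text \<open>Distributions on the real line are represented by their probability measures
  (\<^locale>\<open>real_distribution\<close>).\<close>

definition mgf :: "real measure \<Rightarrow> real \<Rightarrow> real" where
  "mgf F\<^sub>0 \<theta> = (LINT x|F\<^sub>0. exp (x * \<theta>))"

definition tilted :: "real measure \<Rightarrow> real \<Rightarrow> real measure" where
  "tilted F\<^sub>0 \<theta> = density F\<^sub>0 (\<lambda>x. ennreal (exp (\<theta> * x - ln (mgf F\<^sub>0 \<theta>))))"

definition exceed_prob :: "real measure \<Rightarrow> real \<Rightarrow> real \<Rightarrow> real" where
  "exceed_prob F\<^sub>0 \<theta> t = measure (tilted F\<^sub>0 \<theta>) {x. x > t}"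

subsection \<open>The testing problem\<close>

definition null_law :: "real measure \<Rightarrow> nat \<Rightarrow> (int ^ 'd::finite \<Rightarrow> real) measure" where
  "null_law F\<^sub>0 m = (\<Pi>\<^sub>M v\<in>grid m. F\<^sub>0)"

definition alt_law ::
  "real measure \<Rightarrow> real \<Rightarrow> nat \<Rightarrow> (int ^ 'd::finite) set \<Rightarrow> (int ^ 'd \<Rightarrow> real) measure" where
  "alt_law F\<^sub>0 \<theta> m K = (\<Pi>\<^sub>M v\<in>grid m. if v \<in> K then tilted F\<^sub>0 \<theta> else F\<^sub>0)"

text \<open>The sidelength of a hypercube is the number of integers in each of its factors.\<close>

definition hypercubes :: "real \<Rightarrow> nat \<Rightarrow> (int ^ 'd::finite) set set" where
  "hypercubes \<alpha> m = {K. K \<subseteq> grid m \<and>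
     (\<exists>a. K = {v. \<forall>i. a $ i \<le> v $ i \<and> v $ i < a $ i + \<lfloor>real m powr \<alpha>\<rfloor>})}"

text \<open>A test maps the observations to \<open>True\<close> (reject, \<open>T = 1\<close>) or \<open>False\<close> (accept, \<open>T = 0\<close>).\<close>

definition risk ::
  "real measure \<Rightarrow> real \<Rightarrow> nat \<Rightarrow> (int ^ 'd::finite) set set \<Rightarrow> ((int ^ 'd \<Rightarrow> real) \<Rightarrow> bool) \<Rightarrow> real"
where
  "risk F\<^sub>0 \<theta> m \<K> T =
     measure (null_law F\<^sub>0 m) {x \<in> space (null_law F\<^sub>0 m). T x} +
     (MAX K\<in>\<K>. measure (alt_law F\<^sub>0 \<theta> m K) {x \<in> space (alt_law F\<^sub>0 \<theta> m K). \<not> T x})"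

definition asymp_powerful ::
  "real measure \<Rightarrow> (nat \<Rightarrow> real) \<Rightarrow> (nat \<Rightarrow> (int ^ 'd::finite) set set)
     \<Rightarrow> (nat \<Rightarrow> (int ^ 'd \<Rightarrow> real) \<Rightarrow> bool) \<Rightarrow> bool" where
  "asymp_powerful F\<^sub>0 \<theta> \<K> T \<longleftrightarrow> (\<lambda>m. risk F\<^sub>0 (\<theta> m) m (\<K> m) (T m)) \<longlonglongrightarrow> 0"

definition asymp_powerless ::
  "real measure \<Rightarrow> (nat \<Rightarrow> real) \<Rightarrow> (nat \<Rightarrow> (int ^ 'd::finite) set set)
     \<Rightarrow> (nat \<Rightarrow> (int ^ 'd \<Rightarrow> real) \<Rightarrow> bool) \<Rightarrow> bool" where
  "asymp_powerless F\<^sub>0 \<theta> \<K> T \<longleftrightarrow>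
     liminf (\<lambda>m. ereal (risk F\<^sub>0 (\<theta> m) m (\<K> m) (T m))) \<ge> 1"

definition stat_powerful ::
  "real measure \<Rightarrow> (nat \<Rightarrow> real) \<Rightarrow> (nat \<Rightarrow> (int ^ 'd::finite) set set)
     \<Rightarrow> (nat \<Rightarrow> (int ^ 'd \<Rightarrow> real) \<Rightarrow> real) \<Rightarrow> bool" where
  "stat_powerful F\<^sub>0 \<theta> \<K> S \<longleftrightarrow>
     (\<exists>c :: nat \<Rightarrow> real. asymp_powerful F\<^sub>0 \<theta> \<K> (\<lambda>m x. S m x > c m))"

definition stat_powerless ::
  "real measure \<Rightarrow> (nat \<Rightarrow> real) \<Rightarrow> (nat \<Rightarrow> (int ^ 'd::finite) set set)
     \<Rightarrow> (nat \<Rightarrow> (int ^ 'd \<Rightarrow> real) \<Rightarrow> real) \<Rightarrow> bool" where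
  "stat_powerless F\<^sub>0 \<theta> \<K> S \<longleftrightarrow>
     (\<forall>c :: nat \<Rightarrow> real. asymp_powerless F\<^sub>0 \<theta> \<K> (\<lambda>m x. S m x > c m))"

definition largest_open_cluster :: "real \<Rightarrow> nat \<Rightarrow> (int ^ 'd::finite \<Rightarrow> real) \<Rightarrow> real" where
  "largest_open_cluster t m x = real (largest_cluster {v \<in> grid m. x v > t})"

end

theory Submission
  imports Defs "HOL-Real_Asymp.Real_Asymp"
begin

text \<open>At level \<open>p\<close> the largest open cluster in a cube of side \<open>m\<^sup>a\<close> has size about
  \<open>(a d / \<zeta>\<^sub>p) ln m\<close>: a union bound gives the upper estimate, disjoint balls in the cube the lower
  one. So the hypercube is seen if and only if \<open>\<alpha> / \<zeta>\<close> inside it exceeds \<open>1 / \<zeta>\<close> outside.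

  For \<open>\<zeta>\<close> this needs three facts. It is positive below the critical point: by the argument of
  Duminil-Copin and Tassion, some finite set around the origin has fewer than one expected exit,
  and the cluster is then dominated by a subcritical branching process. The limit defining it
  exists because cluster probabilities in a half-space are supermultiplicative. It is strictly
  decreasing because the probability of an increasing event at parameter \<open>p = q powr \<gamma>\<close>, \<open>\<gamma> > 1\<close>,
  is at most the power \<open>\<gamma>\<close> of its probability at \<open>q\<close>. All of this takes place in finite products of Bernoulli measures.\<close>

subsection \<open>Finite Bernoulli expectations\<close>

text \<open>Configurations are sets of open sites, so increasing events become monotone functions of
  sets; the density may vary with the site because the alternative has two of them. Infinite volume
  enters only through events of the form "at least n sites", which are decided within distance n of
  the source.

  Two obstacles shape the rest. Clusters grown from neighbouring sources may overlap, so their sizes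
  cannot simply be added; in a half-space the second cluster can be placed in a region not yet
  inspected, and the return to the whole lattice costs a polynomial factor, which the decay rate
  does not see. And a strong signal may open the sites of the hypercube with probability at or above
  the critical point, where the rate is zero by definition; there the lower estimate has to come
  from the failure of the finite criterion, again up to a polynomial factor.

  Only strict comparisons of rates are needed, so a sequence \<open>\<theta>\<close> is replaced by
  one constant parameter between \<open>\<theta>_star\<close> and its lower or upper limit.\<close>

definition bexp :: "('a \<Rightarrow> real) \<Rightarrow> 'a set \<Rightarrow> ('a set \<Rightarrow> real) \<Rightarrow> real" where
  "bexp p A f = (\<Sum>\<omega>\<in>Pow A. (\<Prod>v\<in>\<omega>. p v) * (\<Prod>v\<in>A - \<omega>. 1 - p v) * f \<omega>)"

abbreviation bprob :: "('a \<Rightarrow> real) \<Rightarrow> 'a set \<Rightarrow> ('a set \<Rightarrow> bool) \<Rightarrow> real" where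
  "bprob p A Q \<equiv> bexp p A (\<lambda>\<omega>. of_bool (Q \<omega>))"

lemma bexp_empty [simp]: "bexp p {} f = f {}"
  by (simp add: bexp_def)

text \<open>Conditioning on the state of v. Monotonicity in the density, Russo's formula and the
  power inequality are all proved by induction through this recursion.\<close>

lemma bexp_insert:
  assumes "finite A" "v \<notin> A"
  shows "bexp p (insert v A) f = p v * bexp p A (\<lambda>\<omega>. f (insert v \<omega>)) + (1 - p v) * bexp p A f"
proof -
  let ?w = "\<lambda>B \<omega>. (\<Prod>v\<in>\<omega>. p v) * (\<Prod>v\<in>B - \<omega>. 1 - p v)"
  have inj: "inj_on (insert v) (Pow A)"
    using assms by (auto simp: inj_on_def)
  have disj: "Pow A \<inter> insert v ` Pow A = {}"
    using assms by auto
  have "bexp p (insert v A) f = (\<Sum>\<omega>\<in>Pow A. ?w (insert v A) \<omega> * f \<omega>)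
      + (\<Sum>\<omega>\<in>Pow A. ?w (insert v A) (insert v \<omega>) * f (insert v \<omega>))"
    unfolding bexp_def Pow_insert using assms disj
    by (subst sum.union_disjoint) (auto simp: sum.reindex[OF inj])
  also have "(\<Sum>\<omega>\<in>Pow A. ?w (insert v A) \<omega> * f \<omega>) = (1 - p v) * bexp p A f"
    unfolding bexp_def sum_distrib_left
  proof (rule sum.cong)
    fix \<omega> assume w: "\<omega> \<in> Pow A"
    then have "insert v A - \<omega> = insert v (A - \<omega>)" "v \<notin> A - \<omega>" using assms by auto
    then show "?w (insert v A) \<omega> * f \<omega> = (1 - p v) * (?w A \<omega> * f \<omega>)"
      using assms by simp
  qed simp
  also have "(\<Sum>\<omega>\<in>Pow A. ?w (insert v A) (insert v \<omega>) * f (insert v \<omega>))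
      = p v * bexp p A (\<lambda>\<omega>. f (insert v \<omega>))"
    unfolding bexp_def sum_distrib_left
  proof (rule sum.cong)
    fix \<omega> assume w: "\<omega> \<in> Pow A"
    then have "insert v A - insert v \<omega> = A - \<omega>" "v \<notin> \<omega>" "finite \<omega>"
      using assms finite_subset by auto
    then show "?w (insert v A) (insert v \<omega>) * f (insert v \<omega>) = p v * (?w A \<omega> * f (insert v \<omega>))"
      by simp
  qed simp
  finally show ?thesis by simp
qed

lemma bexp_cong: "(\<And>\<omega>. \<omega> \<subseteq> A \<Longrightarrow> f \<omega> = g \<omega>) \<Longrightarrow> bexp p A f = bexp p A g"
  unfolding bexp_def by (intro sum.cong) auto

lemma bexp_cong_p: "(\<And>v. v \<in> A \<Longrightarrow> p v = q v) \<Longrightarrow> bexp p A f = bexp q A f"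
  unfolding bexp_def
  by (intro sum.cong arg_cong2[where f = "(*)"] refl prod.cong) auto

lemma bexp_add: "bexp p A (\<lambda>\<omega>. f \<omega> + g \<omega>) = bexp p A f + bexp p A g"
  by (simp add: bexp_def algebra_simps sum.distrib)

lemma bexp_diff: "bexp p A (\<lambda>\<omega>. f \<omega> - g \<omega>) = bexp p A f - bexp p A g"
  by (simp add: bexp_def algebra_simps sum_subtractf)

lemma bexp_cmult: "bexp p A (\<lambda>\<omega>. c * f \<omega>) = c * bexp p A f"
  by (simp add: bexp_def sum_distrib_left mult_ac)

lemma bexp_sum: "bexp p A (\<lambda>\<omega>. \<Sum>i\<in>I. f i \<omega>) = (\<Sum>i\<in>I. bexp p A (f i))"
  unfolding bexp_def sum_distrib_left by (rule sum.swap)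

lemma bexp_const: "finite A \<Longrightarrow> bexp p A (\<lambda>_. c) = c"
  by (induction A rule: finite_induct) (auto simp: bexp_insert algebra_simps)

lemma bexp_zero [simp]: "bexp p A (\<lambda>_. 0) = 0"
  by (simp add: bexp_def)

lemma bexp_mono:
  assumes "\<And>v. v \<in> A \<Longrightarrow> 0 \<le> p v \<and> p v \<le> 1" "\<And>\<omega>. \<omega> \<subseteq> A \<Longrightarrow> f \<omega> \<le> g \<omega>"
  shows "bexp p A f \<le> bexp p A g"
  unfolding bexp_def using assms
  by (intro sum_mono mult_left_mono mult_nonneg_nonneg prod_nonneg) auto

lemma bexp_nonneg:
  assumes "\<And>v. v \<in> A \<Longrightarrow> 0 \<le> p v \<and> p v \<le> 1" "\<And>\<omega>. \<omega> \<subseteq> A \<Longrightarrow> 0 \<le> f \<omega>"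
  shows "0 \<le> bexp p A f"
  using bexp_mono[of A p "\<lambda>_. 0" f] assms by simp

lemma bprob_le_1:
  assumes "finite A" "\<And>v. v \<in> A \<Longrightarrow> 0 \<le> p v \<and> p v \<le> 1"
  shows "bprob p A Q \<le> 1"
  using bexp_mono[of A p "\<lambda>\<omega>. of_bool (Q \<omega>)" "\<lambda>_. 1"] assms by (simp add: bexp_const)

lemma bexp_Un:
  assumes "finite A" "finite B" "A \<inter> B = {}"
  shows "bexp p (A \<union> B) f = bexp p A (\<lambda>a. bexp p B (\<lambda>b. f (a \<union> b)))"
  using assms(1,3)
proof (induction A arbitrary: f rule: finite_induct)
  case (insert v A)
  have "v \<notin> A \<union> B" "finite (A \<union> B)" using insert assms by auto
  then show ?case using insert by (simp add: bexp_insert)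
qed simp

text \<open>Independence of what happens inside T and outside T. The set T may stick out of A, as
  the set inspected by an exploration does.\<close>

lemma bexp_indep:
  assumes "finite A" "\<And>\<omega>. \<omega> \<subseteq> A \<Longrightarrow> f \<omega> = f (\<omega> \<inter> T)" "\<And>\<omega>. \<omega> \<subseteq> A \<Longrightarrow> g \<omega> = g (\<omega> - T)"
  shows "bexp p A (\<lambda>\<omega>. f \<omega> * g \<omega>) = bexp p (A \<inter> T) f * bexp p (A - T) g"
proof -
  have "bexp p A (\<lambda>\<omega>. f \<omega> * g \<omega>) = bexp p ((A \<inter> T) \<union> (A - T)) (\<lambda>\<omega>. f \<omega> * g \<omega>)"
    by (simp add: Int_Diff_Un)
  also have "\<dots> = bexp p (A \<inter> T) (\<lambda>a. bexp p (A - T) (\<lambda>b. f (a \<union> b) * g (a \<union> b)))"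
    using assms(1) by (intro bexp_Un) auto
  also have "\<dots> = bexp p (A \<inter> T) (\<lambda>a. bexp p (A - T) (\<lambda>b. f a * g b))"
  proof (intro bexp_cong)
    fix a b assume ab: "a \<subseteq> A \<inter> T" "b \<subseteq> A - T"
    then have "(a \<union> b) \<inter> T = a" "(a \<union> b) - T = b" "a \<union> b \<subseteq> A" by auto
    then show "f (a \<union> b) * g (a \<union> b) = f a * g b"
      using assms(2,3)[of "a \<union> b"] by simp
  qed
  also have "\<dots> = bexp p (A \<inter> T) (\<lambda>a. bexp p (A - T) g * f a)"
    by (simp add: bexp_cmult mult.commute)
  finally show ?thesis by (simp add: bexp_cmult)
qed

lemma bexp_restrict:
  assumes "finite A" "B \<subseteq> A" "\<And>\<omega>. \<omega> \<subseteq> A \<Longrightarrow> f \<omega> = f (\<omega> \<inter> B)"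
  shows "bexp p A f = bexp p B f"
proof -
  have "A \<inter> B = B" using assms by auto
  then show ?thesis
    using bexp_indep[of A f B "\<lambda>_. 1" p] assms by (simp add: bexp_const)
qed

lemma bexp_prod_indep:
  assumes "finite J" "\<And>j. j \<in> J \<Longrightarrow> finite (B j)" "disjoint_family_on B J"
  shows "bexp p (\<Union>j\<in>J. B j) (\<lambda>\<omega>. \<Prod>j\<in>J. g j (\<omega> \<inter> B j)) = (\<Prod>j\<in>J. bexp p (B j) (g j))"
  using assms
proof (induction J rule: finite_induct)
  case empty
  then show ?case by simp
next
  case (insert i J)
  let ?A = "\<Union>j\<in>insert i J. B j"
  have dis: "B j \<inter> B i = {}" if "j \<in> J" for j
    using insert.prems(2) insert.hyps that by (auto simp: disjoint_family_on_def)
  have eq: "?A \<inter> B i = B i" "?A - B i = (\<Union>j\<in>J. B j)"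
    using dis by auto
  have "bexp p ?A (\<lambda>\<omega>. \<Prod>j\<in>insert i J. g j (\<omega> \<inter> B j))
      = bexp p ?A (\<lambda>\<omega>. g i (\<omega> \<inter> B i) * (\<Prod>j\<in>J. g j (\<omega> \<inter> B j)))"
    using insert.hyps by simp
  also have "\<dots> = bexp p (?A \<inter> B i) (\<lambda>\<omega>. g i (\<omega> \<inter> B i))
      * bexp p (?A - B i) (\<lambda>\<omega>. \<Prod>j\<in>J. g j (\<omega> \<inter> B j))"
  proof (rule bexp_indep)
    fix \<omega>
    show "(\<Prod>j\<in>J. g j (\<omega> \<inter> B j)) = (\<Prod>j\<in>J. g j ((\<omega> - B i) \<inter> B j))"
    proof (rule prod.cong)
      fix j assume "j \<in> J"
      then have "(\<omega> - B i) \<inter> B j = \<omega> \<inter> B j" using dis by auto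
      then show "g j (\<omega> \<inter> B j) = g j ((\<omega> - B i) \<inter> B j)" by simp
    qed simp
  qed (use insert in auto)
  also have "bexp p (?A - B i) (\<lambda>\<omega>. \<Prod>j\<in>J. g j (\<omega> \<inter> B j)) = (\<Prod>j\<in>J. bexp p (B j) (g j))"
    unfolding eq using insert.prems by (intro insert.IH) (auto simp: disjoint_family_on_def)
  also have "bexp p (?A \<inter> B i) (\<lambda>\<omega>. g i (\<omega> \<inter> B i)) = bexp p (B i) (g i)"
    unfolding eq by (intro bexp_cong) (simp add: Int_absorb2)
  finally show ?case using insert.hyps by simp
qed

lemma bexp_image:
  assumes "finite A" "inj_on g A"
  shows "bexp p (g ` A) f = bexp (p \<circ> g) A (\<lambda>\<omega>. f (g ` \<omega>))"
  using assms
  by (induction A arbitrary: f rule: finite_induct) (auto simp: bexp_insert)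

text \<open>Raising the density at v moves weight from the conditional expectation with v closed to
  the one with v open, which is the larger of the two because f is increasing.\<close>

lemma bexp_mono_p:
  assumes "finite A" "\<And>v. v \<in> A \<Longrightarrow> 0 \<le> p v \<and> p v \<le> q v \<and> q v \<le> 1"
    and "\<And>a b. a \<subseteq> b \<Longrightarrow> b \<subseteq> A \<Longrightarrow> f a \<le> f b"
  shows "bexp p A f \<le> bexp q A f"
  using assms
proof (induction A arbitrary: f rule: finite_induct)
  case (insert v A)
  let ?f1 = "\<lambda>\<omega>. f (insert v \<omega>)"
  have pq: "0 \<le> p v" "p v \<le> q v" "q v \<le> 1" using insert.prems(1)[of v] by auto
  have 0: "bexp p A f \<le> bexp q A f"
    using insert.prems by (intro insert.IH) (auto simp: subset_insertI2)
  have 1: "bexp p A ?f1 \<le> bexp q A ?f1"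
    using insert.prems(1) by (intro insert.IH) (auto intro!: insert.prems(2))
  have 01: "bexp q A f \<le> bexp q A ?f1"
  proof (rule bexp_mono)
    show "0 \<le> q u \<and> q u \<le> 1" if "u \<in> A" for u
      using insert.prems(1)[of u] that by auto
  qed (auto intro!: insert.prems(2))
  have "p v * bexp p A ?f1 + (1 - p v) * bexp p A f \<le> p v * bexp q A ?f1 + (1 - p v) * bexp q A f"
    using 0 1 pq by (intro add_mono mult_left_mono) auto
  also have "\<dots> = bexp q A f + p v * (bexp q A ?f1 - bexp q A f)" by (simp add: algebra_simps)
  also have "\<dots> \<le> bexp q A f + q v * (bexp q A ?f1 - bexp q A f)"
    using 01 pq by (intro add_left_mono mult_right_mono) auto
  finally show ?case using insert.hyps by (simp add: bexp_insert algebra_simps)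
qed simp

text \<open>Russo's formula for an arbitrary function f. In the induction, differentiating the
  weights p and 1 - p of the new site w yields exactly the summand for w.\<close>

lemma russo_formula:
  assumes "finite A"
  shows "((\<lambda>p. bexp (\<lambda>_. p) A f) has_real_derivative
    (\<Sum>v\<in>A. bexp (\<lambda>_. p) A (\<lambda>\<omega>. f (insert v \<omega>) - f (\<omega> - {v})))) (at p)"
  using assms
proof (induction A arbitrary: f rule: finite_induct)
  case (insert w A)
  let ?D = "\<lambda>f. \<Sum>v\<in>A. bexp (\<lambda>_. p) A (\<lambda>\<omega>. f (insert v \<omega>) - f (\<omega> - {v}))"
  let ?f1 = "\<lambda>\<omega>. f (insert w \<omega>)"
  have der: "((\<lambda>p. p * bexp (\<lambda>_. p) A ?f1 + (1 - p) * bexp (\<lambda>_. p) A f) has_real_derivative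
      (bexp (\<lambda>_. p) A ?f1 + p * ?D ?f1 + ((1 - p) * ?D f - bexp (\<lambda>_. p) A f))) (at p)"
    by (rule derivative_eq_intros insert.IH refl | simp add: algebra_simps)+
  have v: "bexp (\<lambda>_. p) (insert w A) (\<lambda>\<omega>. f (insert v \<omega>) - f (\<omega> - {v}))
    = p * bexp (\<lambda>_. p) A (\<lambda>\<omega>. ?f1 (insert v \<omega>) - ?f1 (\<omega> - {v}))
      + (1 - p) * bexp (\<lambda>_. p) A (\<lambda>\<omega>. f (insert v \<omega>) - f (\<omega> - {v}))" if "v \<in> A" for v
  proof -
    have "insert w \<omega> - {v} = insert w (\<omega> - {v})" for \<omega> using that insert.hyps by auto
    then show ?thesis using insert.hyps by (simp add: bexp_insert insert_commute)
  qed
  have "bexp (\<lambda>_. p) (insert w A) (\<lambda>\<omega>. f (insert w \<omega>) - f (\<omega> - {w}))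
      = bexp (\<lambda>_. p) A (\<lambda>\<omega>. ?f1 \<omega> - f (\<omega> - {w}))"
    using insert.hyps by (simp add: bexp_insert algebra_simps)
  also have "\<dots> = bexp (\<lambda>_. p) A (\<lambda>\<omega>. ?f1 \<omega> - f \<omega>)"
  proof (rule bexp_cong)
    fix \<omega> assume "\<omega> \<subseteq> A"
    then have "\<omega> - {w} = \<omega>" using insert.hyps by auto
    then show "?f1 \<omega> - f (\<omega> - {w}) = ?f1 \<omega> - f \<omega>" by simp
  qed
  finally have w: "bexp (\<lambda>_. p) (insert w A) (\<lambda>\<omega>. f (insert w \<omega>) - f (\<omega> - {w}))
      = bexp (\<lambda>_. p) A ?f1 - bexp (\<lambda>_. p) A f" by (simp add: bexp_diff)
  have "(\<Sum>v\<in>insert w A. bexp (\<lambda>_. p) (insert w A) (\<lambda>\<omega>. f (insert v \<omega>) - f (\<omega> - {v})))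
     = bexp (\<lambda>_. p) A ?f1 + p * ?D ?f1 + ((1 - p) * ?D f - bexp (\<lambda>_. p) A f)"
    using insert.hyps v w by (simp add: sum.distrib sum_distrib_left)
  then show ?case using der insert.hyps by (simp add: bexp_insert)
qed simp

text \<open>The two-point case of the power inequality. The function \<open>?F\<close> is
  nondecreasing by convexity of the power; its value at \<open>p * b\<close> is
  \<open>(1 - p powr g) * b powr g\<close>, and its value at \<open>p * a\<close> is the right-hand
  side minus \<open>p powr g * a powr g\<close>.\<close>

lemma powr_mix_le:
  fixes a b p g :: real
  assumes "0 \<le> b" "b \<le> a" "0 < p" "p \<le> 1" "1 \<le> g"
  shows "p powr g * a powr g + (1 - p powr g) * b powr g \<le> (p * a + (1 - p) * b) powr g"
proof -
  let ?F = "\<lambda>x. (x + (1 - p) * b) powr g - x powr g"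
  have "?F (p * b) \<le> ?F (p * a)"
  proof (cases "b = 0")
    case False
    then have b: "b > 0" using assms by simp
    show ?thesis
    proof (rule DERIV_nonneg_imp_nondecreasing[where f = ?F])
      fix x assume x: "p * b \<le> x" "x \<le> p * a"
      have x0: "x > 0" using x(1) mult_pos_pos[OF assms(3) b] by linarith
      have y0: "(1 - p) * b \<ge> 0" using assms b by simp
      have "(?F has_real_derivative g * (x + (1 - p) * b) powr (g - 1) - g * x powr (g - 1)) (at x)"
        using x0 y0 by (auto intro!: derivative_eq_intros)
      moreover have "g * x powr (g - 1) \<le> g * (x + (1 - p) * b) powr (g - 1)"
        using x0 y0 assms by (intro mult_left_mono powr_mono2) auto
      ultimately show "\<exists>y. (?F has_real_derivative y) (at x) \<and> 0 \<le> y" by force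
    qed (use assms in \<open>simp add: mult_left_mono\<close>)
  qed simp
  moreover have "p * b + (1 - p) * b = b" by (simp add: algebra_simps)
  ultimately show ?thesis using assms by (simp add: powr_mult algebra_simps)
qed

text \<open>Tensorises \<open>powr_mix_le\<close>: the conditional expectations given that v is open
  or closed are ordered because f is increasing, and they play the roles of a and b. For the
  indicator of an increasing event the power on f disappears.\<close>

lemma bexp_powr_le:
  assumes "finite A" "0 < p" "p \<le> 1" "1 \<le> g"
    and "\<And>\<omega>. \<omega> \<subseteq> A \<Longrightarrow> 0 \<le> f \<omega>" "\<And>a b. a \<subseteq> b \<Longrightarrow> b \<subseteq> A \<Longrightarrow> f a \<le> f b"
  shows "bexp (\<lambda>_. p powr g) A (\<lambda>\<omega>. f \<omega> powr g) \<le> (bexp (\<lambda>_. p) A f) powr g"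
  using assms(1,5,6)
proof (induction A arbitrary: f rule: finite_induct)
  case (insert v A)
  let ?f1 = "\<lambda>\<omega>. f (insert v \<omega>)"
  have pg: "0 \<le> p powr g" "p powr g \<le> 1" using assms by (auto intro: powr_le1)
  have sub: "insert v a \<subseteq> insert v A" "a \<subseteq> insert v A" if "a \<subseteq> A" for a using that by auto
  have 0: "bexp (\<lambda>_. p powr g) A (\<lambda>\<omega>. f \<omega> powr g) \<le> (bexp (\<lambda>_. p) A f) powr g"
    using insert.prems sub by (intro insert.IH) auto
  have 1: "bexp (\<lambda>_. p powr g) A (\<lambda>\<omega>. ?f1 \<omega> powr g) \<le> (bexp (\<lambda>_. p) A ?f1) powr g"
    using insert.prems sub by (intro insert.IH) (auto intro!: insert.prems)
  have ba: "0 \<le> bexp (\<lambda>_. p) A f" "bexp (\<lambda>_. p) A f \<le> bexp (\<lambda>_. p) A ?f1"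
    using assms sub by (auto intro!: bexp_nonneg bexp_mono insert.prems)
  have "bexp (\<lambda>_. p powr g) (insert v A) (\<lambda>\<omega>. f \<omega> powr g)
      \<le> p powr g * (bexp (\<lambda>_. p) A ?f1) powr g + (1 - p powr g) * (bexp (\<lambda>_. p) A f) powr g"
    using insert.hyps 0 1 pg by (auto simp: bexp_insert intro!: add_mono mult_left_mono)
  also have "\<dots> \<le> (p * bexp (\<lambda>_. p) A ?f1 + (1 - p) * bexp (\<lambda>_. p) A f) powr g"
    by (rule powr_mix_le[OF ba assms(2-4)])
  finally show ?case using insert.hyps by (simp add: bexp_insert)
qed simp

subsection \<open>Clusters\<close>

lemma in_cluster_iff:
  "u \<in> cluster A v \<longleftrightarrow> v \<in> A \<and> (v, u) \<in> {(x, y). x \<in> A \<and> y \<in> A \<and> lattice_adj x y}\<^sup>*"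
  unfolding cluster_def by (rule mem_Collect_eq)

text \<open>The graph distance from the origin, adjacency being \<open>l1 (u - v) = 1\<close>. Balls
  are taken in this norm because one step along a path changes it by at most one.\<close>

definition l1 :: "int ^ 'd::finite \<Rightarrow> int" where
  "l1 x = (\<Sum>i\<in>UNIV. \<bar>x $ i\<bar>)"

definition l1_ball :: "int ^ 'd::finite \<Rightarrow> nat \<Rightarrow> (int ^ 'd) set" where
  "l1_ball v n = {x. l1 (x - v) \<le> int n}"

lemma adj_iff_l1: "lattice_adj u v \<longleftrightarrow> l1 (u - v) = 1"
  by (simp add: lattice_adj_def l1_def)

lemma l1_nonneg [simp]: "0 \<le> l1 x"
  by (simp add: l1_def sum_nonneg)

lemma l1_zero [simp]: "l1 0 = 0"
  by (simp add: l1_def)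

lemma l1_minus: "l1 (u - v) = l1 (v - u)"
  by (simp add: l1_def abs_minus_commute)

lemma l1_triangle: "l1 (x + y) \<le> l1 x + l1 y"
  unfolding l1_def sum.distrib[symmetric] by (intro sum_mono) simp

lemma abs_component_le_l1: "\<bar>x $ i\<bar> \<le> l1 x"
  unfolding l1_def by (rule member_le_sum) auto

lemma adj_sym: "lattice_adj u v \<longleftrightarrow> lattice_adj v u"
  by (simp add: adj_iff_l1 l1_minus)

lemma adj_add [simp]: "lattice_adj (a + u) (a + v) \<longleftrightarrow> lattice_adj u v"
  by (simp add: adj_iff_l1)

lemma adj_l1_diff: "lattice_adj x y \<Longrightarrow> l1 (y - v) \<le> l1 (x - v) + 1"
  using l1_triangle[of "y - x" "x - v"] by (simp add: adj_iff_l1 l1_minus)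

lemma adj_axis: "lattice_adj x (x + axis i 1)"
proof -
  have "\<bar>(axis i 1 :: int ^ 'a) $ j\<bar> = (if j = i then 1 else 0)" for j by (simp add: axis_def)
  then show ?thesis by (simp add: adj_iff_l1 l1_def sum.delta)
qed

lemma card_vec_box:
  "card {v :: 'b ^ 'd::finite. \<forall>i. v $ i \<in> S i} = (\<Prod>i\<in>UNIV. card (S i))"
proof -
  have "bij_betw (\<lambda>f. \<chi> i. f i) (PiE UNIV S) {v :: 'b ^ 'd. \<forall>i. v $ i \<in> S i}"
    by (rule bij_betwI[where g = vec_nth]) auto
  then show ?thesis by (simp add: bij_betw_same_card[symmetric] card_PiE)
qed

lemma finite_vec_box:
  assumes "\<And>i. finite (S i)"
  shows "finite {v :: 'b ^ 'd::finite. \<forall>i. v $ i \<in> S i}"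
proof -
  have "bij_betw (\<lambda>f. \<chi> i. f i) (PiE UNIV S) {v :: 'b ^ 'd. \<forall>i. v $ i \<in> S i}"
    by (rule bij_betwI[where g = vec_nth]) auto
  moreover have "finite (PiE UNIV S)" using assms by (intro finite_PiE) auto
  ultimately show ?thesis using bij_betw_finite by blast
qed

lemma l1_ball_subset: "l1_ball v n \<subseteq> {x. \<forall>i. x $ i \<in> {v $ i - int n..v $ i + int n}}"
proof (clarify)
  fix x i assume "x \<in> l1_ball v n"
  then have "\<bar>(x - v) $ i\<bar> \<le> int n"
    using abs_component_le_l1[of "x - v" i] by (simp add: l1_ball_def)
  then show "x $ i \<in> {v $ i - int n..v $ i + int n}" by auto
qed

lemma finite_l1_ball [simp]: "finite (l1_ball v n)"
  by (rule finite_subset[OF l1_ball_subset finite_vec_box]) simp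

lemma card_l1_ball: "card (l1_ball v n :: (int ^ 'd::finite) set) \<le> (2 * n + 1) ^ CARD('d)"
proof -
  have "card (l1_ball v n) \<le> card {x :: int ^ 'd. \<forall>i. x $ i \<in> {v $ i - int n..v $ i + int n}}"
    by (intro card_mono finite_vec_box l1_ball_subset) simp
  also have "\<dots> = (\<Prod>i\<in>(UNIV::'d set). 2 * n + 1)"
    unfolding card_vec_box by (intro prod.cong) auto
  finally show ?thesis by simp
qed

lemma l1_ball_translate: "l1_ball v n = (+) v ` l1_ball 0 n"
proof -
  have "x \<in> (+) v ` l1_ball 0 n" if "l1 (x - v) \<le> int n" for x
    using that by (intro image_eqI[of _ _ "x - v"]) (auto simp: l1_ball_def)
  then show ?thesis by (auto simp: l1_ball_def)
qed

lemma self_in_l1_ball [simp]: "v \<in> l1_ball v n"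
  by (simp add: l1_ball_def)

lemma finite_neighbours: "finite {y. lattice_adj x y}"
proof (rule finite_subset[OF _ finite_l1_ball[of x 1]])
  show "{y. lattice_adj x y} \<subseteq> l1_ball x 1"
    using l1_minus[of x] by (auto simp: l1_ball_def adj_iff_l1)
qed

section \<open>Connected components of induced subgraphs\<close>

lemma cluster_subset: "cluster A v \<subseteq> A"
proof
  fix u assume "u \<in> cluster A v"
  then have "v \<in> A" "(v, u) \<in> {(x, y). x \<in> A \<and> y \<in> A \<and> lattice_adj x y}\<^sup>*"
    unfolding in_cluster_iff by blast+
  from this(2,1) show "u \<in> A" by (cases rule: rtranclE) auto
qed

lemma cluster_self: "v \<in> A \<Longrightarrow> v \<in> cluster A v"
  unfolding in_cluster_iff by blast

lemma cluster_empty: "v \<notin> A \<Longrightarrow> cluster A v = {}"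
  by (simp add: cluster_def)

lemma cluster_source: "u \<in> cluster A v \<Longrightarrow> v \<in> A"
  unfolding in_cluster_iff by blast

lemma cluster_step:
  assumes "x \<in> cluster A v" "y \<in> A" "lattice_adj x y"
  shows "y \<in> cluster A v"
proof -
  have "(v, y) \<in> {(x, y). x \<in> A \<and> y \<in> A \<and> lattice_adj x y}\<^sup>*"
    using assms(1) unfolding in_cluster_iff
    by (elim conjE rtrancl_into_rtrancl) (use assms cluster_subset[of A v] in auto)
  then show ?thesis using assms(1) unfolding in_cluster_iff by (elim conjE) (rule conjI)
qed

lemma cluster_induct [consumes 1, case_names base step]:
  assumes "u \<in> cluster A v"
    and "v \<in> A \<Longrightarrow> P v"
    and "\<And>x y. x \<in> cluster A v \<Longrightarrow> P x \<Longrightarrow> y \<in> A \<Longrightarrow> lattice_adj x y \<Longrightarrow> P y"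
  shows "P u"
proof -
  have v: "v \<in> A" and "(v, u) \<in> {(x, y). x \<in> A \<and> y \<in> A \<and> lattice_adj x y}\<^sup>*"
    using assms(1) unfolding in_cluster_iff by blast+
  from this(2) show ?thesis
  proof (induction rule: rtrancl_induct)
    case (step x y)
    have "x \<in> cluster A v" unfolding in_cluster_iff using v step(1) by (rule conjI)
    then show ?case using step(2,3) assms(3) by blast
  qed (rule assms(2)[OF v])
qed

lemma cluster_least:
  assumes "v \<in> A \<Longrightarrow> v \<in> C"
    and "\<And>x y. x \<in> cluster A v \<Longrightarrow> x \<in> C \<Longrightarrow> y \<in> A \<Longrightarrow> lattice_adj x y \<Longrightarrow> y \<in> C"
  shows "cluster A v \<subseteq> C"
proof
  fix u assume "u \<in> cluster A v"
  then show "u \<in> C" by (induction rule: cluster_induct) (use assms in auto)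
qed

lemma cluster_mono: "A \<subseteq> B \<Longrightarrow> cluster A v \<subseteq> cluster B v"
  by (rule cluster_least) (auto intro: cluster_self cluster_step)

lemma cluster_trans: "u \<in> cluster A v \<Longrightarrow> cluster A u \<subseteq> cluster A v"
  by (rule cluster_least) (auto intro: cluster_step)

lemma cluster_sym:
  assumes "u \<in> cluster A v"
  shows "v \<in> cluster A u"
  using assms
proof (induction rule: cluster_induct)
  case (step x y)
  have "x \<in> A" using step(1) cluster_subset by blast
  then have "x \<in> cluster A y"
    using cluster_step[OF cluster_self[OF step.hyps(2)]] step.hyps(3) adj_sym[of x y] by simp
  then show ?case using cluster_trans step.IH by blast
qed (rule cluster_self)

lemma cluster_eq: "u \<in> cluster A v \<Longrightarrow> cluster A u = cluster A v"
  using cluster_sym cluster_trans by blast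

lemma cluster_restrict: "cluster A v \<subseteq> B \<Longrightarrow> cluster A v = cluster (A \<inter> B) v"
proof
  assume B: "cluster A v \<subseteq> B"
  show "cluster A v \<subseteq> cluster (A \<inter> B) v"
  proof (rule cluster_least)
    assume "v \<in> A"
    then show "v \<in> cluster (A \<inter> B) v" using B cluster_self[of v A] by (auto intro: cluster_self)
  next
    fix x y assume "x \<in> cluster A v" "x \<in> cluster (A \<inter> B) v" "y \<in> A" "lattice_adj x y"
    then show "y \<in> cluster (A \<inter> B) v"
      using B cluster_step[of x A v y] by (auto intro: cluster_step)
  qed
qed (simp add: cluster_mono)

lemma cluster_translate:
  "cluster ((+) a ` A) (a + v) = (+) a ` cluster A v"
proof
  show "cluster ((+) a ` A) (a + v) \<subseteq> (+) a ` cluster A v"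
  proof (rule cluster_least)
    assume "a + v \<in> (+) a ` A"
    then show "a + v \<in> (+) a ` cluster A v" by (simp add: inj_image_mem_iff cluster_self)
  next
    fix x y assume "x \<in> (+) a ` cluster A v" "y \<in> (+) a ` A" "lattice_adj x y"
    then show "y \<in> (+) a ` cluster A v" by (auto intro!: imageI intro: cluster_step)
  qed
  have "a + u \<in> cluster ((+) a ` A) (a + v)" if "u \<in> cluster A v" for u
    using that
  proof (induction rule: cluster_induct)
    case (step x y)
    then show ?case by (auto intro: cluster_step)
  qed (auto intro: cluster_self)
  then show "(+) a ` cluster A v \<subseteq> cluster ((+) a ` A) (a + v)" by auto
qed

lemma card_cluster_translate: "card (cluster ((+) a ` A) (a + v)) = card (cluster A v)"
  unfolding cluster_translate by (rule card_image) (simp add: inj_on_def)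

text \<open>A discrete intermediate value theorem: along a path inside the cluster f rises by at
  most one per step, so it cannot jump over j.\<close>

lemma cluster_level:
  fixes f :: "int ^ 'd::finite \<Rightarrow> int"
  assumes "u \<in> cluster A v" "\<And>x y. lattice_adj x y \<Longrightarrow> f y \<le> f x + 1"
    and "f v \<le> j" "j \<le> f u"
  shows "\<exists>w\<in>cluster A v. f w = j"
  using assms(1,4)
proof (induction rule: cluster_induct)
  case base
  then have "f v = j" "v \<in> cluster A v" using assms(3) by (auto intro: cluster_self)
  then show ?case by auto
next
  case (step x y)
  show ?case
  proof (cases "j \<le> f x")
    case False
    then have "f y = j" using assms(2)[OF step.hyps(3)] step.prems by simp
    then show ?thesis using cluster_step[OF step.hyps] by auto
  qed (use step in auto)
qed

text \<open>A path from v to u meets each of the distances 0, ..., n from v, which gives n + 1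
  different sites.\<close>

lemma card_cluster_ge_distance:
  assumes "u \<in> cluster A v" "int n \<le> l1 (u - v)" "finite (cluster A v)"
  shows "n + 1 \<le> card (cluster A v)"
proof -
  have "int ` {0..n} \<subseteq> (\<lambda>w. l1 (w - v)) ` cluster A v"
  proof clarify
    fix j assume "j \<in> {0..n}"
    then have "\<exists>w\<in>cluster A v. l1 (w - v) = int j"
      using assms(2) by (intro cluster_level[OF assms(1)] adj_l1_diff) auto
    then show "int j \<in> (\<lambda>w. l1 (w - v)) ` cluster A v" by force
  qed
  then have "card (int ` {0..n}) \<le> card ((\<lambda>w. l1 (w - v)) ` cluster A v)"
    using assms(3) by (intro card_mono) auto
  also have "\<dots> \<le> card (cluster A v)" using assms(3) by (rule card_image_le)
  finally show ?thesis by (simp add: card_image)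
qed

text \<open>Either the cluster inside the ball reaches distance n and then has n + 1 sites already,
  or it stays strictly inside and is the whole cluster. The infinite case is listed separately
  because \<open>card\<close> of an infinite set is 0.\<close>

lemma cluster_localize:
  "(infinite (cluster A v) \<or> n \<le> card (cluster A v)) \<longleftrightarrow> n \<le> card (cluster (A \<inter> l1_ball v n) v)"
proof
  let ?C = "cluster (A \<inter> l1_ball v n) v"
  have fin: "finite ?C" by (rule finite_subset[OF cluster_subset]) simp
  have sub: "?C \<subseteq> cluster A v" by (simp add: cluster_mono)
  {
    assume L: "infinite (cluster A v) \<or> n \<le> card (cluster A v)"
    show "n \<le> card ?C"
    proof (cases "\<exists>u\<in>?C. int n \<le> l1 (u - v)")
      case True
      then show ?thesis using card_cluster_ge_distance fin by fastforce
    next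
      case False
      have "cluster A v \<subseteq> ?C"
      proof (rule cluster_least)
        assume "v \<in> A" then show "v \<in> ?C" by (intro cluster_self) simp
      next
        fix x y assume xy: "x \<in> ?C" "y \<in> A" "lattice_adj x y"
        then have "l1 (x - v) < int n" using False by force
        then have "y \<in> l1_ball v n" using adj_l1_diff[OF xy(3), of v] by (simp add: l1_ball_def)
        then show "y \<in> ?C" using xy cluster_step by blast
      qed
      then have "cluster A v = ?C" using sub by auto
      then show ?thesis using L fin by auto
    qed
  }
  assume "n \<le> card ?C"
  then show "infinite (cluster A v) \<or> n \<le> card (cluster A v)"
    using card_mono[OF _ sub] by (meson order_trans)
qed

lemma card_cluster_localize:
  assumes "finite A"
  shows "n \<le> card (cluster A v) \<longleftrightarrow> n \<le> card (cluster (A \<inter> l1_ball v n) v)"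
  using cluster_localize[of A v n] finite_subset[OF cluster_subset assms] by auto

lemma card_cluster_mono:
  assumes "finite B" "A \<subseteq> B"
  shows "card (cluster A v) \<le> card (cluster B v)"
  by (intro card_mono cluster_mono assms finite_subset[OF cluster_subset])

section \<open>Probabilities of large clusters on finite vertex sets\<close>

lemma bexp_mono_set:
  assumes "finite B" "A \<subseteq> B" "\<And>v. v \<in> B \<Longrightarrow> 0 \<le> p v \<and> p v \<le> 1"
    and "\<And>a b. a \<subseteq> b \<Longrightarrow> b \<subseteq> B \<Longrightarrow> f a \<le> f b"
  shows "bexp p A f \<le> bexp p B f"
proof -
  have fin: "finite A" using assms(2,1) by (rule finite_subset)
  have "bexp p A f = bexp p A (\<lambda>a. bexp p (B - A) (\<lambda>_. f a))"
    using assms(1) by (simp add: bexp_const)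
  also have "\<dots> \<le> bexp p A (\<lambda>a. bexp p (B - A) (\<lambda>b. f (a \<union> b)))"
    by (intro bexp_mono) (use assms in \<open>auto intro!: assms(4)\<close>)
  also have "\<dots> = bexp p (A \<union> (B - A)) f"
    using assms fin by (intro bexp_Un[symmetric]) auto
  finally show ?thesis using assms(2) by (simp add: Un_absorb1)
qed

lemma of_bool_mono: "(P \<Longrightarrow> Q) \<Longrightarrow> (of_bool P :: real) \<le> of_bool Q"
  by auto

text \<open>By \<open>card_cluster_localize\<close>, \<open>reach p n B\<close> is the probability that the cluster of the origin
  in site percolation restricted to \<open>B\<close> has at least \<open>n\<close> sites.\<close>

definition reach :: "real \<Rightarrow> nat \<Rightarrow> (int ^ 'd::finite) set \<Rightarrow> real" where
  "reach p n B = bprob (\<lambda>_. p) (l1_ball 0 n \<inter> B) (\<lambda>\<omega>. n \<le> card (cluster \<omega> 0))"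

lemma translate_Int: "(+) (x::int ^ 'd::finite) ` (A \<inter> B) = (+) x ` A \<inter> (+) x ` B"
  by (rule image_Int) (simp add: inj_on_def)

text \<open>Only sites within distance n of x matter, and translation by x identifies them with the
  ball around the origin; the second hypothesis says that A contains all of them that lie in the
  translate of B.\<close>

lemma bprob_cluster_eq_reach:
  assumes "finite A" "(+) x ` (l1_ball 0 n \<inter> B) \<subseteq> A"
  shows "bprob (\<lambda>_. p) A (\<lambda>\<omega>. n \<le> card (cluster (\<omega> \<inter> (+) x ` B) x)) = reach p n B"
proof -
  let ?T = "(+) x ` (l1_ball 0 n \<inter> B)"
  have T: "?T = (+) x ` B \<inter> l1_ball x n"
    unfolding translate_Int l1_ball_translate[of x, symmetric] by auto
  have "bprob (\<lambda>_. p) A (\<lambda>\<omega>. n \<le> card (cluster (\<omega> \<inter> (+) x ` B) x))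
      = bprob (\<lambda>_. p) A (\<lambda>\<omega>. n \<le> card (cluster (\<omega> \<inter> ?T) x))"
  proof (rule bexp_cong)
    fix \<omega> assume "\<omega> \<subseteq> A"
    then have "finite (\<omega> \<inter> (+) x ` B)" using finite_subset[OF _ assms(1)] by simp
    then show "of_bool (n \<le> card (cluster (\<omega> \<inter> (+) x ` B) x))
        = (of_bool (n \<le> card (cluster (\<omega> \<inter> ?T) x)) :: real)"
      unfolding T by (subst card_cluster_localize) (simp_all add: Int_assoc)
  qed
  also have "\<dots> = bprob (\<lambda>_. p) ?T (\<lambda>\<omega>. n \<le> card (cluster (\<omega> \<inter> ?T) x))"
    using assms by (intro bexp_restrict) auto
  also have "\<dots> = bprob (\<lambda>_. p) (l1_ball 0 n \<inter> B) (\<lambda>\<omega>. n \<le> card (cluster ((+) x ` \<omega> \<inter> ?T) x))"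
    by (subst bexp_image) (auto simp: inj_on_def comp_def)
  also have "\<dots> = reach p n B"
    unfolding reach_def
  proof (rule bexp_cong)
    fix \<omega> assume "\<omega> \<subseteq> l1_ball 0 n \<inter> B"
    then have "(+) x ` \<omega> \<inter> ?T = (+) x ` \<omega>" by auto
    then show "of_bool (n \<le> card (cluster ((+) x ` \<omega> \<inter> ?T) x))
        = (of_bool (n \<le> card (cluster \<omega> 0)) :: real)"
      using card_cluster_translate[of x \<omega> 0] by simp
  qed
  finally show ?thesis .
qed

text \<open>Near the edge of A a part of the ball around x is missing. Adding it can only enlarge
  the cluster.\<close>

lemma bprob_cluster_le_reach:
  assumes "finite A" "0 \<le> p" "p \<le> 1"
  shows "bprob (\<lambda>_. p) A (\<lambda>\<omega>. n \<le> card (cluster (\<omega> \<inter> (+) x ` B) x)) \<le> reach p n B"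
proof -
  let ?T = "(+) x ` (l1_ball 0 n \<inter> B)"
  have fin: "finite (A \<union> ?T)" using assms by auto
  have "bprob (\<lambda>_. p) A (\<lambda>\<omega>. n \<le> card (cluster (\<omega> \<inter> (+) x ` B) x))
      \<le> bprob (\<lambda>_. p) (A \<union> ?T) (\<lambda>\<omega>. n \<le> card (cluster (\<omega> \<inter> (+) x ` B) x))"
  proof (rule bexp_mono_set[OF fin])
    fix a b assume ab: "a \<subseteq> b" "b \<subseteq> A \<union> ?T"
    have "finite b" using ab(2) fin by (rule finite_subset)
    then have "card (cluster (a \<inter> (+) x ` B) x) \<le> card (cluster (b \<inter> (+) x ` B) x)"
      using ab by (intro card_cluster_mono) auto
    then show "of_bool (n \<le> card (cluster (a \<inter> (+) x ` B) x))
        \<le> (of_bool (n \<le> card (cluster (b \<inter> (+) x ` B) x)) :: real)"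
      by (intro of_bool_mono) simp
  qed (use assms in auto)
  also have "\<dots> = reach p n B"
    using fin by (intro bprob_cluster_eq_reach) auto
  finally show ?thesis .
qed

lemmas bprob_le_reach = bprob_cluster_le_reach[where B = UNIV, simplified]
lemmas bprob_eq_reach = bprob_cluster_eq_reach[where B = UNIV, simplified, folded l1_ball_translate]

lemma reach_bounds:
  assumes "0 \<le> p" "p \<le> 1"
  shows "0 \<le> reach p n B" "reach p n B \<le> 1"
  unfolding reach_def using assms by (auto intro!: bexp_nonneg bprob_le_1)

lemma reach_mono_p:
  assumes "0 \<le> p" "p \<le> q" "q \<le> 1"
  shows "reach p n B \<le> reach q n B"
  unfolding reach_def
proof (rule bexp_mono_p)
  fix a b :: "(int ^ 'a) set" assume ab: "a \<subseteq> b" "b \<subseteq> l1_ball 0 n \<inter> B"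
  then have "card (cluster a 0) \<le> card (cluster b 0)"
    using finite_subset[OF ab(2)] by (intro card_cluster_mono) auto
  then show "of_bool (n \<le> card (cluster a 0)) \<le> (of_bool (n \<le> card (cluster b 0)) :: real)"
    by (intro of_bool_mono) simp
qed (use assms in auto)

subsection \<open>Exponential decay under a finite criterion\<close>

text \<open>The exits lie outside S and may be open or closed. Their states are left to the next
  stage of an exploration, so that the number of exits depends only on the configuration inside
  S.\<close>

definition exits :: "(int ^ 'd::finite) set \<Rightarrow> (int ^ 'd) set \<Rightarrow> (int ^ 'd) set" where
  "exits C S = {y. y \<notin> S \<and> (\<exists>z\<in>C. lattice_adj z y)}"

lemma exits_mono: "C \<subseteq> C' \<Longrightarrow> exits C S \<subseteq> exits C' S"
  by (auto simp: exits_def)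

lemma finite_exits: "finite C \<Longrightarrow> finite (exits C S)"
  by (rule finite_subset[of _ "\<Union>z\<in>C. {y. lattice_adj z y}"])
    (auto simp: exits_def finite_neighbours)

lemma exits_translate: "exits ((+) x ` C) ((+) x ` S) = (+) x ` exits C S"
proof
  show "exits ((+) x ` C) ((+) x ` S) \<subseteq> (+) x ` exits C S"
  proof
    fix y assume y: "y \<in> exits ((+) x ` C) ((+) x ` S)"
    define u where "u = y - x"
    have "y = x + u" by (simp add: u_def)
    then show "y \<in> (+) x ` exits C S" using y by (auto simp: exits_def)
  qed
qed (auto simp: exits_def)

lemma card_exits_cluster_translate:
  "card (exits (cluster ((+) x ` \<omega>) x) ((+) x ` S)) = card (exits (cluster \<omega> 0) S)"
proof -
  have "cluster ((+) x ` \<omega>) x = (+) x ` cluster \<omega> 0"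
    using cluster_translate[of x \<omega> 0] by simp
  then show ?thesis by (simp add: exits_translate card_image inj_on_def)
qed

text \<open>The site percolation version of the quantity \<open>\<phi>\<^sub>p(S)\<close> of Duminil-Copin and Tassion.\<close>

definition exit_mean :: "real \<Rightarrow> (int ^ 'd::finite) set \<Rightarrow> real" where
  "exit_mean p S = bexp (\<lambda>_. p) S (\<lambda>\<omega>. real (card (exits (cluster \<omega> 0) S)))"

lemma exit_mean_mono:
  fixes S :: "(int ^ 'd::finite) set"
  assumes "finite S" "0 \<le> p" "p \<le> q" "q \<le> 1"
  shows "exit_mean p S \<le> exit_mean q S"
  unfolding exit_mean_def
proof (rule bexp_mono_p)
  fix a b :: "(int ^ 'd) set" assume ab: "a \<subseteq> b" "b \<subseteq> S"
  have "finite (cluster b 0)"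
    using finite_subset[OF cluster_subset] finite_subset[OF ab(2)] assms by auto
  then show "real (card (exits (cluster a 0) S)) \<le> real (card (exits (cluster b 0) S))"
    using ab by (simp add: card_mono finite_exits exits_mono cluster_mono)
qed (use assms in auto)

text \<open>The set T collects the sites inspected while D is explored: the open sites D, their
  neighbours in S, which are found closed, and x, whose state decides whether D is empty. Hence the
  event is determined by T.\<close>

lemma cluster_explored_iff:
  assumes T: "T = D \<union> (exits D D \<inter> S) \<union> {x}"
  shows "cluster (\<omega> \<inter> S) x = D \<longleftrightarrow> cluster (\<omega> \<inter> T \<inter> S) x = D"
proof
  assume D: "cluster (\<omega> \<inter> S) x = D"
  have "cluster (\<omega> \<inter> S) x \<subseteq> T" unfolding D T by auto
  then have "cluster (\<omega> \<inter> S) x = cluster (\<omega> \<inter> S \<inter> T) x" by (rule cluster_restrict)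
  then show "cluster (\<omega> \<inter> T \<inter> S) x = D" using D by (simp only: Int_assoc Int_commute[of S])
next
  assume D: "cluster (\<omega> \<inter> T \<inter> S) x = D"
  have "cluster (\<omega> \<inter> S) x \<subseteq> D"
  proof (rule cluster_least)
    assume "x \<in> \<omega> \<inter> S"
    then have "x \<in> \<omega> \<inter> T \<inter> S" using T by auto
    then show "x \<in> D" using cluster_self[of x "\<omega> \<inter> T \<inter> S"] D by simp
  next
    fix u y assume uy: "u \<in> D" "y \<in> \<omega> \<inter> S" "lattice_adj u y"
    show "y \<in> D"
    proof (rule ccontr)
      assume "y \<notin> D"
      then have "y \<in> \<omega> \<inter> T \<inter> S" using uy T by (auto simp: exits_def)
      then show False
        using cluster_step[of u "\<omega> \<inter> T \<inter> S" x y] uy D \<open>y \<notin> D\<close> by simp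
    qed
  qed
  moreover have "D \<subseteq> cluster (\<omega> \<inter> S) x"
    unfolding D[symmetric] by (rule cluster_mono) auto
  ultimately show "cluster (\<omega> \<inter> S) x = D" by auto
qed

text \<open>Inspected sites outside D are closed, so an open site is in D or uninspected. A path
  that steps from D to an uninspected site must leave S, hence passes through an exit, and that exit
  becomes a new source.\<close>

lemma clusters_after_exploration:
  assumes D: "cluster (\<omega> \<inter> S) x = D" and T: "T = D \<union> (exits D D \<inter> S) \<union> {x}"
    and x: "x \<in> Y" "x \<in> S"
  shows "(\<Union>y\<in>Y. cluster \<omega> y) \<subseteq> D \<union> (\<Union>y\<in>(Y - {x}) \<union> exits D S. cluster (\<omega> - T) y)"
proof -
  let ?U = "D \<union> (\<Union>y\<in>(Y - {x}) \<union> exits D S. cluster (\<omega> - T) y)"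
  have split: "v \<in> D \<or> v \<in> \<omega> - T" if "v \<in> \<omega>" for v
  proof -
    have "v \<in> D" if "v \<in> exits D D" "v \<in> S"
    proof -
      from \<open>v \<in> exits D D\<close> obtain z where "z \<in> D" "lattice_adj z v" by (auto simp: exits_def)
      then show ?thesis
        using cluster_step[of z "\<omega> \<inter> S" x v] \<open>v \<in> S\<close> \<open>v \<in> \<omega>\<close> D by blast
    qed
    moreover have "v \<in> D" if "v = x" using that \<open>v \<in> \<omega>\<close> x D cluster_self[of x "\<omega> \<inter> S"] by simp
    ultimately show ?thesis using that T by auto
  qed
  have "cluster \<omega> y \<subseteq> ?U" if y: "y \<in> Y" for y
  proof (rule cluster_least)
    assume "y \<in> \<omega>"
    then show "y \<in> ?U"
      using split[of y] y cluster_self[of y "\<omega> - T"] T by (cases "y = x") auto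
  next
    fix u w assume uw: "u \<in> ?U" "w \<in> \<omega>" "lattice_adj u w"
    show "w \<in> ?U"
    proof (cases "w \<in> D")
      case False
      then have w: "w \<in> \<omega> - T" using split uw by auto
      show ?thesis
      proof (cases "u \<in> D")
        case True
        then have "w \<in> exits D D" using False uw by (auto simp: exits_def)
        then have "w \<notin> S" using w T by auto
        then have "w \<in> exits D S" using True uw by (auto simp: exits_def)
        then show ?thesis using cluster_self[OF w] by blast
      next
        case False
        then obtain y' where "y' \<in> (Y - {x}) \<union> exits D S" "u \<in> cluster (\<omega> - T) y'"
          using uw by auto
        then show ?thesis using cluster_step[OF _ w uw(3)] by blast
      qed
    qed simp
  qed
  then show ?thesis by auto
qed

text \<open>Exploring the cluster of a source \<open>x\<close> inside \<open>x + S\<close> replaces the source by the sites where this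
  cluster exits \<open>x + S\<close>; the sites not yet inspected are still independent. So the cluster is
  dominated by the total progeny of a branching process, and the bound passes from smaller
  vertex sets to larger ones.\<close>

lemma exp_moment_clusters:
  fixes S A Y :: "(int ^ 'd::finite) set" and l G :: real
  assumes "finite S" "0 \<in> S" "0 \<le> p" "p \<le> 1" "0 \<le> l" "1 \<le> G"
    and G: "bexp (\<lambda>_. p) S (\<lambda>\<omega>. exp (l * card (cluster \<omega> 0)) * G ^ card (exits (cluster \<omega> 0) S)) \<le> G"
    and "finite A" "finite Y"
  shows "bexp (\<lambda>_. p) A (\<lambda>\<omega>. exp (l * card (\<Union>y\<in>Y. cluster \<omega> y))) \<le> G ^ card Y"
  using assms(8,9)
proof (induction A arbitrary: Y rule: finite_psubset_induct)
  case (psubset A)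
  let ?F = "\<lambda>Y \<omega>. exp (l * card (\<Union>y\<in>Y. cluster \<omega> y))"
  show ?case
  proof (cases "\<exists>x. x \<in> Y \<inter> A")
    case False
    have "bexp (\<lambda>_. p) A (?F Y) = bexp (\<lambda>_. p) A (\<lambda>_. 1)"
    proof (rule bexp_cong)
      fix \<omega> assume "\<omega> \<subseteq> A"
      then have "(\<Union>y\<in>Y. cluster \<omega> y) = {}" using False by (auto dest: cluster_source)
      then show "?F Y \<omega> = 1" by simp
    qed
    then show ?thesis using psubset assms by (simp add: bexp_const)
  next
    case True
    then obtain x where x: "x \<in> Y" "x \<in> A" by auto
    define Sx where "Sx = (+) x ` S"
    have xS: "x \<in> Sx" using assms(2) by (force simp: Sx_def)
    define T where "T D = D \<union> (exits D D \<inter> Sx) \<union> {x}" for D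
    let ?I = "\<lambda>D \<omega>. of_bool (cluster (\<omega> \<inter> Sx) x = D) :: real"
    let ?Z = "\<lambda>D. (Y - {x}) \<union> exits D Sx"
    have finD: "finite D" if "D \<in> Pow A" for D using that psubset.hyps finite_subset by auto
    have decomp: "bexp (\<lambda>_. p) A f = (\<Sum>D\<in>Pow A. bexp (\<lambda>_. p) A (\<lambda>\<omega>. ?I D \<omega> * f \<omega>))" for f
    proof -
      have "bexp (\<lambda>_. p) A f = bexp (\<lambda>_. p) A (\<lambda>\<omega>. \<Sum>D\<in>Pow A. ?I D \<omega> * f \<omega>)"
      proof (rule bexp_cong)
        fix \<omega> assume "\<omega> \<subseteq> A"
        then have "cluster (\<omega> \<inter> Sx) x \<in> Pow A" using cluster_subset by blast
        then have "(\<Sum>D\<in>Pow A. ?I D \<omega>) = 1"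
          using psubset.hyps by (simp add: of_bool_def sum.delta)
        then show "f \<omega> = (\<Sum>D\<in>Pow A. ?I D \<omega> * f \<omega>)"
          by (simp add: sum_distrib_right[symmetric])
      qed
      then show ?thesis by (simp add: bexp_sum)
    qed
    have bnd: "bexp (\<lambda>_. p) A (\<lambda>\<omega>. ?I D \<omega> * ?F Y \<omega>)
      \<le> bexp (\<lambda>_. p) A (\<lambda>\<omega>. ?I D \<omega> * (exp (l * card (cluster (\<omega> \<inter> Sx) x)) * G ^ card (exits (cluster (\<omega> \<inter> Sx) x) Sx)))
         * G ^ card (Y - {x})" if D: "D \<in> Pow A" for D
    proof -
      have finZ: "finite (?Z D)" using psubset.prems finite_exits finD[OF D] by auto
      have "bexp (\<lambda>_. p) A (\<lambda>\<omega>. ?I D \<omega> * ?F Y \<omega>)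
          \<le> bexp (\<lambda>_. p) A (\<lambda>\<omega>. ?I D \<omega> * (exp (l * card D) * ?F (?Z D) (\<omega> - T D)))"
      proof (rule bexp_mono)
        fix \<omega> assume w: "\<omega> \<subseteq> A"
        show "?I D \<omega> * ?F Y \<omega> \<le> ?I D \<omega> * (exp (l * card D) * ?F (?Z D) (\<omega> - T D))"
        proof (cases "cluster (\<omega> \<inter> Sx) x = D")
          case True
          have fw: "finite (\<omega> - T D)" using w psubset.hyps finite_subset by auto
          have fin: "finite (\<Union>y\<in>?Z D. cluster (\<omega> - T D) y)"
            using finZ finite_subset[OF cluster_subset fw] by auto
          have "card (\<Union>y\<in>Y. cluster \<omega> y) \<le> card (D \<union> (\<Union>y\<in>?Z D. cluster (\<omega> - T D) y))"
            using clusters_after_exploration[OF True T_def x(1) xS] fin finD[OF D]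
            by (intro card_mono) auto
          also have "\<dots> \<le> card D + card (\<Union>y\<in>?Z D. cluster (\<omega> - T D) y)" by (rule card_Un_le)
          finally have "l * real (card (\<Union>y\<in>Y. cluster \<omega> y))
             \<le> l * (real (card D) + real (card (\<Union>y\<in>?Z D. cluster (\<omega> - T D) y)))"
            using assms(5) by (intro mult_left_mono) linarith+
          then show ?thesis using True by (simp add: exp_add[symmetric] distrib_left)
        qed simp
      qed (use assms in auto)
      also have "\<dots> = bexp (\<lambda>_. p) (A \<inter> T D) (?I D) *
           bexp (\<lambda>_. p) (A - T D) (\<lambda>\<omega>. exp (l * card D) * ?F (?Z D) (\<omega> - T D))"
      proof (rule bexp_indep[OF psubset.hyps])
        show "?I D \<omega> = ?I D (\<omega> \<inter> T D)" for \<omega>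
          using cluster_explored_iff[OF T_def] by simp
      qed simp
      also have "bexp (\<lambda>_. p) (A \<inter> T D) (?I D) = bexp (\<lambda>_. p) A (?I D)"
        using psubset.hyps cluster_explored_iff[OF T_def, of _ D]
        by (intro bexp_restrict[symmetric]) (auto simp: Int_absorb2 Int_assoc[symmetric])
      also have "bexp (\<lambda>_. p) (A - T D) (\<lambda>\<omega>. exp (l * card D) * ?F (?Z D) (\<omega> - T D))
          = exp (l * card D) * bexp (\<lambda>_. p) (A - T D) (?F (?Z D))"
        unfolding bexp_cmult
      proof (intro arg_cong2[where f = "(*)"] refl bexp_cong)
        fix \<omega> assume "\<omega> \<subseteq> A - T D"
        then have "\<omega> - T D = \<omega>" by auto
        then show "?F (?Z D) (\<omega> - T D) = ?F (?Z D) \<omega>" by simp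
      qed
      \<comment> \<open>\<open>T D\<close> contains x, which lies in A, so \<open>A - T D\<close> is
        a proper subset of A and the induction hypothesis applies to the new sources.\<close>
      also have "bexp (\<lambda>_. p) (A - T D) (?F (?Z D)) \<le> G ^ card (?Z D)"
        using x finZ by (intro psubset.IH) (auto simp: T_def)
      also have "\<dots> \<le> G ^ (card (Y - {x}) + card (exits D Sx))"
        using assms(6) by (intro power_increasing card_Un_le) auto
      finally have "bexp (\<lambda>_. p) A (\<lambda>\<omega>. ?I D \<omega> * ?F Y \<omega>)
          \<le> bexp (\<lambda>_. p) A (?I D) * (exp (l * card D) * (G ^ card (Y - {x}) * G ^ card (exits D Sx)))"
        using assms by (simp add: mult_left_mono bexp_nonneg power_add)
      also have "\<dots> = bexp (\<lambda>_. p) A (\<lambda>\<omega>. (exp (l * card D) * G ^ card (exits D Sx)) * ?I D \<omega>)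
          * G ^ card (Y - {x})"
        by (simp add: bexp_cmult)
      also have "bexp (\<lambda>_. p) A (\<lambda>\<omega>. (exp (l * card D) * G ^ card (exits D Sx)) * ?I D \<omega>)
         = bexp (\<lambda>_. p) A (\<lambda>\<omega>. ?I D \<omega> * (exp (l * card (cluster (\<omega> \<inter> Sx) x)) * G ^ card (exits (cluster (\<omega> \<inter> Sx) x) Sx)))"
        by (rule bexp_cong) simp
      finally show ?thesis .
    qed
    let ?h = "\<lambda>\<omega>. exp (l * card (cluster (\<omega> \<inter> Sx) x)) * G ^ card (exits (cluster (\<omega> \<inter> Sx) x) Sx)"
    have finSx: "finite Sx" using assms by (simp add: Sx_def)
    have "bexp (\<lambda>_. p) A (?F Y) \<le> bexp (\<lambda>_. p) A ?h * G ^ card (Y - {x})"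
      unfolding decomp[of "?F Y"] decomp[of ?h] sum_distrib_right by (rule sum_mono[OF bnd])
    \<comment> \<open>Near the edge of A only a part of the translate \<open>Sx\<close> is
      available. The integrand is increasing, so completing the translate gives an upper bound, and
      this bound is the same for every x.\<close>
    also have "bexp (\<lambda>_. p) A ?h \<le> bexp (\<lambda>_. p) (A \<union> Sx) ?h"
    proof (rule bexp_mono_set)
      fix a b :: "(int ^ 'd) set" assume ab: "a \<subseteq> b" "b \<subseteq> A \<union> Sx"
      have fin: "finite (cluster (b \<inter> Sx) x)"
        by (rule finite_subset[OF cluster_subset]) (simp add: finSx)
      have sub: "cluster (a \<inter> Sx) x \<subseteq> cluster (b \<inter> Sx) x" using ab by (intro cluster_mono) auto
      show "?h a \<le> ?h b"
        using assms(5,6) sub fin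
        by (intro mult_mono power_increasing card_mono finite_exits exits_mono)
          (auto intro!: mult_left_mono card_mono)
    qed (use psubset.hyps finSx assms in auto)
    also have "\<dots> = bexp (\<lambda>_. p) Sx ?h"
      using psubset.hyps finSx by (intro bexp_restrict) auto
    also have "\<dots> = bexp (\<lambda>_. p) S (\<lambda>\<omega>. exp (l * card (cluster \<omega> 0)) * G ^ card (exits (cluster \<omega> 0) S))"
    proof -
      have "bexp (\<lambda>_. p) Sx ?h = bexp ((\<lambda>_. p) \<circ> (+) x) S (\<lambda>\<omega>. ?h ((+) x ` \<omega>))"
        unfolding Sx_def using assms(1) by (intro bexp_image) (auto simp: inj_on_def)
      also have "\<dots> = bexp (\<lambda>_. p) S (\<lambda>\<omega>. ?h ((+) x ` \<omega>))"
        by (rule bexp_cong_p) simp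
      also have "\<dots> = bexp (\<lambda>_. p) S (\<lambda>\<omega>. exp (l * card (cluster \<omega> 0)) * G ^ card (exits (cluster \<omega> 0) S))"
      proof (rule bexp_cong)
        fix \<omega> assume "\<omega> \<subseteq> S"
        then have eq: "(+) x ` \<omega> \<inter> Sx = (+) x ` \<omega>" by (auto simp: Sx_def)
        then show "?h ((+) x ` \<omega>)
            = exp (l * card (cluster \<omega> 0)) * G ^ card (exits (cluster \<omega> 0) S)"
          unfolding eq unfolding Sx_def card_exits_cluster_translate
          using card_cluster_translate[of x \<omega> 0] by (simp only: add_0_right)
      qed
      finally show ?thesis .
    qed
    also note G
    finally have "bexp (\<lambda>_. p) A (?F Y) \<le> G * G ^ card (Y - {x})"
      using assms(6) by (simp add: mult_right_mono)
    also have "\<dots> = G ^ card Y" by (simp only: card.remove[OF psubset.prems x(1)] power_Suc)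
    finally show ?thesis .
  qed
qed

text \<open>As for a branching process with mean offspring below one: the generating function of the
  number of exits minus the identity vanishes at 1 with derivative
  \<open>exit_mean p S - 1 < 0\<close>, so it is negative at some G slightly above 1. The inequality
  being strict there, continuity leaves room for a small positive l.\<close>

lemma exit_mean_less_1_parameters:
  fixes S :: "(int ^ 'd::finite) set"
  assumes "finite S" "exit_mean p S < 1"
  obtains l G :: real where "0 < l" "1 \<le> G"
    "bexp (\<lambda>_. p) S (\<lambda>\<omega>. exp (l * card (cluster \<omega> 0)) * G ^ card (exits (cluster \<omega> 0) S)) \<le> G"
proof -
  let ?w = "\<lambda>\<omega>. (\<Prod>v\<in>\<omega>. p) * (\<Prod>v\<in>S - \<omega>. 1 - p)"
  let ?k = "\<lambda>\<omega>. card (exits (cluster \<omega> 0) S)"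
  define g where "g e = (\<Sum>\<omega>\<in>Pow S. ?w \<omega> * (1 + e) ^ ?k \<omega>) - (1 + e)" for e :: real
  have w1: "(\<Sum>\<omega>\<in>Pow S. ?w \<omega>) = 1"
    using bexp_const[OF assms(1), of "\<lambda>_. p" 1] by (simp add: bexp_def)
  have "(g has_real_derivative (\<Sum>\<omega>\<in>Pow S. ?w \<omega> * real (?k \<omega>)) - 1) (at 0)"
    unfolding g_def by (auto intro!: derivative_eq_intros sum.cong)
  moreover have "(\<Sum>\<omega>\<in>Pow S. ?w \<omega> * real (?k \<omega>)) - 1 < 0"
    using assms(2) by (simp add: exit_mean_def bexp_def)
  ultimately obtain d where d: "d > 0" "\<And>h. 0 < h \<Longrightarrow> h < d \<Longrightarrow> g (0 + h) < g 0"
    using DERIV_neg_dec_right by blast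
  define G where "G = 1 + d / 2"
  have "g (d / 2) < g 0" using d(2)[of "d / 2"] d(1) by simp
  then have G: "(\<Sum>\<omega>\<in>Pow S. ?w \<omega> * G ^ ?k \<omega>) < G" "1 \<le> G"
    using w1 d(1) by (auto simp: g_def G_def)
  define f where "f l = (\<Sum>\<omega>\<in>Pow S. ?w \<omega> * (exp (l * card (cluster \<omega> 0)) * G ^ ?k \<omega>))" for l :: real
  have "(f \<longlongrightarrow> f 0) (at_right 0)"
    unfolding f_def by (intro tendsto_intros)
  moreover have "f 0 < G" using G by (simp add: f_def)
  ultimately have "eventually (\<lambda>l. f l < G) (at_right 0)" by (rule order_tendstoD)
  then have "eventually (\<lambda>l. f l < G \<and> 0 < l) (at_right 0)"
    using eventually_at_right_less by eventually_elim auto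
  then obtain l where "f l < G" "0 < l"
    using eventually_happens'[OF trivial_limit_at_right_real] by blast
  then show ?thesis using that[of l G] G(2) by (simp add: f_def bexp_def)
qed

text \<open>Markov's inequality for the exponential moment of the cluster size, with the origin as
  the only source.\<close>

lemma reach_exp_decay:
  fixes S :: "(int ^ 'd::finite) set"
  assumes "finite S" "0 \<in> S" "0 \<le> p" "p \<le> 1" "exit_mean p S < 1"
  shows "\<exists>l > 0. \<exists>G > 0. \<forall>n. reach p n (UNIV :: (int ^ 'd) set) \<le> G * exp (- l * real n)"
proof -
  obtain l G :: real where l: "0 < l" "1 \<le> G"
    "bexp (\<lambda>_. p) S (\<lambda>\<omega>. exp (l * card (cluster \<omega> 0)) * G ^ card (exits (cluster \<omega> 0) S)) \<le> G"
    by (rule exit_mean_less_1_parameters[OF assms(1,5)])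
  have "reach p n (UNIV :: (int ^ 'd) set) \<le> G * exp (- l * n)" for n
  proof -
    have "reach p n (UNIV :: (int ^ 'd) set)
        \<le> bexp (\<lambda>_. p) (l1_ball (0 :: int ^ 'd) n) (\<lambda>\<omega>. exp (- l * n) * exp (l * card (\<Union>y\<in>{0}. cluster \<omega> y)))"
      unfolding reach_def Int_UNIV_right
    proof (rule bexp_mono)
      fix \<omega> :: "(int ^ 'd) set"
      have "1 \<le> exp (- l * n) * exp (l * card (cluster \<omega> 0))" if "n \<le> card (cluster \<omega> 0)"
        unfolding exp_add[symmetric] using that l(1) by simp
      then show "of_bool (n \<le> card (cluster \<omega> 0))
          \<le> exp (- l * n) * exp (l * card (\<Union>y\<in>{0}. cluster \<omega> y))"
        by (cases "n \<le> card (cluster \<omega> 0)") simp_all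
    qed (use assms in auto)
    also have "\<dots> \<le> exp (- l * n) * G ^ card {0 :: int ^ 'd}"
      unfolding bexp_cmult using l(1)
      by (intro mult_left_mono exp_moment_clusters[OF assms(1-4) _ l(2,3)]) auto
    finally show ?thesis by (simp add: mult.commute)
  qed
  moreover have "0 < G" using l(2) by simp
  ultimately show ?thesis using l(1) by blast
qed

subsection \<open>Sharpness of the phase transition\<close>

text \<open>All sites off L count as open here, so \<open>0 \<in> outside L \<omega>\<close> is the
  event that the origin is connected to the complement of L, and \<open>escape\<close> is its
  probability.\<close>

definition outside :: "(int ^ 'd::finite) set \<Rightarrow> (int ^ 'd) set \<Rightarrow> (int ^ 'd) set" where
  "outside L \<omega> = {u. \<exists>z. z \<notin> L \<and> u \<in> cluster (\<omega> \<union> - L) z}"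

text \<open>The sites of \<open>L\<close> that stay disconnected from the complement of \<open>L\<close> even if they are opened.\<close>

definition sealed :: "(int ^ 'd::finite) set \<Rightarrow> (int ^ 'd) set \<Rightarrow> (int ^ 'd) set" where
  "sealed L \<omega> = {v \<in> L. \<forall>u\<in>outside L \<omega>. \<not> lattice_adj u v}"

lemma outside_mono: "a \<subseteq> b \<Longrightarrow> outside L a \<subseteq> outside L b"
  unfolding outside_def using cluster_mono[of "a \<union> - L" "b \<union> - L"] by blast

lemma outside_base: "z \<notin> L \<Longrightarrow> z \<in> outside L \<omega>"
  unfolding outside_def using cluster_self[of z "\<omega> \<union> - L"] by blast

lemma outside_step: "u \<in> outside L \<omega> \<Longrightarrow> y \<in> \<omega> \<Longrightarrow> lattice_adj u y \<Longrightarrow> y \<in> outside L \<omega>"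
  unfolding outside_def using cluster_step[of u "\<omega> \<union> - L" _ y] by blast

lemma outside_least:
  assumes "\<And>z. z \<notin> L \<Longrightarrow> z \<in> C"
    and "\<And>x y. x \<in> outside L \<omega> \<Longrightarrow> x \<in> C \<Longrightarrow> y \<in> \<omega> \<Longrightarrow> lattice_adj x y \<Longrightarrow> y \<in> C"
  shows "outside L \<omega> \<subseteq> C"
proof -
  have "cluster (\<omega> \<union> - L) z \<subseteq> C" if z: "z \<notin> L" for z
  proof (rule cluster_least)
    fix x y assume xy: "x \<in> cluster (\<omega> \<union> - L) z" "x \<in> C" "y \<in> \<omega> \<union> - L" "lattice_adj x y"
    have "x \<in> outside L \<omega>" using xy(1) z by (auto simp: outside_def)
    then show "y \<in> C" using xy assms by blast
  qed (use z assms in auto)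
  then show ?thesis by (auto simp: outside_def)
qed

lemma outside_pred:
  assumes "v \<in> outside L \<omega>" "v \<in> L"
  shows "\<exists>u\<in>outside L \<omega>. lattice_adj u v"
proof -
  have "outside L \<omega> \<subseteq> {v. v \<notin> L \<or> (\<exists>u\<in>outside L \<omega>. lattice_adj u v)}"
    by (rule outside_least) auto
  then show ?thesis using assms by auto
qed

lemma sealed_not_outside: "v \<in> sealed L \<omega> \<Longrightarrow> v \<notin> outside L \<omega>"
  using outside_pred[of v L \<omega>] by (auto simp: sealed_def)

text \<open>A sealed site has no neighbour in \<open>outside\<close>, so no path from the complement
  of L ever enters S and closing S changes nothing. The event is therefore independent of the
  configuration in S.\<close>

lemma sealed_iff_remove: "sealed L \<omega> = S \<longleftrightarrow> sealed L (\<omega> - S) = S"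
proof
  assume S: "sealed L \<omega> = S"
  have "outside L \<omega> \<subseteq> outside L (\<omega> - S)"
  proof (rule outside_least)
    fix x y assume xy: "x \<in> outside L \<omega>" "x \<in> outside L (\<omega> - S)" "y \<in> \<omega>" "lattice_adj x y"
    have "y \<notin> S" using outside_step[OF xy(1,3,4)] sealed_not_outside[of y L \<omega>] S by auto
    then show "y \<in> outside L (\<omega> - S)" using outside_step[OF xy(2) _ xy(4)] xy(3) by auto
  qed (rule outside_base)
  then have "outside L (\<omega> - S) = outside L \<omega>" using outside_mono[of "\<omega> - S" \<omega> L] by auto
  then show "sealed L (\<omega> - S) = S" using S by (simp add: sealed_def)
next
  assume S: "sealed L (\<omega> - S) = S"
  have "outside L \<omega> \<subseteq> outside L (\<omega> - S)"
  proof (rule outside_least)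
    fix x y assume xy: "x \<in> outside L (\<omega> - S)" "y \<in> \<omega>" "lattice_adj x y"
    have "y \<notin> sealed L (\<omega> - S)" using xy by (auto simp: sealed_def)
    then show "y \<in> outside L (\<omega> - S)" using outside_step[OF xy(1) _ xy(3)] xy(2) S by auto
  qed (rule outside_base)
  then have "outside L (\<omega> - S) = outside L \<omega>" using outside_mono[of "\<omega> - S" \<omega> L] by auto
  then show "sealed L \<omega> = S" using S by (simp add: sealed_def)
qed

text \<open>As a neighbour of a sealed site y is not in \<open>outside\<close>; not being sealed
  itself, it has a neighbour there. So y is closed, and opening it joins the cluster of x to the
  complement of L.\<close>

lemma exit_site_pivotal:
  assumes S: "sealed L \<omega> = S" and x: "x \<in> S" and y: "y \<in> exits (cluster (\<omega> \<inter> S) x) S"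
  shows "y \<in> L" "x \<in> outside L (insert y \<omega>)" "x \<notin> outside L (\<omega> - {y})"
proof -
  obtain z where z: "z \<in> cluster (\<omega> \<inter> S) x" "lattice_adj z y" and yS: "y \<notin> S"
    using y by (auto simp: exits_def)
  have "z \<in> S" using z(1) cluster_subset by blast
  then have "y \<notin> outside L \<omega>" using z(2) S by (auto simp: sealed_def adj_sym[of z y])
  then show yL: "y \<in> L" using outside_base by blast
  then obtain u where u: "u \<in> outside L \<omega>" "lattice_adj u y"
    using yS S by (auto simp: sealed_def)
  have yo: "y \<in> outside L (insert y \<omega>)"
    using outside_step[OF _ _ u(2)] u(1) outside_mono[of \<omega> "insert y \<omega>" L] by blast
  have "cluster (\<omega> \<inter> S) z \<subseteq> outside L (insert y \<omega>)"
  proof (rule cluster_least)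
    assume "z \<in> \<omega> \<inter> S"
    then show "z \<in> outside L (insert y \<omega>)" using outside_step[OF yo] z(2) adj_sym by blast
  next
    fix v w assume "v \<in> outside L (insert y \<omega>)" "w \<in> \<omega> \<inter> S" "lattice_adj v w"
    then show "w \<in> outside L (insert y \<omega>)" using outside_step by blast
  qed
  then show "x \<in> outside L (insert y \<omega>)" using cluster_sym[OF z(1)] by auto
  show "x \<notin> outside L (\<omega> - {y})"
    using sealed_not_outside[of x L \<omega>] x S outside_mono[of "\<omega> - {y}" \<omega> L] by auto
qed

definition escape :: "real \<Rightarrow> (int ^ 'd::finite) set \<Rightarrow> real" where
  "escape p L = bprob (\<lambda>_. p) L (\<lambda>\<omega>. 0 \<in> outside L \<omega>)"

lemma pivotal_sum_ge_exits:
  fixes L :: "(int ^ 'd::finite) set"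
  assumes "finite L" "\<omega> \<subseteq> L"
  shows "of_bool (0 \<in> sealed L \<omega>) * real (card (exits (cluster (\<omega> \<inter> sealed L \<omega>) 0) (sealed L \<omega>)))
    \<le> (\<Sum>v\<in>L. of_bool (0 \<in> outside L (insert v \<omega>)) - of_bool (0 \<in> outside L (\<omega> - {v})))"
proof -
  let ?d = "\<lambda>v. of_bool (0 \<in> outside L (insert v \<omega>)) - of_bool (0 \<in> outside L (\<omega> - {v})) :: real"
  let ?E = "exits (cluster (\<omega> \<inter> sealed L \<omega>) 0) (sealed L \<omega>)"
  have nonneg: "0 \<le> ?d v" for v
    using outside_mono[of "\<omega> - {v}" "insert v \<omega>" L] by (auto simp: of_bool_def)
  show ?thesis
  proof (cases "0 \<in> sealed L \<omega>")
    case True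
    have E: "v \<in> L" "?d v = 1" if "v \<in> ?E" for v
      using exit_site_pivotal[OF refl True that] by auto
    have "real (card ?E) = (\<Sum>v\<in>?E. ?d v)" using E(2) by simp
    also have "\<dots> \<le> (\<Sum>v\<in>L. ?d v)"
      using E(1) nonneg assms(1) by (intro sum_mono2) auto
    finally show ?thesis using True by simp
  next
    case False
    have "0 \<le> (\<Sum>v\<in>L. ?d v)" by (rule sum_nonneg) (rule nonneg)
    then show ?thesis using False by simp
  qed
qed

text \<open>Given \<open>sealed L \<omega> = S\<close>, the configuration inside \<open>S\<close> is still unbiased, and every exit of the
  cluster of the origin from \<open>S\<close> is a pivotal closed site.\<close>

lemma mean_pivotal_ge_sealed:
  fixes L :: "(int ^ 'd::finite) set"
  assumes "finite L" "0 \<le> p" "p \<le> 1"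
    and "\<And>S. finite S \<Longrightarrow> 0 \<in> S \<Longrightarrow> 1 \<le> exit_mean p (S :: (int ^ 'd) set)"
  shows "bprob (\<lambda>_. p) L (\<lambda>\<omega>. 0 \<in> sealed L \<omega>)
    \<le> (\<Sum>v\<in>L. bexp (\<lambda>_. p) L (\<lambda>\<omega>. of_bool (0 \<in> outside L (insert v \<omega>)) - of_bool (0 \<in> outside L (\<omega> - {v}))))"
proof -
  let ?N = "\<lambda>S \<omega>. real (card (exits (cluster (\<omega> \<inter> S) 0) S))"
  let ?I = "\<lambda>S \<omega>. of_bool (sealed L \<omega> = S) :: real"
  let ?P = "{S \<in> Pow L. 0 \<in> S}"
  have finP: "finite ?P" using assms(1) by simp
  have split: "of_bool (0 \<in> sealed L \<omega>) * f (sealed L \<omega>) = (\<Sum>S\<in>?P. f S * ?I S \<omega>)"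
    for \<omega> and f :: "(int ^ 'd) set \<Rightarrow> real"
  proof -
    have "sealed L \<omega> \<subseteq> L" by (auto simp: sealed_def)
    moreover have "(\<Sum>S\<in>?P. f S * ?I S \<omega>) = (\<Sum>S\<in>?P. if sealed L \<omega> = S then f S else 0)"
      by (rule sum.cong) auto
    ultimately show ?thesis using finP by (simp add: sum.delta)
  qed
  have "bprob (\<lambda>_. p) L (\<lambda>\<omega>. 0 \<in> sealed L \<omega>) = (\<Sum>S\<in>?P. bexp (\<lambda>_. p) L (?I S))"
    using split[of _ "\<lambda>_. 1"] by (simp add: bexp_sum)
  also have "\<dots> \<le> (\<Sum>S\<in>?P. bexp (\<lambda>_. p) L (\<lambda>\<omega>. ?N S \<omega> * ?I S \<omega>))"
  proof (rule sum_mono)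
    fix S assume S: "S \<in> ?P"
    then have finS: "finite S" and LS: "L \<inter> S = S" and S0: "0 \<in> S"
      using assms(1) finite_subset by auto
    have I: "?I S \<omega> = ?I S (\<omega> - S)" for \<omega> using sealed_iff_remove[of L \<omega> S] by simp
    have nn: "0 \<le> bexp (\<lambda>_. p) (L - S) (?I S)" using assms by (intro bexp_nonneg) auto
    have "bexp (\<lambda>_. p) L (?I S) = bexp (\<lambda>_. p) L (\<lambda>\<omega>. 1 * ?I S \<omega>)" by simp
    also have "\<dots> = bexp (\<lambda>_. p) (L \<inter> S) (\<lambda>_. 1) * bexp (\<lambda>_. p) (L - S) (?I S)"
      by (rule bexp_indep[where T = S and g = "?I S", OF assms(1) _ I]) simp
    also have "\<dots> = 1 * bexp (\<lambda>_. p) (L - S) (?I S)"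
      using finS by (simp add: LS bexp_const)
    also have "\<dots> \<le> bexp (\<lambda>_. p) S (?N S) * bexp (\<lambda>_. p) (L - S) (?I S)"
    proof (intro mult_right_mono nn)
      have "bexp (\<lambda>_. p) S (?N S) = exit_mean p S"
        unfolding exit_mean_def by (rule bexp_cong) (simp add: Int_absorb2)
      then show "1 \<le> bexp (\<lambda>_. p) S (?N S)" using assms(4)[OF finS S0] by simp
    qed
    also have "\<dots> = bexp (\<lambda>_. p) (L \<inter> S) (?N S) * bexp (\<lambda>_. p) (L - S) (?I S)"
      by (simp only: LS)
    also have "\<dots> = bexp (\<lambda>_. p) L (\<lambda>\<omega>. ?N S \<omega> * ?I S \<omega>)"
      by (rule bexp_indep[where T = S and g = "?I S", OF assms(1) _ I, symmetric]) simp
    finally show "bexp (\<lambda>_. p) L (?I S) \<le> bexp (\<lambda>_. p) L (\<lambda>\<omega>. ?N S \<omega> * ?I S \<omega>)" .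
  qed
  also have "\<dots> = bexp (\<lambda>_. p) L (\<lambda>\<omega>. of_bool (0 \<in> sealed L \<omega>) * ?N (sealed L \<omega>) \<omega>)"
    unfolding bexp_sum[symmetric]
  proof (rule bexp_cong)
    fix \<omega>
    show "(\<Sum>S\<in>?P. ?N S \<omega> * ?I S \<omega>) = of_bool (0 \<in> sealed L \<omega>) * ?N (sealed L \<omega>) \<omega>"
      by (rule split[symmetric])
  qed
  also have "\<dots> \<le> bexp (\<lambda>_. p) L (\<lambda>\<omega>. \<Sum>v\<in>L. of_bool (0 \<in> outside L (insert v \<omega>)) - of_bool (0 \<in> outside L (\<omega> - {v})))"
    using assms by (intro bexp_mono pivotal_sum_ge_exits) auto
  finally show ?thesis by (simp add: bexp_sum)
qed

text \<open>An unsealed origin has a neighbour connected to the complement of L, so it escapes as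
  soon as it is open. The latter event ignores the state of the origin itself, and opening the
  origin costs the factor p.\<close>

lemma not_sealed_le_escape:
  fixes L :: "(int ^ 'd::finite) set"
  assumes "finite L" "0 \<in> L" "0 \<le> p" "p \<le> 1"
  shows "p * (1 - bprob (\<lambda>_. p) L (\<lambda>\<omega>. 0 \<in> sealed L \<omega>)) \<le> escape p L"
proof -
  let ?M = "L - {0}"
  let ?r = "bprob (\<lambda>_. p) ?M (\<lambda>\<omega>. 0 \<in> outside L (insert 0 \<omega>))"
  have L: "L = insert 0 ?M" "finite ?M" "0 \<notin> ?M" using assms by auto
  have key: "0 \<in> outside L (insert 0 \<omega>)" if n0: "0 \<notin> sealed L \<omega>" for \<omega>
  proof -
    obtain u where "u \<in> outside L \<omega>" "lattice_adj u 0"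
      using n0 assms(2) unfolding sealed_def by blast
    then show ?thesis
      using outside_step[of u L "insert 0 \<omega>" 0] outside_mono[of \<omega> "insert 0 \<omega>" L] by auto
  qed
  have "1 - bprob (\<lambda>_. p) L (\<lambda>\<omega>. 0 \<in> sealed L \<omega>) = bprob (\<lambda>_. p) L (\<lambda>\<omega>. 0 \<notin> sealed L \<omega>)"
    using bexp_diff[of "\<lambda>_. p" L "\<lambda>_. 1" "\<lambda>\<omega>. of_bool (0 \<in> sealed L \<omega>)"] assms(1)
    by (simp add: bexp_const of_bool_not_iff)
  also have "\<dots> = p * bprob (\<lambda>_. p) ?M (\<lambda>\<omega>. 0 \<notin> sealed L (insert 0 \<omega>))
      + (1 - p) * bprob (\<lambda>_. p) ?M (\<lambda>\<omega>. 0 \<notin> sealed L \<omega>)"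
    by (subst (1) L(1)) (simp only: bexp_insert[OF L(2,3)])
  also have "\<dots> \<le> p * ?r + (1 - p) * ?r"
  proof (intro add_mono mult_left_mono bexp_mono)
    fix \<omega>
    show "of_bool (0 \<notin> sealed L (insert 0 \<omega>)) \<le> (of_bool (0 \<in> outside L (insert 0 \<omega>)) :: real)"
      using key[of "insert 0 \<omega>"] by (auto simp: of_bool_def)
    show "of_bool (0 \<notin> sealed L \<omega>) \<le> (of_bool (0 \<in> outside L (insert 0 \<omega>)) :: real)"
      using key[of \<omega>] by (auto simp: of_bool_def)
  qed (use assms in auto)
  finally have "1 - bprob (\<lambda>_. p) L (\<lambda>\<omega>. 0 \<in> sealed L \<omega>) \<le> ?r" by (simp add: algebra_simps)
  then have "p * (1 - bprob (\<lambda>_. p) L (\<lambda>\<omega>. 0 \<in> sealed L \<omega>)) \<le> p * ?r"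
    using assms by (intro mult_left_mono) auto
  also have "\<dots> \<le> p * ?r + (1 - p) * bprob (\<lambda>_. p) ?M (\<lambda>\<omega>. 0 \<in> outside L \<omega>)"
    using assms by (simp add: bexp_nonneg)
  also have "\<dots> = escape p L"
    unfolding escape_def by (subst (4) L(1)) (simp only: bexp_insert[OF L(2,3)])
  finally show ?thesis .
qed

lemma escape_mono:
  assumes "finite L" "0 \<le> p" "p \<le> q" "q \<le> 1"
  shows "escape p L \<le> escape q L"
  unfolding escape_def
proof (rule bexp_mono_p)
  fix a b :: "(int ^ 'a) set" assume "a \<subseteq> b"
  then show "of_bool (0 \<in> outside L a) \<le> (of_bool (0 \<in> outside L b) :: real)"
    using outside_mono[of a b L] by (intro of_bool_mono) auto
qed (use assms in auto)

text \<open>If \<open>escape p' L\<close> were below p / 2, the origin would be sealed with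
  probability at least 1/2 at every density z between p and p', so by Russo's formula the derivative
  of \<open>escape\<close> would be at least 1/2 there. The mean value theorem then gives the second
  term of the minimum. The bound is the same for all L, hence survives when L grows.\<close>

lemma escape_ge:
  fixes L :: "(int ^ 'd::finite) set"
  assumes "finite L" "0 \<in> L" "0 < p" "p < p'" "p' \<le> 1"
    and "\<And>S. finite S \<Longrightarrow> 0 \<in> S \<Longrightarrow> 1 \<le> exit_mean p (S :: (int ^ 'd) set)"
  shows "min (p / 2) ((p' - p) / 2) \<le> escape p' L"
proof (rule ccontr)
  assume "\<not> ?thesis"
  then have small: "escape p' L < p / 2" "escape p' L < (p' - p) / 2"
    by (simp_all only: not_le min_less_iff_conj)
  define D where "D q = (\<Sum>v\<in>L. bexp (\<lambda>_. q) L (\<lambda>\<omega>. of_bool (0 \<in> outside L (insert v \<omega>))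
      - of_bool (0 \<in> outside L (\<omega> - {v}))))" for q :: real
  have "\<exists>z>p. z < p' \<and> escape p' L - escape p L = (p' - p) * D z"
    using assms(4) unfolding escape_def D_def by (rule MVT2) (rule russo_formula[OF assms(1)])
  then obtain z where z: "p < z" "z < p'" "escape p' L - escape p L = (p' - p) * D z" by blast
  let ?s = "bprob (\<lambda>_. z) L (\<lambda>\<omega>. 0 \<in> sealed L \<omega>)"
  have "1 \<le> exit_mean z S" if "finite S" "0 \<in> S" for S :: "(int ^ 'd) set"
    using assms(6)[OF that] exit_mean_mono[OF that(1), of p z] assms z by auto
  then have "?s \<le> D z"
    unfolding D_def using assms z by (intro mean_pivotal_ge_sealed) auto
  moreover have "z * (1 - ?s) \<le> p / 2"
    using not_sealed_le_escape[OF assms(1,2), of z] escape_mono[OF assms(1), of z p'] small assms z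
    by auto
  then have "z * (1 - ?s) \<le> z * (1 / 2)" using z by simp
  then have "1 - ?s \<le> 1 / 2" using z assms(3) by (simp only: mult_le_cancel_left_pos)
  ultimately have "1 / 2 \<le> D z" by simp
  then have "(p' - p) * (1 / 2) \<le> (p' - p) * D z" using assms by (intro mult_left_mono) auto
  moreover have "0 \<le> escape p L" unfolding escape_def using assms by (intro bexp_nonneg) auto
  ultimately show False using z(3) small by simp
qed

lemma escape_le_reach:
  assumes "0 \<le> p" "p \<le> 1"
  shows "escape p (l1_ball (0 :: int ^ 'd::finite) n) \<le> reach p n (UNIV :: (int ^ 'd) set)"
  unfolding escape_def reach_def Int_UNIV_right
proof (intro bexp_mono of_bool_mono)
  fix \<omega> :: "(int ^ 'd) set"
  let ?L = "l1_ball (0 :: int ^ 'd) n"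
  assume w: "\<omega> \<subseteq> ?L" and "0 \<in> outside ?L \<omega>"
  then obtain z where z: "z \<notin> ?L" "0 \<in> cluster (\<omega> \<union> - ?L) z" by (auto simp: outside_def)
  then have "z \<in> cluster (\<omega> \<union> - ?L) 0" "int n \<le> l1 (z - 0)"
    using cluster_sym by (auto simp: l1_ball_def)
  then have "infinite (cluster (\<omega> \<union> - ?L) 0) \<or> n \<le> card (cluster (\<omega> \<union> - ?L) 0)"
    using card_cluster_ge_distance by fastforce
  moreover have "(\<omega> \<union> - ?L) \<inter> ?L = \<omega>" using w by auto
  ultimately show "n \<le> card (cluster \<omega> 0)"
    using cluster_localize[of "\<omega> \<union> - ?L" 0 n] by simp
qed (use assms in auto)

lemma reach_ge_of_exit_mean:
  assumes "0 < p" "p < p'" "p' \<le> 1"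
    and "\<And>S. finite S \<Longrightarrow> 0 \<in> S \<Longrightarrow> 1 \<le> exit_mean p (S :: (int ^ 'd::finite) set)"
  shows "min (p / 2) ((p' - p) / 2) \<le> reach p' n (UNIV :: (int ^ 'd) set)"
  by (rule order_trans[OF escape_ge[OF finite_l1_ball self_in_l1_ball assms] escape_le_reach])
    (use assms in auto)

text \<open>An exit from the ball forces the cluster to reach distance n, and all exits lie in the
  ball of radius n + 1. When the left-hand side is at least one, this is a polynomial lower bound
  for \<open>reach\<close>.\<close>

lemma exit_mean_le_reach:
  assumes "0 \<le> p" "p \<le> 1"
  shows "exit_mean p (l1_ball (0 :: int ^ 'd::finite) n)
    \<le> (2 * real n + 3) ^ CARD('d) * reach p n (UNIV :: (int ^ 'd) set)"
  unfolding exit_mean_def reach_def Int_UNIV_right bexp_cmult[symmetric]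
proof (rule bexp_mono)
  fix \<omega> :: "(int ^ 'd) set"
  let ?L = "l1_ball (0 :: int ^ 'd) n"
  let ?E = "exits (cluster \<omega> 0) ?L"
  assume w: "\<omega> \<subseteq> ?L"
  have fin: "finite (cluster \<omega> 0)"
    by (rule finite_subset[OF cluster_subset finite_subset[OF w]]) simp
  have "?E \<subseteq> l1_ball 0 (n + 1)"
  proof
    fix y assume "y \<in> ?E"
    then obtain z where "z \<in> cluster \<omega> 0" and a: "lattice_adj z y" by (auto simp: exits_def)
    then have "z \<in> ?L" using cluster_subset w by blast
    then show "y \<in> l1_ball 0 (n + 1)" using adj_l1_diff[OF a, of 0] by (simp add: l1_ball_def)
  qed
  then have "card ?E \<le> card (l1_ball (0 :: int ^ 'd) (n + 1))" by (intro card_mono) auto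
  also have "\<dots> \<le> (2 * n + 3) ^ CARD('d)"
    using card_l1_ball[of "0 :: int ^ 'd" "n + 1"] by (simp add: algebra_simps numeral_3_eq_3)
  finally have le: "card ?E \<le> (2 * n + 3) ^ CARD('d)" .
  then have "real (card ?E) \<le> real ((2 * n + 3) ^ CARD('d))" by (rule of_nat_mono)
  then have le': "real (card ?E) \<le> (2 * real n + 3) ^ CARD('d)" by simp
  show "real (card ?E) \<le> (2 * real n + 3) ^ CARD('d) * of_bool (n \<le> card (cluster \<omega> 0))"
  proof (cases "?E = {}")
    case False
    then obtain y z where z: "z \<in> cluster \<omega> 0" "lattice_adj z y" "y \<notin> ?L"
      by (auto simp: exits_def)
    then have "int n \<le> l1 (z - 0)" using adj_l1_diff[OF z(2), of 0] by (simp add: l1_ball_def)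
    then have "n \<le> card (cluster \<omega> 0)" using card_cluster_ge_distance[OF z(1) _ fin, of n] by simp
    then show ?thesis using le' by simp
  qed simp
qed (use assms in auto)

lemma continuous_exit_mean: "finite S \<Longrightarrow> continuous_on UNIV (\<lambda>p. exit_mean p S)"
  unfolding exit_mean_def bexp_def by (intro continuous_intros)

text \<open>Makes the exit criterion hold at small densities, so that the supremum defining the
  critical point is taken over a nonempty set.\<close>

lemma exit_mean_singleton:
  assumes "0 \<le> p"
  shows "exit_mean p {0 :: int ^ 'd::finite} \<le> p * 3 ^ CARD('d)"
proof -
  have "card (exits (cluster {0} 0) {0 :: int ^ 'd}) \<le> card (l1_ball (0 :: int ^ 'd) 1)"
  proof (rule card_mono[OF finite_l1_ball])
    show "exits (cluster {0} 0) {0 :: int ^ 'd} \<subseteq> l1_ball 0 1"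
    proof
      fix y :: "int ^ 'd" assume "y \<in> exits (cluster {0} 0) {0}"
      then have "lattice_adj 0 y"
        using cluster_subset[of "{0}" "0 :: int ^ 'd"] by (auto simp: exits_def)
      then show "y \<in> l1_ball 0 1" using l1_minus[of 0 y] by (simp add: l1_ball_def adj_iff_l1)
    qed
  qed
  also have "\<dots> \<le> 3 ^ CARD('d)" using card_l1_ball[of "0 :: int ^ 'd" 1] by (simp add: numeral_3_eq_3)
  finally have "real (card (exits (cluster {0} 0) {0 :: int ^ 'd})) \<le> 3 ^ CARD('d)"
    using of_nat_mono by fastforce
  moreover have "card (exits (cluster {} 0) {0 :: int ^ 'd}) = 0"
    by (simp add: cluster_empty exits_def)
  ultimately show ?thesis
    using assms unfolding exit_mean_def by (simp add: bexp_insert mult_left_mono)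
qed

subsection \<open>Existence of the decay rate\<close>

lemma fekete_superadditive:
  fixes u :: "nat \<Rightarrow> real"
  assumes "\<And>m n. 1 \<le> m \<Longrightarrow> 1 \<le> n \<Longrightarrow> u m + u n \<le> u (m + n)"
    and "\<And>n. 1 \<le> n \<Longrightarrow> u n \<le> 0"
  obtains L where "(\<lambda>n. u n / real n) \<longlonglongrightarrow> L"
proof -
  define L where "L = (SUP n\<in>{1..}. u n / real n)"
  have bdd: "bdd_above ((\<lambda>n. u n / real n) ` {1..})"
    by (rule bdd_aboveI[of _ 0]) (auto intro!: divide_nonpos_nonneg assms)
  have le: "u n / real n \<le> L" if "1 \<le> n" for n
    unfolding L_def using that by (intro cSUP_upper bdd) simp
  have "(\<lambda>n. u n / real n) \<longlonglongrightarrow> L"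
  proof (rule LIMSEQ_I)
    fix e :: real assume e: "0 < e"
    have "\<exists>N\<in>{1..}. L - e / 2 < u N / real N"
      using e bdd unfolding L_def by (subst less_cSUP_iff[symmetric]) auto
    then obtain N where N: "1 \<le> N" "L - e / 2 < u N / real N" by auto
    define c where "c = Min (u ` {1..N})"
    have c: "c \<le> u r" if "1 \<le> r" "r \<le> N" for r
      unfolding c_def using that by (intro Min_le) auto
    have iter: "real q * u N + u r \<le> u (q * N + r)" if "1 \<le> r" for q r
    proof (induction q)
      case (Suc q)
      have "u N + u (q * N + r) \<le> u (N + (q * N + r))" using N that by (intro assms) auto
      then show ?case using Suc by (simp add: algebra_simps)
    qed simp
    have "(\<lambda>n. c / real n) \<longlonglongrightarrow> 0" by real_asymp
    then have "eventually (\<lambda>n. - e / 2 < c / real n) sequentially"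
      using e by (intro order_tendstoD) auto
    then obtain M where M: "\<And>n. M \<le> n \<Longrightarrow> - e / 2 < c / real n"
      by (auto simp: eventually_sequentially)
    show "\<exists>M. \<forall>n\<ge>M. norm (u n / real n - L) < e"
    proof (intro exI allI impI)
      fix n assume n: "max M 1 \<le> n"
      define q r where "q = (n - 1) div N" and "r = (n - 1) mod N + 1"
      have nqr: "n = q * N + r" using n N by (simp add: q_def r_def)
      have r: "1 \<le> r" "r \<le> N" using N by (auto simp: r_def Suc_leI)
      have "real q * real N \<le> real n" unfolding nqr by simp
      \<comment> \<open>\<open>u N\<close> is nonpositive, so replacing \<open>q * N\<close> by the
        larger n lowers the product.\<close>
      then have "real n * (u N / real N) \<le> (real q * real N) * (u N / real N)"
        using assms(2)[OF N(1)] by (intro mult_right_mono_neg divide_nonpos_nonneg) auto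
      also have "\<dots> = real q * u N" using N by simp
      also have "\<dots> + c \<le> u n" using iter[OF r(1), of q] c[OF r] nqr by simp
      finally have "(real n * (u N / real N) + c) / real n \<le> u n / real n"
        by (intro divide_right_mono) auto
      moreover have "(real n * (u N / real N) + c) / real n = u N / real N + c / real n"
        using n by (simp add: add_divide_distrib)
      ultimately have "u N / real N + c / real n \<le> u n / real n" by simp
      then have "L - e < u n / real n" using N(2) M[of n] n by simp
      then show "norm (u n / real n - L) < e" using le[of n] n by (simp add: abs_less_iff)
    qed
  qed
  then show ?thesis by (rule that)
qed

section \<open>Cluster growth in a half-space\<close>

definition halfspace :: "'d \<Rightarrow> (int ^ 'd::finite) set" where
  "halfspace i = {x. 0 \<le> x $ i}"

lemma translate_halfspace: "(+) x ` halfspace i = {y. x $ i \<le> y $ i}"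
proof
  show "{y. x $ i \<le> y $ i} \<subseteq> (+) x ` halfspace i"
  proof
    fix y assume "y \<in> {y. x $ i \<le> y $ i}"
    then show "y \<in> (+) x ` halfspace i"
      by (intro image_eqI[of _ _ "y - x"]) (auto simp: halfspace_def)
  qed
qed (auto simp: halfspace_def)

lemma reach_1:
  fixes B :: "(int ^ 'd::finite) set"
  assumes "0 \<in> B"
  shows "reach p 1 B = p"
proof -
  have "reach p 1 B = bprob (\<lambda>_. p) (l1_ball 0 1 \<inter> B) (\<lambda>\<omega>. 0 \<in> \<omega>)"
    unfolding reach_def
  proof (rule bexp_cong)
    fix \<omega> :: "(int ^ 'd) set" assume "\<omega> \<subseteq> l1_ball 0 1 \<inter> B"
    then have "finite (cluster \<omega> 0)"
      by (intro finite_subset[OF cluster_subset] finite_subset[OF _ finite_l1_ball]) auto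
    then have "1 \<le> card (cluster \<omega> 0) \<longleftrightarrow> 0 \<in> \<omega>"
      using cluster_self[of 0 \<omega>] cluster_empty[of 0 \<omega>] by (auto simp: Suc_le_eq card_gt_0_iff)
    then show "of_bool (1 \<le> card (cluster \<omega> 0)) = (of_bool (0 \<in> \<omega>) :: real)" by simp
  qed
  also have "\<dots> = bprob (\<lambda>_. p) {0 :: int ^ 'd} (\<lambda>\<omega>. 0 \<in> \<omega>)"
    using assms by (intro bexp_restrict) auto
  finally show ?thesis by (simp add: bexp_insert)
qed

text \<open>Grow the cluster slab by slab until it has \<open>m\<close> sites. At that moment it has a site \<open>w\<close> in the
  top layer, and everything above is unexplored, so a fresh half-space cluster of \<open>n\<close> sites can be
  attached at \<open>w + e\<^sub>i\<close>.\<close>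

lemma reach_halfspace_supermult:
  fixes i :: "'d::finite"
  assumes "0 \<le> p" "p \<le> 1" "1 \<le> m" "1 \<le> n"
  shows "reach p m (halfspace i) * reach p n (halfspace i) \<le> reach p (m + n) (halfspace i)"
proof -
  let ?H = "halfspace i" and ?B = "l1_ball (0 :: int ^ 'd) m"
  \<comment> \<open>The radius leaves room for a first cluster within distance m, one step upwards,
    and a second cluster within distance n of the site reached.\<close>
  define A where "A = l1_ball 0 (m + n + 1) \<inter> ?H"
  define slab where "slab z = {x :: int ^ 'd. x $ i < int z}" for z
  \<comment> \<open>Cutting with the ball of radius m keeps the event of having m sites and confines
    the relevant layers to heights at most m.\<close>
  define g where "g z \<omega> = (of_bool (m \<le> card (cluster (\<omega> \<inter> ?B \<inter> slab z) 0)) :: real)" for z \<omega>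
  \<comment> \<open>The indicator that the cluster first attains m sites when layer z is added.
    These events are disjoint, which is why their contributions sum to at most one
    probability.\<close>
  define e where "e z \<omega> = g (Suc z) \<omega> - g z \<omega>" for z \<omega>
  let ?h = "reach p n ?H"
  let ?J = "\<lambda>\<omega> :: (int ^ 'd) set. of_bool (m + n \<le> card (cluster \<omega> 0)) :: real"
  have finA: "finite A" by (simp add: A_def)
  have h0: "0 \<le> ?h" using reach_bounds assms by blast
  have H0: "(+) 0 ` ?H = ?H" by simp
  have g0: "g 0 \<omega> = 0" if "\<omega> \<subseteq> A" for \<omega>
  proof -
    have "\<omega> \<inter> ?B \<inter> slab 0 = {}" using that by (auto simp: A_def slab_def halfspace_def)
    then show ?thesis using assms by (simp add: g_def cluster_empty)
  qed
  have gm: "g (Suc m) \<omega> = of_bool (m \<le> card (cluster (\<omega> \<inter> (+) 0 ` ?H) 0))" if "\<omega> \<subseteq> A" for \<omega>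
  proof -
    have "x $ i \<le> int m" if "x \<in> ?B" for x
      using abs_component_le_l1[of x i] that by (simp add: l1_ball_def)
    then have "\<omega> \<inter> ?B \<inter> slab (Suc m) = \<omega> \<inter> ?B" by (force simp: slab_def)
    moreover have "\<omega> \<inter> (+) 0 ` ?H = \<omega>" using that unfolding H0 by (auto simp: A_def)
    moreover have "finite \<omega>" using that finA by (rule finite_subset)
    ultimately show ?thesis by (simp add: g_def card_cluster_localize[symmetric])
  qed
  have gmono: "g z \<omega> \<le> g (Suc z) \<omega>" for z \<omega>
  proof -
    have "card (cluster (\<omega> \<inter> ?B \<inter> slab z) 0) \<le> card (cluster (\<omega> \<inter> ?B \<inter> slab (Suc z)) 0)"
      by (rule card_cluster_mono) (auto simp: slab_def)
    then show ?thesis by (auto simp: g_def of_bool_def)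
  qed
  have e01: "e z \<omega> = 0 \<or> e z \<omega> = 1" for z \<omega>
    using gmono[of z \<omega>] by (auto simp: e_def g_def of_bool_def split: if_splits)
  have tel: "(\<Sum>z<Suc m. e z \<omega>) = of_bool (m \<le> card (cluster (\<omega> \<inter> (+) 0 ` ?H) 0))"
    if "\<omega> \<subseteq> A" for \<omega>
    unfolding e_def sum_lessThan_telescope[of "\<lambda>z. g z \<omega>" "Suc m"] g0[OF that] gm[OF that] by simp
  have attach: "bexp (\<lambda>_. p) A (e z) * ?h \<le> bexp (\<lambda>_. p) A (\<lambda>\<omega>. e z \<omega> * ?J \<omega>)"
    if z: "z < Suc m" for z
  proof -
    let ?A1 = "A \<inter> slab (Suc z)" and ?A2 = "A - slab (Suc z)"
    have A12: "A = ?A1 \<union> ?A2" by auto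
    have e_local: "e z (a \<union> b) = e z a" if "a \<subseteq> ?A1" "b \<subseteq> ?A2" for a b
    proof -
      have "(a \<union> b) \<inter> slab (Suc z) = a \<inter> slab (Suc z)" "(a \<union> b) \<inter> slab z = a \<inter> slab z"
        using that by (auto simp: slab_def)
      then have "(a \<union> b) \<inter> ?B \<inter> slab (Suc z) = a \<inter> ?B \<inter> slab (Suc z)"
          "(a \<union> b) \<inter> ?B \<inter> slab z = a \<inter> ?B \<inter> slab z" by blast+
      then show ?thesis by (simp only: e_def g_def)
    qed
    have inner: "e z a * ?h \<le> e z a * bexp (\<lambda>_. p) ?A2 (\<lambda>b. ?J (a \<union> b))" if a: "a \<subseteq> ?A1" for a
    proof (cases "e z a = 0")
      case False
      then have e1: "e z a = 1" using e01 by blast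
      let ?C = "cluster (a \<inter> ?B \<inter> slab (Suc z)) 0"
      have m1: "m \<le> card ?C" and m0: "\<not> m \<le> card (cluster (a \<inter> ?B \<inter> slab z) 0)"
        using e1 by (auto simp: e_def g_def of_bool_def split: if_splits)
      have "\<not> ?C \<subseteq> slab z"
      proof
        assume "?C \<subseteq> slab z"
        then have "?C = cluster (a \<inter> ?B \<inter> slab (Suc z) \<inter> slab z) 0" by (rule cluster_restrict)
        moreover have "a \<inter> ?B \<inter> slab (Suc z) \<inter> slab z = a \<inter> ?B \<inter> slab z" by (auto simp: slab_def)
        ultimately show False using m1 m0 by simp
      qed
      then obtain w where w: "w \<in> ?C" "w \<notin> slab z" by auto
      have "w \<in> a \<inter> ?B \<inter> slab (Suc z)" using w(1) cluster_subset by blast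
      then have wi: "w $ i = int z" and wB: "l1 w \<le> int m"
        using w(2) by (auto simp: slab_def l1_ball_def)
      define w' where "w' = w + axis i 1"
      have ww': "lattice_adj w w'" unfolding w'_def by (rule adj_axis)
      have w'i: "w' $ i = int z + 1" by (simp add: w'_def wi axis_def)
      have w'l: "l1 w' \<le> int m + 1" using adj_l1_diff[OF ww', of 0] wB by simp
      have sub: "(+) w' ` (l1_ball 0 n \<inter> ?H) \<subseteq> ?A2"
      proof clarify
        fix y assume y: "y \<in> l1_ball 0 n" "y \<in> ?H"
        have "l1 (w' + y) \<le> int (m + n + 1)"
          using l1_triangle[of w' y] w'l y(1) by (simp add: l1_ball_def)
        then show "w' + y \<in> ?A2"
          using y(2) w'i by (simp add: A_def l1_ball_def halfspace_def slab_def)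
      qed
      have "?h = bprob (\<lambda>_. p) ?A2 (\<lambda>b. n \<le> card (cluster (b \<inter> (+) w' ` ?H) w'))"
        using finA sub by (intro bprob_cluster_eq_reach[symmetric]) auto
      also have "\<dots> \<le> bexp (\<lambda>_. p) ?A2 (\<lambda>b. ?J (a \<union> b))"
      proof (intro bexp_mono of_bool_mono)
        fix b assume b: "b \<subseteq> ?A2"
        let ?E = "cluster (b \<inter> (+) w' ` ?H) w'"
        assume nE: "n \<le> card ?E"
        then have "?E \<noteq> {}" using assms by auto
        then have w'b: "w' \<in> b" using cluster_source by blast
        have finab: "finite (a \<union> b)" using a b finA by (auto intro: finite_subset)
        have C: "?C \<subseteq> cluster (a \<union> b) 0" by (rule cluster_mono) auto
        have "w' \<in> cluster (a \<union> b) 0"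
          using cluster_step[of w "a \<union> b" 0 w'] C w(1) w'b ww' by auto
        then have "cluster (a \<union> b) w' = cluster (a \<union> b) 0" by (rule cluster_eq)
        moreover have "?E \<subseteq> cluster (a \<union> b) w'" by (rule cluster_mono) auto
        ultimately have CE: "?C \<union> ?E \<subseteq> cluster (a \<union> b) 0" using C by simp
        have CEsub: "?C \<subseteq> a" "?E \<subseteq> b" using cluster_subset by blast+
        then have fin: "finite ?C" "finite ?E" using finab by (auto intro: finite_subset)
        have disj: "?C \<inter> ?E = {}" using CEsub a b by blast
        have "m + n \<le> card (?C \<union> ?E)" using m1 nE by (simp add: card_Un_disjoint[OF fin disj])
        also have "\<dots> \<le> card (cluster (a \<union> b) 0)"
          using CE finite_subset[OF cluster_subset finab] by (intro card_mono) auto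
        finally show "m + n \<le> card (cluster (a \<union> b) 0)" .
      qed (use assms in auto)
      finally show ?thesis using e1 by simp
    qed simp
    have "bexp (\<lambda>_. p) A (e z) * ?h = bexp (\<lambda>_. p) ?A1 (\<lambda>a. e z a * ?h)"
    proof -
      have "bexp (\<lambda>_. p) A (e z) = bexp (\<lambda>_. p) ?A1 (e z)"
      proof (rule bexp_restrict[OF finA])
        fix \<omega> assume w: "\<omega> \<subseteq> A"
        have "e z ((\<omega> \<inter> ?A1) \<union> (\<omega> - slab (Suc z))) = e z (\<omega> \<inter> ?A1)"
          using w by (intro e_local) auto
        moreover have "(\<omega> \<inter> ?A1) \<union> (\<omega> - slab (Suc z)) = \<omega>" using w by auto
        ultimately show "e z \<omega> = e z (\<omega> \<inter> ?A1)" by simp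
      qed simp
      then show ?thesis using bexp_cmult[of "\<lambda>_. p" ?A1 ?h "e z"] by (simp add: mult.commute)
    qed
    also have "\<dots> \<le> bexp (\<lambda>_. p) ?A1 (\<lambda>a. e z a * bexp (\<lambda>_. p) ?A2 (\<lambda>b. ?J (a \<union> b)))"
      using inner assms by (intro bexp_mono) auto
    also have "\<dots> = bexp (\<lambda>_. p) ?A1 (\<lambda>a. bexp (\<lambda>_. p) ?A2 (\<lambda>b. e z (a \<union> b) * ?J (a \<union> b)))"
      unfolding bexp_cmult[symmetric] by (intro bexp_cong) (simp add: e_local)
    also have "\<dots> = bexp (\<lambda>_. p) (?A1 \<union> ?A2) (\<lambda>\<omega>. e z \<omega> * ?J \<omega>)"
      using finA by (intro bexp_Un[symmetric]) auto
    finally show ?thesis using A12 by simp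
  qed
  have "reach p m ?H * ?h = bexp (\<lambda>_. p) A (\<lambda>\<omega>. \<Sum>z<Suc m. e z \<omega>) * ?h"
  proof -
    have "reach p m ?H = bprob (\<lambda>_. p) A (\<lambda>\<omega>. m \<le> card (cluster (\<omega> \<inter> (+) 0 ` ?H) 0))"
      using finA by (intro bprob_cluster_eq_reach[symmetric]) (auto simp: A_def l1_ball_def)
    also have "\<dots> = bexp (\<lambda>_. p) A (\<lambda>\<omega>. \<Sum>z<Suc m. e z \<omega>)"
      by (rule bexp_cong) (simp only: tel)
    finally show ?thesis by simp
  qed
  also have "\<dots> \<le> bexp (\<lambda>_. p) A (\<lambda>\<omega>. \<Sum>z<Suc m. e z \<omega> * ?J \<omega>)"
    unfolding bexp_sum sum_distrib_right using attach by (intro sum_mono) simp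
  also have "\<dots> \<le> bprob (\<lambda>_. p) A (\<lambda>\<omega>. m + n \<le> card (cluster (\<omega> \<inter> (+) 0 ` ?H) 0))"
  proof (rule bexp_mono)
    fix \<omega> assume w: "\<omega> \<subseteq> A"
    then have "\<omega> \<inter> (+) 0 ` ?H = \<omega>" unfolding H0 by (auto simp: A_def)
    then show "(\<Sum>z<Suc m. e z \<omega> * ?J \<omega>) \<le> of_bool (m + n \<le> card (cluster (\<omega> \<inter> (+) 0 ` ?H) 0))"
      unfolding sum_distrib_right[symmetric] tel[OF w] by simp
  qed (use assms in auto)
  also have "\<dots> = reach p (m + n) ?H"
    using finA by (intro bprob_cluster_eq_reach) (auto simp: A_def l1_ball_def)
  finally show ?thesis .
qed

text \<open>Each further site costs at most a factor p. The resulting positivity makes the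
  logarithms of these probabilities superadditive.\<close>

lemma reach_halfspace_ge:
  fixes i :: "'d::finite"
  assumes "0 \<le> p" "p \<le> 1" "1 \<le> n"
  shows "p ^ n \<le> reach p n (halfspace i)"
  using assms(3)
proof (induction n rule: dec_induct)
  case base
  then show ?case using reach_1[of "halfspace i" p] by (simp add: halfspace_def)
next
  case (step n)
  have "p ^ n * p \<le> reach p n (halfspace i) * reach p 1 (halfspace i)"
    using step assms reach_1[of "halfspace i" p]
    by (simp add: halfspace_def mult_right_mono)
  also have "\<dots> \<le> reach p (n + 1) (halfspace i)"
    using step assms by (intro reach_halfspace_supermult) auto
  finally show ?case by (simp add: mult.commute)
qed

lemma reach_le_UNIV:
  fixes B :: "(int ^ 'd::finite) set"
  assumes "0 \<le> p" "p \<le> 1"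
  shows "reach p n B \<le> reach p n (UNIV :: (int ^ 'd) set)"
  using bprob_cluster_eq_reach[of "l1_ball 0 n \<inter> B" 0 n B p]
    bprob_cluster_le_reach[of "l1_ball 0 n \<inter> B" p n 0 "UNIV :: (int ^ 'd) set"] assms
  by (simp add: reach_def)

text \<open>A lowest site of the cluster of the origin has the same cluster, which lies in the half-space
  above it.\<close>

lemma reach_le_halfspace:
  fixes i :: "'d::finite"
  assumes "0 \<le> p" "p \<le> 1"
  shows "reach p n (UNIV :: (int ^ 'd) set) \<le> (2 * real n + 1) ^ CARD('d) * reach p n (halfspace i)"
proof -
  let ?L = "l1_ball (0 :: int ^ 'd) n" and ?H = "halfspace i"
  have "reach p n (UNIV :: (int ^ 'd) set)
      \<le> bexp (\<lambda>_. p) ?L (\<lambda>\<omega>. \<Sum>x\<in>?L. of_bool (n \<le> card (cluster (\<omega> \<inter> (+) x ` ?H) x)))"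
    unfolding reach_def Int_UNIV_right
  proof (rule bexp_mono)
    fix \<omega> assume w: "\<omega> \<subseteq> ?L"
    have fin: "finite (cluster \<omega> 0)"
      by (rule finite_subset[OF cluster_subset finite_subset[OF w]]) simp
    show "of_bool (n \<le> card (cluster \<omega> 0))
      \<le> (\<Sum>x\<in>?L. of_bool (n \<le> card (cluster (\<omega> \<inter> (+) x ` ?H) x)) :: real)"
    proof (cases "n \<le> card (cluster \<omega> 0)")
      case n: True
      have "\<exists>x\<in>?L. n \<le> card (cluster (\<omega> \<inter> (+) x ` ?H) x)"
      proof (cases "cluster \<omega> 0 = {}")
        case False
        obtain x where x: "x \<in> cluster \<omega> 0" "\<And>y. y \<in> cluster \<omega> 0 \<Longrightarrow> x $ i \<le> y $ i"
          using ex_min_if_finite[of "(\<lambda>y. y $ i) ` cluster \<omega> 0"] fin False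
          by (force simp: not_less)
        have eq: "cluster \<omega> x = cluster \<omega> 0" using x(1) by (rule cluster_eq)
        then have "cluster \<omega> x \<subseteq> (+) x ` ?H" using x(2) by (auto simp: translate_halfspace)
        then have "cluster \<omega> x = cluster (\<omega> \<inter> (+) x ` ?H) x" by (rule cluster_restrict)
        moreover have "x \<in> ?L" using x(1) w cluster_subset by blast
        ultimately show ?thesis using n eq by (intro bexI[of _ x]) simp_all
      next
        case True
        then show ?thesis using n self_in_l1_ball[of 0 n] by (intro bexI[of _ 0]) simp_all
      qed
      then obtain x where x: "x \<in> ?L" "n \<le> card (cluster (\<omega> \<inter> (+) x ` ?H) x)" by blast
      have "of_bool (n \<le> card (cluster (\<omega> \<inter> (+) x ` ?H) x))
        \<le> (\<Sum>x\<in>?L. of_bool (n \<le> card (cluster (\<omega> \<inter> (+) x ` ?H) x)) :: real)"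
        using x(1) by (intro member_le_sum) auto
      then show ?thesis using x(2) n by simp
    qed (simp add: sum_nonneg)
  qed (use assms in auto)
  also have "\<dots> \<le> (\<Sum>x\<in>?L. reach p n ?H)"
    unfolding bexp_sum using assms by (intro sum_mono bprob_cluster_le_reach) auto
  also have "\<dots> = real (card ?L) * reach p n ?H" by simp
  also have "\<dots> \<le> (2 * real n + 1) ^ CARD('d) * reach p n ?H"
  proof (intro mult_right_mono)
    have "real (card ?L) \<le> real ((2 * n + 1) ^ CARD('d))" by (intro of_nat_mono card_l1_ball)
    then show "real (card ?L) \<le> (2 * real n + 1) ^ CARD('d)" by (simp add: add.commute)
  qed (use reach_bounds assms in blast)
  finally show ?thesis .
qed

lemma reach_pos:
  assumes "0 < p" "p \<le> 1" "1 \<le> n"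
  shows "0 < reach p n (UNIV :: (int ^ 'd::finite) set)"
proof -
  have "0 < p ^ n" using assms by simp
  also have "\<dots> \<le> reach p n (halfspace (undefined :: 'd))"
    using assms by (intro reach_halfspace_ge) auto
  also have "\<dots> \<le> reach p n (UNIV :: (int ^ 'd) set)" using assms by (intro reach_le_UNIV) auto
  finally show ?thesis .
qed

text \<open>The limit exists for the half-space by superadditivity. The whole lattice differs from
  it by a polynomial factor only, which disappears after taking logarithms and dividing by
  k.\<close>

lemma reach_rate_exists:
  assumes "0 < p" "p \<le> 1"
  obtains L where "(\<lambda>k. 1 / real k * ln (reach p k (UNIV :: (int ^ 'd::finite) set))) \<longlonglongrightarrow> L"
proof -
  \<comment> \<open>Any coordinate direction will do for the half-space; \<open>undefined\<close>
    picks one.\<close>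
  let ?h = "\<lambda>n. reach p n (halfspace (undefined :: 'd))"
  let ?q = "\<lambda>n. reach p n (UNIV :: (int ^ 'd) set)"
  have hpos: "0 < ?h n" if "1 \<le> n" for n
    using reach_halfspace_ge[of p n] assms that zero_less_power[OF assms(1), of n]
    by (meson less_le_trans less_imp_le)
  have "ln (?h m) + ln (?h n) \<le> ln (?h (m + n))" if "1 \<le> m" "1 \<le> n" for m n
    using reach_halfspace_supermult[of p m n] hpos[OF that(1)] hpos[OF that(2)] hpos[of "m + n"] assms that
    by (simp add: ln_mult_pos[symmetric])
  moreover have "ln (?h n) \<le> 0" if "1 \<le> n" for n
    using hpos[OF that] reach_bounds(2)[of p n] assms by simp
  ultimately obtain L where L: "(\<lambda>n. ln (?h n) / real n) \<longlonglongrightarrow> L"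
    by (rule fekete_superadditive)
  have lim0: "(\<lambda>n. real CARD('d) * ln (2 * real n + 1) / real n) \<longlonglongrightarrow> 0" by real_asymp
  have "(\<lambda>k. 1 / real k * ln (?q k)) \<longlonglongrightarrow> L"
  proof (rule tendsto_sandwich[OF _ _ L])
    show "(\<lambda>n. ln (?h n) / real n + real CARD('d) * ln (2 * real n + 1) / real n) \<longlonglongrightarrow> L"
      using tendsto_add[OF L lim0] by simp
    show "eventually (\<lambda>n. ln (?h n) / real n \<le> 1 / real n * ln (?q n)) sequentially"
      using eventually_ge_at_top[of 1]
    proof eventually_elim
      case (elim n)
      have "ln (?h n) \<le> ln (?q n)"
        using hpos[OF elim] reach_le_UNIV[of p n] assms by (intro ln_mono) auto
      then show ?case by (simp add: divide_right_mono)
    qed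
    show "eventually (\<lambda>n. 1 / real n * ln (?q n)
        \<le> ln (?h n) / real n + real CARD('d) * ln (2 * real n + 1) / real n) sequentially"
      using eventually_ge_at_top[of 1]
    proof eventually_elim
      case (elim n)
      have "ln (?q n) \<le> ln ((2 * real n + 1) ^ CARD('d) * ?h n)"
        using reach_pos[OF assms elim] reach_le_halfspace[of p n] assms by (intro ln_mono) auto
      also have "\<dots> = real CARD('d) * ln (2 * real n + 1) + ln (?h n)"
        using hpos[OF elim] by (simp add: ln_mult_pos ln_realpow)
      finally have "ln (?q n) / real n \<le> (real CARD('d) * ln (2 * real n + 1) + ln (?h n)) / real n"
        by (intro divide_right_mono) auto
      then show ?case by (simp add: add_divide_distrib)
    qed
  qed
  then show ?thesis by (rule that)
qed

subsection \<open>Product measures\<close>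

text \<open>The bridge from product measures to finite sums: the patterns of coordinates falling
  into their sets \<open>B v\<close> partition the space into finitely many boxes. The index set I
  may be infinite, so both percolation on the lattice and observations on the grid are
  covered.\<close>

lemma
  fixes M :: "'i \<Rightarrow> 'a measure"
  assumes M: "\<And>i. prob_space (M i)" and A: "finite A" "A \<subseteq> I"
    and B: "\<And>v. v \<in> A \<Longrightarrow> B v \<in> sets (M v)"
  shows sets_PiM_pattern: "{x \<in> space (PiM I M). Q {v \<in> A. x v \<in> B v}} \<in> sets (PiM I M)"
    and measure_PiM_pattern: "measure (PiM I M) {x \<in> space (PiM I M). Q {v \<in> A. x v \<in> B v}}
      = bprob (\<lambda>v. measure (M v) (B v)) A Q"
proof -
  interpret product_prob_space M I
    by (intro product_prob_spaceI M)
  let ?P = "PiM I M"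
  define X where "X a v = (if v \<in> a then B v else space (M v) - B v)" for a v
  define E where "E a = {x \<in> space ?P. \<forall>v\<in>A. x v \<in> X a v}" for a
  have X: "X a v \<in> sets (M v)" if "v \<in> A" for a v using B[OF that] by (simp add: X_def)
  have E_sets: "E a \<in> sets ?P" for a
    unfolding E_def
    by (intro sets.sets_Collect_finite_All A sets_Collect_single X) (use A in auto)
  have E_iff: "x \<in> E a \<longleftrightarrow> x \<in> space ?P \<and> {v \<in> A. x v \<in> B v} = a" if "a \<in> Pow A" for x a
    using that A(2) unfolding E_def X_def by (auto simp: space_PiM PiE_iff split: if_splits)
  have disj: "disjoint_family_on E {a \<in> Pow A. Q a}"
  proof (unfold disjoint_family_on_def, intro ballI impI equals0I)
    fix a b x assume ab: "a \<in> {a \<in> Pow A. Q a}" "b \<in> {a \<in> Pow A. Q a}" "a \<noteq> b" "x \<in> E a \<inter> E b"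
    have a: "a \<in> Pow A" and b: "b \<in> Pow A" and x: "x \<in> E a" "x \<in> E b" using ab by auto
    have "{v \<in> A. x v \<in> B v} = a" by (rule conjunct2[OF iffD1[OF E_iff[OF a] x(1)]])
    moreover have "{v \<in> A. x v \<in> B v} = b" by (rule conjunct2[OF iffD1[OF E_iff[OF b] x(2)]])
    ultimately show False using ab(3) by simp
  qed
  have eq: "{x \<in> space ?P. Q {v \<in> A. x v \<in> B v}} = (\<Union>a\<in>{a \<in> Pow A. Q a}. E a)"
  proof (intro set_eqI iffI)
    fix x assume x: "x \<in> {x \<in> space ?P. Q {v \<in> A. x v \<in> B v}}"
    then have "x \<in> E {v \<in> A. x v \<in> B v}" by (subst E_iff) auto
    then show "x \<in> (\<Union>a\<in>{a \<in> Pow A. Q a}. E a)"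
      using x by (intro UN_I[of "{v \<in> A. x v \<in> B v}"]) auto
  next
    fix x assume "x \<in> (\<Union>a\<in>{a \<in> Pow A. Q a}. E a)"
    then obtain a where "a \<in> Pow A" "Q a" "x \<in> E a" by blast
    then show "x \<in> {x \<in> space ?P. Q {v \<in> A. x v \<in> B v}}" using E_iff[of a x] by simp
  qed
  have fin: "finite {a \<in> Pow A. Q a}" using A by simp
  show "{x \<in> space ?P. Q {v \<in> A. x v \<in> B v}} \<in> sets ?P"
    unfolding eq using fin E_sets by (intro sets.finite_UN) auto
  have mE: "measure ?P (E a) = (\<Prod>v\<in>a. measure (M v) (B v)) * (\<Prod>v\<in>A - a. 1 - measure (M v) (B v))"
    if a: "a \<in> Pow A" for a
  proof -
    have "emeasure ?P (E a) = (\<Prod>v\<in>A. emeasure (M v) (X a v))"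
      unfolding E_def using A X by (intro emeasure_PiM_Collect) auto
    also have "\<dots> = ennreal (\<Prod>v\<in>A. measure (M v) (X a v))"
      by (subst prod_ennreal[symmetric]) (simp_all add: M.emeasure_eq_measure)
    finally have "measure ?P (E a) = (\<Prod>v\<in>A. measure (M v) (X a v))"
      by (simp add: measure_def prod_nonneg)
    also have "\<dots> = (\<Prod>v\<in>a. measure (M v) (X a v)) * (\<Prod>v\<in>A - a. measure (M v) (X a v))"
      using A a by (simp add: prod.subset_diff mult.commute)
    also have "(\<Prod>v\<in>a. measure (M v) (X a v)) = (\<Prod>v\<in>a. measure (M v) (B v))"
      by (simp add: X_def)
    also have "(\<Prod>v\<in>A - a. measure (M v) (X a v)) = (\<Prod>v\<in>A - a. 1 - measure (M v) (B v))"
      by (rule prod.cong) (auto simp: X_def M.prob_compl B)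
    finally show ?thesis .
  qed
  have "measure ?P {x \<in> space ?P. Q {v \<in> A. x v \<in> B v}} = (\<Sum>a\<in>{a \<in> Pow A. Q a}. measure ?P (E a))"
    unfolding eq using fin E_sets disj by (intro P.finite_measure_finite_Union) auto
  also have "\<dots> = bprob (\<lambda>v. measure (M v) (B v)) A Q"
    unfolding bexp_def using A by (intro sum.mono_neutral_cong_left) (auto simp: mE)
  finally show "measure ?P {x \<in> space ?P. Q {v \<in> A. x v \<in> B v}}
      = bprob (\<lambda>v. measure (M v) (B v)) A Q" .
qed

text \<open>Localised to a ball and written with membership in \<open>{True}\<close>, so that the
  event has the form required by \<open>measure_PiM_pattern\<close>.\<close>

lemma origin_cluster_size_ge_iff:
  "enat k \<le> origin_cluster_size \<omega>
    \<longleftrightarrow> k \<le> card (cluster {v \<in> l1_ball 0 k. \<omega> v \<in> {True}} 0)"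
proof -
  have "{v. \<omega> v} \<inter> l1_ball 0 k = {v \<in> l1_ball 0 k. \<omega> v \<in> {True}}" by auto
  then show ?thesis
    using cluster_localize[of "{v. \<omega> v}" 0 k]
    by (cases "finite (cluster {v. \<omega> v} 0)") (simp_all add: origin_cluster_size_def Let_def)
qed

lemma
  fixes D :: "'d::finite itself"
  assumes p: "0 \<le> p" "p \<le> 1"
  shows sets_origin_cluster_size_ge:
      "{\<omega> \<in> space (site_percolation D p). enat k \<le> origin_cluster_size \<omega>} \<in> sets (site_percolation D p)"
    and measure_origin_cluster_size_ge:
      "measure (site_percolation D p) {\<omega> \<in> space (site_percolation D p). enat k \<le> origin_cluster_size \<omega>}
        = reach p k (UNIV :: (int ^ 'd) set)"
proof -
  let ?Q = "\<lambda>a. k \<le> card (cluster a (0 :: int ^ 'd))"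
  have P: "prob_space (measure_pmf (bernoulli_pmf p))" by (rule measure_pmf.prob_space_axioms)
  show "{\<omega> \<in> space (site_percolation D p). enat k \<le> origin_cluster_size \<omega>} \<in> sets (site_percolation D p)"
    unfolding origin_cluster_size_ge_iff site_percolation_def
    by (rule sets_PiM_pattern[where Q = ?Q]) (use P in auto)
  have "measure (site_percolation D p) {\<omega> \<in> space (site_percolation D p). enat k \<le> origin_cluster_size \<omega>}
      = bprob (\<lambda>_. measure (measure_pmf (bernoulli_pmf p)) {True}) (l1_ball 0 k) ?Q"
    unfolding origin_cluster_size_ge_iff site_percolation_def
    by (rule measure_PiM_pattern[where Q = ?Q]) (use P in auto)
  then show "measure (site_percolation D p) {\<omega> \<in> space (site_percolation D p). enat k \<le> origin_cluster_size \<omega>}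
        = reach p k (UNIV :: (int ^ 'd) set)"
    using p by (simp add: reach_def measure_pmf_single)
qed

text \<open>The event of an infinite cluster is the decreasing intersection of the events of at
  least k sites, so continuity from above applies.\<close>

lemma AE_finite_cluster_iff:
  fixes D :: "'d::finite itself"
  assumes p: "0 \<le> p" "p \<le> 1"
  shows "(AE \<omega> in site_percolation D p. origin_cluster_size \<omega> < \<infinity>)
    \<longleftrightarrow> (\<lambda>k. reach p k (UNIV :: (int ^ 'd) set)) \<longlonglongrightarrow> 0"
proof -
  let ?M = "site_percolation D p"
  let ?E = "\<lambda>k. {\<omega> \<in> space ?M. enat k \<le> origin_cluster_size \<omega>}"
  interpret prob_space ?M
    unfolding site_percolation_def by (intro prob_space_PiM measure_pmf.prob_space_axioms)
  have lim: "(\<lambda>k. reach p k (UNIV :: (int ^ 'd) set)) \<longlonglongrightarrow> measure ?M (\<Inter>k. ?E k)"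
    unfolding measure_origin_cluster_size_ge[OF p, of D, symmetric]
  proof (rule finite_Lim_measure_decseq)
    show "range ?E \<subseteq> sets ?M" using sets_origin_cluster_size_ge[OF p] by blast
    show "decseq ?E" unfolding decseq_def by (auto intro: order_trans[rotated])
  qed
  have "x = \<infinity>" if "\<And>k. enat k \<le> x" for x :: enat
    using that by (metis enat.exhaust Suc_n_not_le_n enat_ord_simps(1) infinity_enat_def not_enat_eq)
  then have Inf: "(\<Inter>k. ?E k) = {\<omega> \<in> space ?M. \<not> origin_cluster_size \<omega> < \<infinity>}"
    by auto
  have S: "(\<Inter>k. ?E k) \<in> sets ?M"
    using sets_origin_cluster_size_ge[OF p, of D] by (intro sets.countable_INT) auto
  have "(AE \<omega> in ?M. origin_cluster_size \<omega> < \<infinity>) \<longleftrightarrow> emeasure ?M (\<Inter>k. ?E k) = 0"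
    by (rule AE_iff_measurable[OF S Inf[symmetric]])
  also have "\<dots> \<longleftrightarrow> measure ?M (\<Inter>k. ?E k) = 0"
    by (simp add: emeasure_eq_measure)
  also have "\<dots> \<longleftrightarrow> (\<lambda>k. reach p k (UNIV :: (int ^ 'd) set)) \<longlonglongrightarrow> 0"
    using lim LIMSEQ_unique by auto
  finally show ?thesis .
qed

subsection \<open>The critical point and the decay rate\<close>

lemma p_crit_eq:
  "p_crit TYPE('d::finite) = Sup {p. 0 < p \<and> p < 1 \<and> (\<lambda>k. reach p k (UNIV :: (int ^ 'd) set)) \<longlonglongrightarrow> 0}"
proof -
  have "0 < p \<and> p < 1 \<and> (AE \<omega> in site_percolation TYPE('d) p. origin_cluster_size \<omega> < \<infinity>)
    \<longleftrightarrow> 0 < p \<and> p < 1 \<and> (\<lambda>k. reach p k (UNIV :: (int ^ 'd) set)) \<longlonglongrightarrow> 0" for p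
    using AE_finite_cluster_iff[of p "TYPE('d)"] by auto
  then show ?thesis unfolding p_crit_def by simp
qed

lemma bdd_above_subcritical:
  "bdd_above {p::real. 0 < p \<and> p < 1 \<and> Q p}"
  by (rule bdd_aboveI[of _ 1]) auto

lemma reach_tendsto_0:
  fixes S :: "(int ^ 'd::finite) set"
  assumes "finite S" "0 \<in> S" "0 \<le> p" "p \<le> 1" "exit_mean p S < 1"
  shows "(\<lambda>k. reach p k (UNIV :: (int ^ 'd) set)) \<longlonglongrightarrow> 0"
proof -
  obtain l G :: real where l: "0 < l" "0 < G"
    and le: "\<And>n. reach p n (UNIV :: (int ^ 'd) set) \<le> G * exp (- l * real n)"
    using reach_exp_decay[OF assms] by auto
  have lim: "(\<lambda>n. G * exp (- l * real n)) \<longlonglongrightarrow> 0" using l(1) by real_asymp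
  show ?thesis
  proof (rule tendsto_sandwich[OF always_eventually always_eventually tendsto_const lim]; intro allI)
    show "0 \<le> reach p n (UNIV :: (int ^ 'd) set)" for n by (rule reach_bounds(1)[OF assms(3,4)])
    show "reach p n (UNIV :: (int ^ 'd) set) \<le> G * exp (- l * real n)" for n by (rule le)
  qed
qed

lemma subcritical_witness: "\<exists>p. 0 < p \<and> p < 1 \<and> (\<lambda>k. reach p k (UNIV :: (int ^ 'd::finite) set)) \<longlonglongrightarrow> 0"
proof -
  \<comment> \<open>Chosen so that the bound of \<open>exit_mean_singleton\<close> equals
    1/2.\<close>
  define p :: real where "p = 1 / (2 * 3 ^ CARD('d))"
  have "(1::real) \<le> 3 ^ CARD('d)" by simp
  then have "(1::real) < 2 * 3 ^ CARD('d)" by linarith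
  then have p: "0 < p" "p < 1" by (auto simp: p_def divide_simps)
  have "p * 3 ^ CARD('d) = 1 / 2" by (simp add: p_def)
  then have "exit_mean p {0 :: int ^ 'd} < 1"
    using exit_mean_singleton[of p, where 'd = 'd] p by simp
  then show ?thesis using p reach_tendsto_0[of "{0 :: int ^ 'd}" p] by auto
qed

lemma p_crit_le_1: "p_crit TYPE('d::finite) \<le> 1"
  unfolding p_crit_eq using subcritical_witness[where 'd = 'd] by (intro cSup_least) auto

lemma p_crit_pos: "0 < p_crit TYPE('d::finite)"
proof -
  obtain p where p: "0 < p" "p < 1" "(\<lambda>k. reach p k (UNIV :: (int ^ 'd) set)) \<longlonglongrightarrow> 0"
    using subcritical_witness by blast
  then have "p \<le> p_crit TYPE('d)"
    unfolding p_crit_eq by (intro cSup_upper bdd_above_subcritical) auto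
  then show ?thesis using p(1) by simp
qed

text \<open>This is the sharpness of the transition: if every finite set had exit mean at least one
  at p, then \<open>reach q\<close> would stay bounded away from 0 at each q > p, whereas some q > p
  has almost surely finite clusters.\<close>

lemma subcritical_exit_mean:
  assumes "0 < p" "p < p_crit TYPE('d::finite)"
  obtains S :: "(int ^ 'd) set" where "finite S" "0 \<in> S" "exit_mean p S < 1"
proof (rule ccontr)
  assume no: "\<not> thesis"
  have ge: "1 \<le> exit_mean p S" if "finite S" "0 \<in> S" for S :: "(int ^ 'd) set"
    using no that(1,2) \<open>\<And>S. finite S \<Longrightarrow> 0 \<in> S \<Longrightarrow> exit_mean p S < 1 \<Longrightarrow> thesis\<close> by force
  obtain q where q: "q < 1" "p < q" and lim: "(\<lambda>k. reach q k (UNIV :: (int ^ 'd) set)) \<longlonglongrightarrow> 0"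
    using assms(2) unfolding p_crit_eq
    by (subst (asm) less_cSup_iff) (use bdd_above_subcritical subcritical_witness[where 'd = 'd] in auto)
  have "min (p / 2) ((q - p) / 2) \<le> reach q k (UNIV :: (int ^ 'd) set)" for k
    using assms(1) q ge by (intro reach_ge_of_exit_mean) auto
  then have "min (p / 2) ((q - p) / 2) \<le> 0"
    using lim by (intro LIMSEQ_le_const[OF lim]) auto
  then show False using assms(1) q by (auto simp: min_def split: if_splits)
qed

text \<open>The condition \<open>exit_mean p S < 1\<close> is open in p by continuity. If it held at
  p, it would hold at some q > p, clusters would be finite at q, and q would exceed the critical
  point. The argument includes the critical point itself.\<close>

lemma supercritical_exit_mean:
  fixes S :: "(int ^ 'd::finite) set"
  assumes "p_crit TYPE('d) \<le> p" "p < 1" "finite S" "0 \<in> S"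
  shows "1 \<le> exit_mean p S"
proof (rule ccontr)
  assume "\<not> ?thesis"
  moreover have "((\<lambda>q. exit_mean q S) \<longlongrightarrow> exit_mean p S) (at_right p)"
    using continuous_exit_mean[OF assms(3)]
    by (metis UNIV_I continuous_on_def tendsto_within_subset subset_UNIV)
  ultimately have "eventually (\<lambda>q. exit_mean q S < 1) (at_right p)"
    by (intro order_tendstoD) auto
  moreover have "eventually (\<lambda>q. q \<in> {p<..<1}) (at_right p)"
    using assms(2) by (rule eventually_at_right_real)
  ultimately have "eventually (\<lambda>q. exit_mean q S < 1 \<and> q \<in> {p<..<1}) (at_right p)"
    by (rule eventually_conj)
  then obtain q where q: "exit_mean q S < 1" "p < q" "q < 1"
    using eventually_happens'[OF trivial_limit_at_right_real] by fastforce
  have "0 < p" using assms(1) p_crit_pos[where 'd = 'd] by simp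
  then have "(\<lambda>k. reach q k (UNIV :: (int ^ 'd) set)) \<longlonglongrightarrow> 0"
    using q assms by (intro reach_tendsto_0) auto
  then have "q \<le> p_crit TYPE('d)"
    unfolding p_crit_eq using q \<open>0 < p\<close> by (intro cSup_upper bdd_above_subcritical) auto
  then show False using q assms(1) by simp
qed

text \<open>The \<open>lim\<close> in the definition of \<open>zeta\<close> says something only
  because the limit is known to exist.\<close>

lemma zeta_tendsto:
  assumes "0 < p" "p < p_crit TYPE('d::finite)"
  shows "(\<lambda>k. 1 / real k * ln (reach p k (UNIV :: (int ^ 'd) set))) \<longlonglongrightarrow> - zeta TYPE('d) p"
proof -
  have p: "0 \<le> p" "p \<le> 1" using assms p_crit_le_1[where 'd = 'd] by auto
  obtain L where L: "(\<lambda>k. 1 / real k * ln (reach p k (UNIV :: (int ^ 'd) set))) \<longlonglongrightarrow> L"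
    using reach_rate_exists[OF assms(1) p(2)] by blast
  then have "zeta TYPE('d) p = - L"
    using assms(2) by (simp add: zeta_def measure_origin_cluster_size_ge[OF p] limI)
  then show ?thesis using L by simp
qed

lemma zeta_pos:
  assumes "0 < p" "p < p_crit TYPE('d::finite)"
  shows "0 < zeta TYPE('d) p"
proof -
  have p: "0 \<le> p" "p \<le> 1" using assms p_crit_le_1[where 'd = 'd] by auto
  obtain S :: "(int ^ 'd) set" where S: "finite S" "0 \<in> S" "exit_mean p S < 1"
    by (rule subcritical_exit_mean[OF assms])
  obtain l G :: real where l: "0 < l" "0 < G"
    and le: "\<And>n. reach p n (UNIV :: (int ^ 'd) set) \<le> G * exp (- l * real n)"
    using reach_exp_decay[OF S(1,2) p S(3)] by auto
  have "(\<lambda>n. ln G / real n - l) \<longlonglongrightarrow> - l" by real_asymp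
  moreover have "eventually (\<lambda>k. 1 / real k * ln (reach p k (UNIV :: (int ^ 'd) set)) \<le> ln G / real k - l) sequentially"
    using eventually_ge_at_top[of 1]
  proof eventually_elim
    case (elim k)
    have "ln (reach p k (UNIV :: (int ^ 'd) set)) \<le> ln (G * exp (- l * k))"
      using reach_pos[OF assms(1) p(2) elim, where 'd = 'd] le by (intro ln_mono) auto
    also have "\<dots> = ln G - l * k" using l by (simp add: ln_mult_pos)
    finally have "ln (reach p k (UNIV :: (int ^ 'd) set)) / real k \<le> (ln G - l * k) / real k"
      by (intro divide_right_mono) auto
    then show ?case using elim by (simp add: diff_divide_distrib)
  qed
  ultimately have "- zeta TYPE('d) p \<le> - l"
    using zeta_tendsto[OF assms] by (intro tendsto_le[OF sequentially_bot])
  then show ?thesis using l(1) by simp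
qed

text \<open>The exponent g > 1 solves \<open>q powr g = p\<close>. The power inequality turns into
  \<open>g * zeta q \<le> zeta p\<close>, and positivity of the rate at q makes the comparison
  strict.\<close>

lemma zeta_strict_antimono:
  assumes "0 < p" "p < q" "q < p_crit TYPE('d::finite)"
  shows "zeta TYPE('d) q < zeta TYPE('d) p"
proof -
  have q1: "q < 1" using assms p_crit_le_1[where 'd = 'd] by simp
  define g where "g = ln p / ln q"
  have lnq: "ln q < 0" and lnp: "ln p < ln q" using assms q1 by auto
  have g1: "1 < g" using lnq lnp by (simp add: g_def divide_simps)
  have qg: "q powr g = p" using assms q1 by (simp add: powr_def g_def)
  have le: "reach p k (UNIV :: (int ^ 'd) set) \<le> reach q k (UNIV :: (int ^ 'd) set) powr g" for k
  proof -
    have "bexp (\<lambda>_. q powr g) (l1_ball 0 k) (\<lambda>\<omega>. of_bool (k \<le> card (cluster \<omega> (0 :: int ^ 'd))) powr g)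
      \<le> (bexp (\<lambda>_. q) (l1_ball 0 k) (\<lambda>\<omega>. of_bool (k \<le> card (cluster \<omega> (0 :: int ^ 'd))))) powr g"
    proof (rule bexp_powr_le)
      fix a b :: "(int ^ 'd) set" assume ab: "a \<subseteq> b" "b \<subseteq> l1_ball 0 k"
      then have "card (cluster a 0) \<le> card (cluster b 0)"
        using finite_subset[OF ab(2)] by (intro card_cluster_mono) auto
      then show "of_bool (k \<le> card (cluster a 0)) \<le> (of_bool (k \<le> card (cluster b 0)) :: real)"
        by (intro of_bool_mono) simp
    qed (use assms q1 g1 in auto)
    moreover have "of_bool Q powr g = (of_bool Q :: real)" for Q using g1 by (cases Q) auto
    ultimately show ?thesis by (simp add: reach_def qg)
  qed
  have "eventually (\<lambda>k. 1 / real k * ln (reach p k (UNIV :: (int ^ 'd) set))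
      \<le> g * (1 / real k * ln (reach q k (UNIV :: (int ^ 'd) set)))) sequentially"
    using eventually_ge_at_top[of 1]
  proof eventually_elim
    case (elim k)
    have pos: "0 < reach p k (UNIV :: (int ^ 'd) set)" "0 < reach q k (UNIV :: (int ^ 'd) set)"
      using assms q1 elim by (auto intro!: reach_pos)
    have "ln (reach p k (UNIV :: (int ^ 'd) set)) \<le> ln (reach q k (UNIV :: (int ^ 'd) set) powr g)"
      using le pos by (intro ln_mono) auto
    also have "\<dots> = g * ln (reach q k (UNIV :: (int ^ 'd) set))" using pos by (simp add: ln_powr)
    finally have "ln (reach p k (UNIV :: (int ^ 'd) set)) / real k
        \<le> (g * ln (reach q k (UNIV :: (int ^ 'd) set))) / real k" by (intro divide_right_mono) auto
    then show ?case by simp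
  qed
  then have "- zeta TYPE('d) p \<le> g * (- zeta TYPE('d) q)"
    using assms by (intro tendsto_le[OF sequentially_bot tendsto_mult[OF tendsto_const zeta_tendsto] zeta_tendsto]) auto
  moreover have "1 * zeta TYPE('d) q < g * zeta TYPE('d) q"
    using g1 zeta_pos[of q, where 'd = 'd] assms by (intro mult_strict_right_mono) auto
  ultimately show ?thesis by simp
qed

lemma zeta_supercritical: "p_crit TYPE('d::finite) \<le> p \<Longrightarrow> zeta TYPE('d) p = 0"
  by (simp add: zeta_def)

lemma reach_le_exp_zeta:
  fixes p b :: real
  assumes "0 < p" "p < p_crit TYPE('d::finite)" "b < zeta TYPE('d) p"
  shows "eventually (\<lambda>k. reach p k (UNIV :: (int ^ 'd) set) \<le> exp (- b * k)) sequentially"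
proof -
  have p: "0 \<le> p" "p \<le> 1" using assms p_crit_le_1[where 'd = 'd] by auto
  have "eventually (\<lambda>k. 1 / real k * ln (reach p k (UNIV :: (int ^ 'd) set)) < - b) sequentially"
    using zeta_tendsto[OF assms(1,2)] assms(3) by (intro order_tendstoD) auto
  then show ?thesis
    using eventually_ge_at_top[of 1]
  proof eventually_elim
    case (elim k)
    have pos: "0 < reach p k (UNIV :: (int ^ 'd) set)"
      using assms p elim by (auto intro!: reach_pos)
    have "ln (reach p k (UNIV :: (int ^ 'd) set)) < - b * k" using elim by (simp add: field_simps)
    then have "exp (ln (reach p k (UNIV :: (int ^ 'd) set))) \<le> exp (- b * k)"
      by (simp only: exp_le_cancel_iff)
    then show ?case using pos by simp
  qed
qed

text \<open>At and above the critical point this rests on \<open>supercritical_exit_mean\<close>: the exit criterion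
  fails for every ball, so the origin reaches distance \<open>k\<close> with polynomially small probability.\<close>

lemma reach_ge_exp_zeta:
  fixes p b :: real
  assumes "0 < p" "p < 1" "zeta TYPE('d::finite) p < b"
  shows "eventually (\<lambda>k. exp (- b * k) \<le> reach p k (UNIV :: (int ^ 'd) set)) sequentially"
proof (cases "p < p_crit TYPE('d)")
  case True
  have "eventually (\<lambda>k. - b < 1 / real k * ln (reach p k (UNIV :: (int ^ 'd) set))) sequentially"
    using zeta_tendsto[OF assms(1) True] assms(3) by (intro order_tendstoD) auto
  then show ?thesis
    using eventually_ge_at_top[of 1]
  proof eventually_elim
    case (elim k)
    have pos: "0 < reach p k (UNIV :: (int ^ 'd) set)"
      using assms elim by (auto intro!: reach_pos)
    have "- b * k < ln (reach p k (UNIV :: (int ^ 'd) set))" using elim by (simp add: field_simps)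
    then have "exp (- b * k) \<le> exp (ln (reach p k (UNIV :: (int ^ 'd) set)))"
      by (simp only: exp_le_cancel_iff)
    then show ?case using pos by simp
  qed
next
  case False
  then have b: "0 < b" using assms zeta_supercritical[of p, where 'd = 'd] by simp
  have "(\<lambda>k. (2 * real k + 3) ^ CARD('d) * exp (- b * real k)) \<longlonglongrightarrow> 0"
    using b by real_asymp
  then have "eventually (\<lambda>k. (2 * real k + 3) ^ CARD('d) * exp (- b * real k) < 1) sequentially"
    by (rule order_tendstoD) simp
  then show ?thesis
  proof eventually_elim
    case (elim k)
    have "1 \<le> exit_mean p (l1_ball (0 :: int ^ 'd) k)"
      using False assms by (intro supercritical_exit_mean) auto
    also have "\<dots> \<le> (2 * real k + 3) ^ CARD('d) * reach p k (UNIV :: (int ^ 'd) set)"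
      using assms by (intro exit_mean_le_reach) auto
    finally have "(2 * real k + 3) ^ CARD('d) * exp (- b * k)
        \<le> (2 * real k + 3) ^ CARD('d) * reach p k (UNIV :: (int ^ 'd) set)"
      using elim by linarith
    moreover have "0 < (2 * real k + 3) ^ CARD('d)" by simp
    ultimately show ?case by (rule mult_left_le_imp_le)
  qed
qed

subsection \<open>Largest clusters\<close>

lemma le_largest_cluster_iff:
  assumes "finite A" "1 \<le> k"
  shows "k \<le> largest_cluster A \<longleftrightarrow> (\<exists>v\<in>A. k \<le> card (cluster A v))"
  unfolding largest_cluster_def using assms by (subst Max_ge_iff) auto

lemma card_cluster_le_largest:
  assumes "finite A"
  shows "card (cluster A v) \<le> largest_cluster A"
proof (cases "v \<in> A")
  case True
  then show ?thesis unfolding largest_cluster_def using assms by (intro Max_ge) auto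
qed (simp add: cluster_empty)

lemma largest_cluster_mono:
  assumes "finite B" "A \<subseteq> B"
  shows "largest_cluster A \<le> largest_cluster B"
proof (cases "largest_cluster A = 0")
  case False
  have "finite A" using assms(2,1) by (rule finite_subset)
  then obtain v where "v \<in> A" "largest_cluster A \<le> card (cluster A v)"
    using le_largest_cluster_iff[of A "largest_cluster A"] False by auto
  then show ?thesis
    using card_cluster_mono[OF assms, of v] card_cluster_le_largest[OF assms(1), of v] by linarith
qed simp

text \<open>A largest cluster with more than k sites cannot meet K, because every cluster meeting K
  has fewer than k; so it survives the removal of K unchanged.\<close>

lemma largest_cluster_remove:
  assumes "finite A" "k \<le> largest_cluster (A - K)" "\<And>v. v \<in> K \<Longrightarrow> \<not> k \<le> card (cluster A v)"
  shows "largest_cluster A \<le> largest_cluster (A - K)"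
proof (cases "largest_cluster A \<le> k")
  case False
  then obtain v where v: "v \<in> A" "largest_cluster A \<le> card (cluster A v)"
    using le_largest_cluster_iff[OF assms(1), of "largest_cluster A"] by auto
  have "cluster A v \<subseteq> - K"
  proof
    fix u assume "u \<in> cluster A v"
    then have "cluster A u = cluster A v" by (rule cluster_eq)
    then show "u \<in> - K" using assms(3)[of u] v(2) False by auto
  qed
  then have "cluster A v = cluster (A \<inter> - K) v" by (rule cluster_restrict)
  then have "card (cluster A v) \<le> largest_cluster (A - K)"
    using card_cluster_le_largest[of "A - K" v] assms(1) by (simp add: Diff_eq)
  then show ?thesis using v(2) by simp
qed (use assms(2) in simp)

lemma bprob_compl:
  assumes "finite A"
  shows "bprob p A (\<lambda>\<omega>. \<not> Q \<omega>) = 1 - bprob p A Q"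
  using bexp_diff[of p A "\<lambda>_. 1" "\<lambda>\<omega>. of_bool (Q \<omega>)"] assms
  by (simp add: bexp_const of_bool_not_iff)

lemma bprob_le_largest:
  fixes A :: "(int ^ 'd::finite) set"
  assumes "finite A" "0 \<le> p" "p \<le> 1" "1 \<le> k"
  shows "bprob (\<lambda>_. p) A (\<lambda>\<omega>. k \<le> largest_cluster \<omega>) \<le> card A * reach p k (UNIV :: (int ^ 'd) set)"
proof -
  have "bprob (\<lambda>_. p) A (\<lambda>\<omega>. k \<le> largest_cluster \<omega>)
      \<le> bexp (\<lambda>_. p) A (\<lambda>\<omega>. \<Sum>v\<in>A. of_bool (k \<le> card (cluster \<omega> v)))"
  proof (rule bexp_mono)
    fix \<omega> assume w: "\<omega> \<subseteq> A"
    show "of_bool (k \<le> largest_cluster \<omega>) \<le> (\<Sum>v\<in>A. of_bool (k \<le> card (cluster \<omega> v)) :: real)"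
    proof (cases "k \<le> largest_cluster \<omega>")
      case True
      then obtain v where v: "v \<in> A" "k \<le> card (cluster \<omega> v)"
        using le_largest_cluster_iff[OF finite_subset[OF w assms(1)] assms(4)] w by auto
      have "of_bool (k \<le> card (cluster \<omega> v)) \<le> (\<Sum>v\<in>A. of_bool (k \<le> card (cluster \<omega> v)) :: real)"
        using v(1) assms(1) by (intro member_le_sum) auto
      then show ?thesis using v(2) True by simp
    qed (simp add: sum_nonneg)
  qed (use assms in auto)
  also have "\<dots> \<le> (\<Sum>v\<in>A. reach p k (UNIV :: (int ^ 'd) set))"
    unfolding bexp_sum using assms by (intro sum_mono bprob_le_reach) auto
  finally show ?thesis by simp
qed

lemma bprob_largest_less_superset:
  assumes "finite A" "B \<subseteq> A" "\<And>v. v \<in> A \<Longrightarrow> 0 \<le> p v \<and> p v \<le> 1"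
  shows "bprob p A (\<lambda>\<omega>. largest_cluster \<omega> < k) \<le> bprob p B (\<lambda>\<omega>. largest_cluster \<omega> < k)"
proof -
  have "bprob p A (\<lambda>\<omega>. largest_cluster \<omega> < k) \<le> bprob p A (\<lambda>\<omega>. largest_cluster (\<omega> \<inter> B) < k)"
  proof (intro bexp_mono of_bool_mono assms(3))
    fix \<omega> assume "\<omega> \<subseteq> A" "largest_cluster \<omega> < k"
    then show "largest_cluster (\<omega> \<inter> B) < k"
      using largest_cluster_mono[of \<omega> "\<omega> \<inter> B"] finite_subset[OF _ assms(1)] by fastforce
  qed
  also have "\<dots> = bprob p B (\<lambda>\<omega>. largest_cluster (\<omega> \<inter> B) < k)"
    using assms by (intro bexp_restrict) auto
  also have "\<dots> = bprob p B (\<lambda>\<omega>. largest_cluster \<omega> < k)"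
    by (rule bexp_cong) (simp add: Int_absorb2)
  finally show ?thesis .
qed

lemma bprob_largest_less_antimono:
  assumes "finite A" "\<And>v. v \<in> A \<Longrightarrow> 0 \<le> p v \<and> p v \<le> q v \<and> q v \<le> 1"
  shows "bprob q A (\<lambda>\<omega>. largest_cluster \<omega> < k) \<le> bprob p A (\<lambda>\<omega>. largest_cluster \<omega> < k)"
proof -
  have "bprob p A (\<lambda>\<omega>. \<not> largest_cluster \<omega> < k) \<le> bprob q A (\<lambda>\<omega>. \<not> largest_cluster \<omega> < k)"
  proof (intro bexp_mono_p[OF assms] of_bool_mono)
    fix a b assume "a \<subseteq> b" "b \<subseteq> A" "\<not> largest_cluster a < k"
    then show "\<not> largest_cluster b < k"
      using largest_cluster_mono[of b a] finite_subset[OF _ assms(1)] by fastforce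
  qed
  then show ?thesis by (simp only: bprob_compl[OF assms(1)])
qed

section \<open>Cubes, packings and the two error probabilities\<close>

definition cube :: "int ^ 'd::finite \<Rightarrow> nat \<Rightarrow> (int ^ 'd) set" where
  "cube a l = {v. \<forall>i. v $ i \<in> {a $ i..<a $ i + int l}}"

lemma finite_cube [simp]: "finite (cube a l)"
  unfolding cube_def by (rule finite_vec_box) simp

lemma card_cube: "card (cube (a :: int ^ 'd::finite) l) = l ^ CARD('d)"
  unfolding cube_def card_vec_box by simp

text \<open>A cube contains \<open>(l div (2 * k + 1)) ^ d\<close> disjoint balls of radius \<open>k\<close>, each of which holds
  a cluster of size \<open>k\<close> around its centre independently with probability \<open>reach p k UNIV\<close>.\<close>

lemma bprob_cube_largest_less:
  fixes a :: "int ^ 'd::finite"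
  assumes "0 \<le> p" "p \<le> 1"
  shows "bprob (\<lambda>_. p) (cube a l) (\<lambda>\<omega>. largest_cluster \<omega> < k)
    \<le> exp (- (reach p k (UNIV :: (int ^ 'd) set) * real (l div (2 * k + 1)) ^ CARD('d)))"
proof -
  let ?q = "reach p k (UNIV :: (int ^ 'd) set)"
  define N where "N = l div (2 * k + 1)"
  define J :: "(int ^ 'd) set" where "J = {j. \<forall>i. j $ i \<in> {0..<int N}}"
  \<comment> \<open>The centre of block j in a partition of the cube into blocks of side 2k + 1; the
    offset k is what makes a ball of radius k fit into its block.\<close>
  define c :: "int ^ 'd \<Rightarrow> int ^ 'd" where "c j = (\<chi> i. a $ i + int k + int (2 * k + 1) * j $ i)" for j
  define B where "B j = l1_ball (c j) k" for j
  have Nl: "int (2 * k + 1) * int N \<le> int l"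
    by (simp only: N_def of_nat_mult[symmetric] of_nat_le_iff) (rule times_div_less_eq_dividend)
  have finJ: "finite J" unfolding J_def by (rule finite_vec_box) simp
  have cardJ: "card J = N ^ CARD('d)" unfolding J_def card_vec_box by simp
  have Bi: "\<bar>x $ i - c j $ i\<bar> \<le> int k" if "x \<in> B j" for x j i
    using that abs_component_le_l1[of "x - c j" i] by (simp add: B_def l1_ball_def)
  have disj: "disjoint_family_on B J"
  proof (unfold disjoint_family_on_def, intro ballI impI equals0I)
    fix j j' x assume j: "j \<noteq> j'" and x: "x \<in> B j \<inter> B j'"
    have "j $ i = j' $ i" for i
    proof -
      have "\<bar>c j $ i - c j' $ i\<bar> \<le> 2 * int k" using Bi[of x j i] Bi[of x j' i] x by auto
      moreover have "c j $ i - c j' $ i = int (2 * k + 1) * (j $ i - j' $ i)"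
        by (simp add: c_def algebra_simps)
      ultimately have le: "int (2 * k + 1) * \<bar>j $ i - j' $ i\<bar> \<le> 2 * int k" by (simp add: abs_mult)
      have "\<not> 1 \<le> \<bar>j $ i - j' $ i\<bar>"
      proof
        assume "1 \<le> \<bar>j $ i - j' $ i\<bar>"
        then have "int (2 * k + 1) * 1 \<le> int (2 * k + 1) * \<bar>j $ i - j' $ i\<bar>"
          by (intro mult_left_mono) auto
        from order_trans[OF this le] show False by simp
      qed
      then show ?thesis by simp
    qed
    then show False using j by (simp add: vec_eq_iff)
  qed
  have sub: "B j \<subseteq> cube a l" if j: "j \<in> J" for j
  proof
    fix x assume x: "x \<in> B j"
    have "x $ i \<in> {a $ i..<a $ i + int l}" for i
    proof -
      have ji: "0 \<le> j $ i" "j $ i + 1 \<le> int N" using j by (auto simp: J_def dest: spec[of _ i])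
      define y where "y = int (2 * k + 1) * j $ i"
      have "int (2 * k + 1) * (j $ i + 1) \<le> int (2 * k + 1) * int N"
        using ji by (intro mult_left_mono) auto
      then have "y + int (2 * k + 1) \<le> int l"
        using Nl by (simp only: y_def distrib_left mult_1_right)
      moreover have "0 \<le> y" using ji by (simp add: y_def)
      moreover have "\<bar>x $ i - (a $ i + int k + y)\<bar> \<le> int k"
        using Bi[OF x, of i] by (simp only: c_def y_def vec_lambda_beta)
      ultimately have "a $ i \<le> x $ i" "x $ i < a $ i + int l" by linarith+
      then show ?thesis by simp
    qed
    then show "x \<in> cube a l" by (simp add: cube_def)
  qed
  let ?g = "\<lambda>j \<omega>. of_bool (\<not> k \<le> card (cluster \<omega> (c j))) :: real"
  have "bprob (\<lambda>_. p) (cube a l) (\<lambda>\<omega>. largest_cluster \<omega> < k)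
      \<le> bexp (\<lambda>_. p) (cube a l) (\<lambda>\<omega>. \<Prod>j\<in>J. ?g j (\<omega> \<inter> B j))"
  proof (rule bexp_mono)
    fix \<omega> assume w: "\<omega> \<subseteq> cube a l"
    then have fw: "finite \<omega>" by (rule finite_subset) simp
    show "of_bool (largest_cluster \<omega> < k) \<le> (\<Prod>j\<in>J. ?g j (\<omega> \<inter> B j))"
    proof (cases "largest_cluster \<omega> < k")
      case True
      have "?g j (\<omega> \<inter> B j) = 1" for j
        using card_cluster_mono[OF fw, of "\<omega> \<inter> B j" "c j"] card_cluster_le_largest[OF fw, of "c j"] True
        by simp
      then show ?thesis by simp
    qed (simp add: prod_nonneg)
  qed (use assms in auto)
  also have "\<dots> = bexp (\<lambda>_. p) (\<Union>j\<in>J. B j) (\<lambda>\<omega>. \<Prod>j\<in>J. ?g j (\<omega> \<inter> B j))"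
  proof (rule bexp_restrict)
    fix \<omega>
    show "(\<Prod>j\<in>J. ?g j (\<omega> \<inter> B j)) = (\<Prod>j\<in>J. ?g j (\<omega> \<inter> (\<Union>j\<in>J. B j) \<inter> B j))"
    proof (rule prod.cong)
      fix j assume "j \<in> J"
      then have "\<omega> \<inter> (\<Union>j\<in>J. B j) \<inter> B j = \<omega> \<inter> B j" by auto
      then show "?g j (\<omega> \<inter> B j) = ?g j (\<omega> \<inter> (\<Union>j\<in>J. B j) \<inter> B j)" by simp
    qed simp
  qed (use sub in auto)
  also have "\<dots> = (\<Prod>j\<in>J. bexp (\<lambda>_. p) (B j) (?g j))"
    by (rule bexp_prod_indep[OF finJ _ disj]) (simp add: B_def)
  also have "\<dots> = (\<Prod>j\<in>J. 1 - ?q)"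
  proof (rule prod.cong)
    fix j
    have "bprob (\<lambda>_. p) (B j) (\<lambda>\<omega>. k \<le> card (cluster \<omega> (c j))) = ?q"
      by (rule bprob_eq_reach) (simp_all add: B_def)
    then show "bexp (\<lambda>_. p) (B j) (?g j) = 1 - ?q"
      by (subst bprob_compl) (simp_all add: B_def)
  qed simp
  also have "\<dots> = (1 - ?q) ^ N ^ CARD('d)" by (simp add: cardJ)
  also have "\<dots> \<le> exp (- ?q) ^ N ^ CARD('d)"
    using reach_bounds[OF assms, of k "UNIV :: (int ^ 'd) set"] exp_ge_add_one_self[of "- ?q"]
    by (intro power_mono) auto
  also have "\<dots> = exp (- (?q * real N ^ CARD('d)))"
    by (simp add: exp_of_nat_mult[symmetric] mult.commute)
  finally show ?thesis by (simp add: N_def)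
qed

text \<open>If \<open>\<omega> - K\<close> has a cluster of size \<open>k\<close> and \<open>\<omega>\<close> has no cluster of size \<open>k\<close> meeting \<open>K\<close>, then
  the largest cluster does not see \<open>K\<close>, where alone the two hypotheses differ.\<close>

lemma error_sum_ge:
  fixes G K :: "(int ^ 'd::finite) set" and p0 p1 :: real
  assumes "finite G" "K \<subseteq> G" "0 \<le> p0" "p0 \<le> p1" "p1 \<le> 1"
  shows "1 - bprob (\<lambda>_. p0) (G - K) (\<lambda>\<omega>. largest_cluster \<omega> < k)
      - card K * reach p1 k (UNIV :: (int ^ 'd) set)
    \<le> bprob (\<lambda>_. p0) G (\<lambda>\<omega>. c < real (largest_cluster \<omega>))
      + bprob (\<lambda>v. if v \<in> K then p1 else p0) G (\<lambda>\<omega>. \<not> c < real (largest_cluster \<omega>))"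
proof -
  let ?pK = "\<lambda>v. if v \<in> K then p1 else p0"
  let ?L = "\<lambda>\<omega>. largest_cluster (\<omega> - K)"
  have finGK: "finite (G - K)" and finK: "finite K" using assms finite_subset by auto
  \<comment> \<open>The two hypotheses give the same law to the configuration off K.\<close>
  have away: "bexp p G (\<lambda>\<omega>. f (\<omega> - K)) = bexp (\<lambda>_. p0) (G - K) f"
    if "\<And>v. v \<in> G - K \<Longrightarrow> p v = p0" for p and f :: "(int ^ 'd) set \<Rightarrow> real"
  proof -
    have "bexp p G (\<lambda>\<omega>. f (\<omega> - K)) = bexp p (G - K) (\<lambda>\<omega>. f (\<omega> - K))"
    proof (rule bexp_restrict[OF assms(1)])
      fix \<omega> assume "\<omega> \<subseteq> G"
      then have "\<omega> \<inter> (G - K) - K = \<omega> - K" by auto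
      then show "f (\<omega> - K) = f (\<omega> \<inter> (G - K) - K)" by simp
    qed auto
    also have "\<dots> = bexp p (G - K) f"
    proof (rule bexp_cong)
      fix \<omega> assume "\<omega> \<subseteq> G - K"
      then have "\<omega> - K = \<omega>" by auto
      then show "f (\<omega> - K) = f \<omega>" by simp
    qed
    also have "\<dots> = bexp (\<lambda>_. p0) (G - K) f" using that by (rule bexp_cong_p)
    finally show ?thesis .
  qed
  have "bprob (\<lambda>_. p0) (G - K) (\<lambda>\<omega>. c < real (largest_cluster \<omega>))
      = bprob (\<lambda>_. p0) G (\<lambda>\<omega>. c < real (?L \<omega>))"
    by (rule away[symmetric]) simp
  also have "\<dots> \<le> bprob (\<lambda>_. p0) G (\<lambda>\<omega>. c < real (largest_cluster \<omega>))"
  proof (intro bexp_mono of_bool_mono)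
    fix \<omega> assume "\<omega> \<subseteq> G" "c < real (?L \<omega>)"
    then show "c < real (largest_cluster \<omega>)"
      using largest_cluster_mono[of \<omega> "\<omega> - K"] finite_subset[OF _ assms(1)] by fastforce
  qed (use assms in auto)
  finally have null: "bprob (\<lambda>_. p0) (G - K) (\<lambda>\<omega>. c < real (largest_cluster \<omega>))
      \<le> bprob (\<lambda>_. p0) G (\<lambda>\<omega>. c < real (largest_cluster \<omega>))" .
  have "bprob (\<lambda>_. p0) (G - K) (\<lambda>\<omega>. \<not> c < real (largest_cluster \<omega>))
      = bprob ?pK G (\<lambda>\<omega>. \<not> c < real (?L \<omega>))"
    by (rule away[symmetric]) simp
  also have "\<dots> \<le> bexp ?pK G (\<lambda>\<omega>. of_bool (\<not> c < real (largest_cluster \<omega>)) + (of_bool (?L \<omega> < k)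
      + (\<Sum>v\<in>K. of_bool (k \<le> card (cluster \<omega> v)))))"
  proof (rule bexp_mono)
    fix \<omega> assume w: "\<omega> \<subseteq> G"
    show "of_bool (\<not> c < real (?L \<omega>)) \<le> (of_bool (\<not> c < real (largest_cluster \<omega>)) + (of_bool (?L \<omega> < k)
      + (\<Sum>v\<in>K. of_bool (k \<le> card (cluster \<omega> v)))) :: real)"
    proof (cases "?L \<omega> < k \<or> (\<exists>v\<in>K. k \<le> card (cluster \<omega> v))")
      case False
      then have "largest_cluster \<omega> \<le> ?L \<omega>"
        using finite_subset[OF w assms(1)] by (intro largest_cluster_remove[where k = k]) auto
      then have "of_bool (\<not> c < real (?L \<omega>)) \<le> (of_bool (\<not> c < real (largest_cluster \<omega>)) :: real)"
        by (intro of_bool_mono) linarith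
      then show ?thesis by (simp add: sum_nonneg add_increasing2)
    next
      case True
      have "1 \<le> (\<Sum>v\<in>K. of_bool (k \<le> card (cluster \<omega> v)) :: real)"
        if v: "v \<in> K" "k \<le> card (cluster \<omega> v)" for v
      proof -
        have "of_bool (k \<le> card (cluster \<omega> v)) \<le> (\<Sum>v\<in>K. of_bool (k \<le> card (cluster \<omega> v)) :: real)"
          using v(1) finK by (intro member_le_sum) auto
        then show ?thesis using v(2) by simp
      qed
      moreover have "0 \<le> (\<Sum>v\<in>K. of_bool (k \<le> card (cluster \<omega> v)) :: real)" by (simp add: sum_nonneg)
      ultimately have "1 \<le> (of_bool (?L \<omega> < k) + (\<Sum>v\<in>K. of_bool (k \<le> card (cluster \<omega> v))) :: real)"
        using True by auto
      moreover have "of_bool P \<le> (1::real)" "0 \<le> (of_bool P :: real)" for P by auto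
      ultimately show ?thesis by (meson add_increasing order_trans)
    qed
  qed (use assms in auto)
  also have "\<dots> = bprob ?pK G (\<lambda>\<omega>. \<not> c < real (largest_cluster \<omega>))
      + (bprob ?pK G (\<lambda>\<omega>. ?L \<omega> < k) + (\<Sum>v\<in>K. bprob ?pK G (\<lambda>\<omega>. k \<le> card (cluster \<omega> v))))"
    by (simp only: bexp_add bexp_sum)
  also have "bprob ?pK G (\<lambda>\<omega>. ?L \<omega> < k) = bprob (\<lambda>_. p0) (G - K) (\<lambda>\<omega>. largest_cluster \<omega> < k)"
    by (rule away) simp
  finally have alt: "bprob (\<lambda>_. p0) (G - K) (\<lambda>\<omega>. \<not> c < real (largest_cluster \<omega>))
    \<le> bprob ?pK G (\<lambda>\<omega>. \<not> c < real (largest_cluster \<omega>))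
      + (bprob (\<lambda>_. p0) (G - K) (\<lambda>\<omega>. largest_cluster \<omega> < k)
        + (\<Sum>v\<in>K. bprob ?pK G (\<lambda>\<omega>. k \<le> card (cluster \<omega> v))))" .
  have "(\<Sum>v\<in>K. bprob ?pK G (\<lambda>\<omega>. k \<le> card (cluster \<omega> v))) \<le> (\<Sum>v\<in>K. reach p1 k (UNIV :: (int ^ 'd) set))"
  proof (rule sum_mono)
    fix v
    have "bprob ?pK G (\<lambda>\<omega>. k \<le> card (cluster \<omega> v)) \<le> bprob (\<lambda>_. p1) G (\<lambda>\<omega>. k \<le> card (cluster \<omega> v))"
    proof (rule bexp_mono_p[OF assms(1)])
      fix a b assume "a \<subseteq> b" "b \<subseteq> G"
      then show "of_bool (k \<le> card (cluster a v)) \<le> (of_bool (k \<le> card (cluster b v)) :: real)"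
        using card_cluster_mono[of b a v] finite_subset[OF _ assms(1)]
        by (intro of_bool_mono) fastforce
    qed (use assms in auto)
    also have "\<dots> \<le> reach p1 k (UNIV :: (int ^ 'd) set)" using assms by (intro bprob_le_reach) auto
    finally show "bprob ?pK G (\<lambda>\<omega>. k \<le> card (cluster \<omega> v)) \<le> reach p1 k (UNIV :: (int ^ 'd) set)" .
  qed
  \<comment> \<open>For the configuration off K the two errors add up to exactly one, whatever c
    is.\<close>
  then show ?thesis
    using null alt bprob_compl[OF finGK, of "\<lambda>_. p0" "\<lambda>\<omega>. c < real (largest_cluster \<omega>)"] by simp
qed

subsection \<open>The exponential family\<close>

lemma integral_pos_on:
  fixes g :: "'a \<Rightarrow> real"
  assumes "integrable M (\<lambda>x. g x * indicator A x)" "\<And>x. x \<in> A \<Longrightarrow> 0 < g x"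
    and "A \<in> sets M" "measure M A \<noteq> 0"
  shows "0 < (LINT x|M. g x * indicator A x)"
proof -
  have nn: "0 \<le> g x * indicator A x" for x using assms(2)[of x] by (auto split: split_indicator)
  have "(LINT x|M. g x * indicator A x) \<noteq> 0"
  proof
    assume "(LINT x|M. g x * indicator A x) = 0"
    then have "AE x in M. g x * indicator A x = 0"
      using assms(1) nn by (subst (asm) integral_nonneg_eq_0_iff_AE) auto
    then have "AE x in M. x \<notin> A"
      by eventually_elim (use assms(2) in \<open>force split: split_indicator_asm\<close>)
    then have "emeasure M A = 0" using AE_iff_null_sets[OF assms(3)] by auto
    then show False using assms(4) by (simp add: measure_def)
  qed
  then show ?thesis using integral_nonneg_AE[of "\<lambda>x. g x * indicator A x" M] nn by fastforce
qed

context
  fixes F :: "real measure"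
  assumes F: "real_distribution F"
begin

interpretation real_distribution F by (rule F)

lemma integrable_exp_indicator:
  assumes "integrable F (\<lambda>x. exp (x * s))" "A \<in> sets borel"
  shows "integrable F (\<lambda>x. exp (x * s) * indicator A x)"
  using assms by (intro integrable_real_mult_indicator) auto

lemma mgf_pos:
  assumes "integrable F (\<lambda>x. exp (x * s))"
  shows "0 < mgf F s"
proof -
  have "measure F UNIV \<noteq> 0" using prob_space by simp
  then have "0 < (LINT x|F. exp (x * s) * indicator UNIV x)"
    using integrable_exp_indicator[OF assms, of UNIV] by (intro integral_pos_on) auto
  then show ?thesis by (simp add: mgf_def)
qed

lemma emeasure_tilted:
  assumes "integrable F (\<lambda>x. exp (x * s))" "A \<in> sets borel"
  shows "emeasure (tilted F s) A = ennreal ((LINT x|F. exp (x * s) * indicator A x) / mgf F s)"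
proof -
  have eq: "exp (s * x - ln (mgf F s)) = exp (x * s) / mgf F s" for x
    using mgf_pos[OF assms(1)] by (simp add: exp_diff mult.commute)
  have "emeasure (tilted F s) A = (\<integral>\<^sup>+ x. ennreal (exp (x * s) / mgf F s) * indicator A x \<partial>F)"
    unfolding tilted_def eq using assms(2) by (intro emeasure_density) auto
  also have "\<dots> = (\<integral>\<^sup>+ x. ennreal (exp (x * s) * indicator A x / mgf F s) \<partial>F)"
    by (intro nn_integral_cong) (auto split: split_indicator)
  also have "\<dots> = ennreal (LINT x|F. exp (x * s) * indicator A x / mgf F s)"
    using integrable_exp_indicator[OF assms] mgf_pos[OF assms(1)]
    by (intro nn_integral_eq_integral) (auto split: split_indicator)
  finally show ?thesis by simp
qed

lemma prob_space_tilted: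
  assumes "integrable F (\<lambda>x. exp (x * s))"
  shows "prob_space (tilted F s)"
proof
  show "emeasure (tilted F s) (space (tilted F s)) = 1"
    using emeasure_tilted[OF assms, of UNIV] mgf_pos[OF assms] by (simp add: tilted_def mgf_def)
qed

lemma exceed_prob_eq:
  assumes "integrable F (\<lambda>x. exp (x * s))"
  shows "exceed_prob F s t = (LINT x|F. exp (x * s) * indicator {t<..} x) / mgf F s"
proof -
  have "{x. x > t} = {t<..}" by auto
  then show ?thesis
    using emeasure_tilted[OF assms, of "{t<..}"] mgf_pos[OF assms]
    by (simp add: exceed_prob_def measure_def)
qed

lemma exceed_prob_0: "exceed_prob F 0 t = measure F {t<..}"
  using exceed_prob_eq[of 0 t] prob_space by (simp add: mgf_def)

lemma mgf_split:
  assumes "integrable F (\<lambda>x. exp (x * s))"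
  shows "mgf F s = (LINT x|F. exp (x * s) * indicator {t<..} x) + (LINT x|F. exp (x * s) * indicator {..t} x)"
proof -
  have "mgf F s = (LINT x|F. exp (x * s) * indicator {t<..} x + exp (x * s) * indicator {..t} x)"
    unfolding mgf_def by (intro Bochner_Integration.integral_cong) (auto split: split_indicator)
  then show ?thesis
    using integrable_exp_indicator[OF assms] by (simp add: Bochner_Integration.integral_add)
qed

text \<open>Raising the parameter by \<open>r\<close> multiplies the integral over \<open>{t<..}\<close> by more than
  \<open>exp (r * t)\<close> and the integral over \<open>{..t}\<close> by at most that.\<close>

lemma exceed_prob_strict_mono:
  assumes "integrable F (\<lambda>x. exp (x * s))" "integrable F (\<lambda>x. exp (x * s'))" "s < s'"
    and "0 < exceed_prob F 0 t" "exceed_prob F 0 t < 1"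
  shows "0 < exceed_prob F s t" "exceed_prob F s t < exceed_prob F s' t" "exceed_prob F s' t < 1"
proof -
  let ?U = "\<lambda>s. LINT x|F. exp (x * s) * indicator {t<..} x"
  let ?V = "\<lambda>s. LINT x|F. exp (x * s) * indicator {..t} x"
  define r where "r = exp ((s' - s) * t)"
  have mU: "measure F {t<..} \<noteq> 0" using assms(4) exceed_prob_0 by simp
  have "measure F (space F - {t<..}) = 1 - measure F {t<..}" by (rule prob_compl) simp
  moreover have "space F - {t<..} = {..t}" by auto
  ultimately have mV: "measure F {..t} \<noteq> 0" using assms(5) exceed_prob_0[of t] by simp
  have U: "0 < ?U q" and V: "0 < ?V q" if "integrable F (\<lambda>x. exp (x * q))" for q
    using integrable_exp_indicator[OF that] mU mV by (auto intro!: integral_pos_on)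
  have eq: "exceed_prob F q t = ?U q / (?U q + ?V q)" if "integrable F (\<lambda>x. exp (x * q))" for q
    using exceed_prob_eq[OF that] mgf_split[OF that] by simp
  have shift: "exp (x * s') - r * exp (x * s) = exp (x * s) * (exp ((s' - s) * x) - r)" for x
    by (simp add: algebra_simps exp_add[symmetric] exp_diff[symmetric])
  have pos: "0 < exp (x * s') - r * exp (x * s)" if "t < x" for x
    unfolding shift unfolding r_def using that assms(3) by (intro mult_pos_pos) auto
  have neg: "exp (x * s') - r * exp (x * s) \<le> 0" if "x \<le> t" for x
    unfolding shift unfolding r_def using that assms(3) by (intro mult_nonneg_nonpos) auto
  \<comment> \<open>Comparing U / (U + V) at two parameters amounts to comparing the odds U /
    V.\<close>
  have frac_cross: "a / (a + b) < c / (c + d)" if "a * d < c * b" "0 < a" "0 < b" "0 < c" "0 < d"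
    for a b c d :: real
  proof -
    have "a * (c + d) < c * (a + b)" using that(1) by (simp add: algebra_simps)
    then show ?thesis using that by (simp add: pos_divide_less_eq pos_less_divide_eq)
  qed
  have int: "integrable F (\<lambda>x. (exp (x * s') - r * exp (x * s)) * indicator A x)"
    and lin: "(LINT x|F. (exp (x * s') - r * exp (x * s)) * indicator A x)
      = (LINT x|F. exp (x * s') * indicator A x) - r * (LINT x|F. exp (x * s) * indicator A x)"
    if "A \<in> sets borel" for A
    using integrable_exp_indicator[OF assms(1) that] integrable_exp_indicator[OF assms(2) that]
    by (simp_all add: left_diff_distrib mult.assoc)
  have "0 < (LINT x|F. (exp (x * s') - r * exp (x * s)) * indicator {t<..} x)"
    using int mU assms(3) by (intro integral_pos_on pos) auto
  then have UU: "r * ?U s < ?U s'" using lin[of "{t<..}"] by simp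
  have "(LINT x|F. (exp (x * s') - r * exp (x * s)) * indicator {..t} x) \<le> (LINT x|F. 0)"
    using int[of "{..t}"]
    by (intro integral_mono) (auto dest: neg split: split_indicator)
  then have VV: "?V s' \<le> r * ?V s" using lin[of "{..t}"] by simp
  show "0 < exceed_prob F s t" using eq[OF assms(1)] U[OF assms(1)] V[OF assms(1)] by simp
  show "exceed_prob F s' t < 1" using eq[OF assms(2)] U[OF assms(2)] V[OF assms(2)] by simp
  have "?U s * ?V s' \<le> ?U s * (r * ?V s)" using VV U[OF assms(1)] by (intro mult_left_mono) auto
  also have "\<dots> = (r * ?U s) * ?V s" by simp
  also have "\<dots> < ?U s' * ?V s" using UU V[OF assms(1)] by (intro mult_strict_right_mono) auto
  finally have "?U s * ?V s' < ?U s' * ?V s" .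
  then show "exceed_prob F s t < exceed_prob F s' t"
    unfolding eq[OF assms(1)] eq[OF assms(2)]
    using U[OF assms(1)] V[OF assms(1)] U[OF assms(2)] V[OF assms(2)]
    by (intro frac_cross) auto
qed

end

subsection \<open>Asymptotics of the error probabilities\<close>

text \<open>At m = 0 this rests on the convention \<open>ln 0 = 0\<close>. It lets the bounds on the
  logarithmic thresholds hold for every m.\<close>

lemma ln_real_nonneg: "0 \<le> ln (real m)"
  by (cases m) auto

lemma filterlim_of_ln_le:
  fixes k :: "nat \<Rightarrow> nat"
  assumes "0 < \<kappa>" "\<And>m. \<kappa> * ln (real m) \<le> real (k m)"
  shows "filterlim k sequentially sequentially"
proof -
  have "filterlim (\<lambda>m. \<kappa> * ln (real m)) at_top sequentially" using assms(1) by real_asymp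
  then have "filterlim (\<lambda>m. real (k m)) at_top sequentially"
    by (rule filterlim_at_top_mono) (use assms(2) in auto)
  then show ?thesis by (simp add: filterlim_sequentially_iff_filterlim_real)
qed

text \<open>At the level \<kappa> ln m, exponential decay with rate b becomes the power
  \<open>m powr (- b * \<kappa>)\<close>. The factor \<open>m powr \<gamma>\<close> stands for the
  number of sites in a union bound.\<close>

lemma powr_times_tendsto_0:
  fixes k :: "nat \<Rightarrow> nat" and q :: "nat \<Rightarrow> real"
  assumes "eventually (\<lambda>k. q k \<le> exp (- b * real k)) sequentially" "\<And>k. 0 \<le> q k"
    and "0 < b" "0 < \<kappa>" "\<And>m. \<kappa> * ln (real m) \<le> real (k m)" "\<gamma> < b * \<kappa>"
  shows "(\<lambda>m. real m powr \<gamma> * q (k m)) \<longlonglongrightarrow> 0"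
proof (rule tendsto_sandwich[OF _ _ tendsto_const])
  show "(\<lambda>m. real m powr (\<gamma> - b * \<kappa>)) \<longlonglongrightarrow> 0"
    using assms(6) by (intro tendsto_neg_powr filterlim_real_sequentially) auto
  have "eventually (\<lambda>m. q (k m) \<le> exp (- b * real (k m))) sequentially"
    using filterlim_of_ln_le[OF assms(4,5)] assms(1) by (rule eventually_compose_filterlim[rotated])
  then show "eventually (\<lambda>m. real m powr \<gamma> * q (k m) \<le> real m powr (\<gamma> - b * \<kappa>)) sequentially"
    using eventually_ge_at_top[of 1]
  proof eventually_elim
    case (elim m)
    have "b * (\<kappa> * ln (real m)) \<le> b * real (k m)" using assms(3,5) by (intro mult_left_mono) auto
    then have "q (k m) \<le> exp (- (b * \<kappa>) * ln (real m))"
      using elim(1) by (elim order_trans) (simp add: mult.assoc)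
    also have "\<dots> = real m powr (- (b * \<kappa>))" using elim(2) by (simp add: powr_def)
    finally have "real m powr \<gamma> * q (k m) \<le> real m powr \<gamma> * real m powr (- (b * \<kappa>))"
      by (intro mult_left_mono) auto
    then show ?case by (simp add: powr_add[symmetric])
  qed
qed (use assms(2) in auto)

text \<open>The exponent is the expected number of successful balls: about
  \<open>m powr (\<gamma> * D)\<close> of them up to logarithms, each succeeding with probability at
  least of order \<open>m powr (- b * \<kappa>)\<close>. The form of the last hypothesis covers both
  a rounded power of m and half of m.\<close>

lemma exp_packing_tendsto_0:
  fixes k l :: "nat \<Rightarrow> nat" and q :: "nat \<Rightarrow> real"
  assumes "eventually (\<lambda>k. exp (- b * real k) \<le> q k) sequentially" "0 < b" "0 < \<kappa>"
    and "\<And>m. \<kappa> * ln (real m) \<le> real (k m)" "\<And>m. real (k m) \<le> \<kappa> * ln (real m) + 1"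
    and "0 < D" "b * \<kappa> < \<gamma> * real D" "0 < c"
    and "eventually (\<lambda>m. c * real m powr \<gamma> - 1 \<le> real (l m)) sequentially"
  shows "(\<lambda>m. exp (- (q (k m) * real (l m div (2 * k m + 1)) ^ D))) \<longlonglongrightarrow> 0"
proof -
  define \<delta> where "\<delta> = b * \<kappa> / real D"
  have \<delta>: "0 < \<delta>" "\<delta> < \<gamma>" using assms by (auto simp: \<delta>_def field_simps)
  \<comment> \<open>Up to a constant, f is the D-th root of a lower bound for that expected number;
    \<delta> distributes the cost \<open>b * \<kappa>\<close> over the D dimensions. Once f is at
    least 1 it is below its own D-th power, so divergence of f is enough.\<close>
  define f where "f m = real m powr (- \<delta>) * ((c * real m powr \<gamma> - 1) / (2 * \<kappa> * ln (real m) + 3) - 1)"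
    for m :: nat
  have f: "filterlim f at_top sequentially"
    unfolding f_def using \<delta> assms(3,8) by real_asymp
  then have "filterlim (\<lambda>m. exp (- b) * f m) at_top sequentially"
    by (intro filterlim_tendsto_pos_mult_at_top[OF tendsto_const]) auto
  then have lim: "(\<lambda>m. exp (- (exp (- b) * f m))) \<longlonglongrightarrow> 0"
    by (intro filterlim_compose[OF exp_at_bot]) (simp add: filterlim_uminus_at_top)
  have "eventually (\<lambda>m. exp (- b) * f m \<le> q (k m) * real (l m div (2 * k m + 1)) ^ D) sequentially"
  proof -
    have "eventually (\<lambda>m. exp (- b * real (k m)) \<le> q (k m)) sequentially"
      using filterlim_of_ln_le[OF assms(3,4)] assms(1) by (rule eventually_compose_filterlim[rotated])
    moreover have "eventually (\<lambda>m. 1 \<le> f m) sequentially"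
      using f by (simp add: filterlim_at_top)
    moreover have "filterlim (\<lambda>m. c * real m powr \<gamma>) at_top sequentially"
      using assms(8) \<delta> by real_asymp
    then have "eventually (\<lambda>m. 1 \<le> c * real m powr \<gamma>) sequentially"
      by (simp add: filterlim_at_top)
    ultimately show ?thesis
      using assms(9) eventually_ge_at_top[of 1]
    proof eventually_elim
      case (elim m)
      let ?N = "real (l m div (2 * k m + 1))"
      have "(c * real m powr \<gamma> - 1) / (2 * \<kappa> * ln (real m) + 3) \<le> real (l m) / real (2 * k m + 1)"
        using elim(3,4) assms(5)[of m] by (intro frac_le) auto
      also have "\<dots> \<le> ?N + 1" using floor_divide_of_nat_eq[of "l m" "2 * k m + 1", where 'a = real] by linarith
      finally have "f m \<le> real m powr (- \<delta>) * ?N"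
        unfolding f_def by (intro mult_left_mono) auto
      then have "f m ^ D \<le> (real m powr (- \<delta>) * ?N) ^ D" using elim(2) by (intro power_mono) auto
      also have "\<dots> = real m powr (- (b * \<kappa>)) * ?N ^ D"
      proof -
        have "(real m powr (- \<delta>)) ^ D = real m powr (real D * (- \<delta>))"
          using assms(6) elim(5) by (intro powr_power) auto
        also have "real D * (- \<delta>) = - (b * \<kappa>)" using assms(6) by (simp add: \<delta>_def)
        finally show ?thesis by (simp only: power_mult_distrib)
      qed
      finally have "f m ^ D \<le> real m powr (- (b * \<kappa>)) * ?N ^ D" .
      moreover have "f m \<le> f m ^ D" using elim(2) assms(6) by (intro self_le_power) auto
      ultimately have "exp (- b) * f m \<le> exp (- b) * (real m powr (- (b * \<kappa>)) * ?N ^ D)"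
        by (intro mult_left_mono) auto
      also have "\<dots> = exp (- b * (\<kappa> * ln (real m) + 1)) * ?N ^ D"
        using elim(5) by (simp add: powr_def exp_add[symmetric] algebra_simps flip: mult.assoc)
      also have "\<dots> \<le> exp (- b * real (k m)) * ?N ^ D"
        using mult_left_mono[OF assms(5)[of m], of b] assms(2) by (intro mult_right_mono) auto
      also have "\<dots> \<le> q (k m) * ?N ^ D" using elim(1) by (intro mult_right_mono) auto
      finally show ?case .
    qed
  qed
  then have le: "eventually (\<lambda>m. exp (- (q (k m) * real (l m div (2 * k m + 1)) ^ D)) \<le> exp (- (exp (- b) * f m))) sequentially"
    by eventually_elim simp
  show ?thesis
    by (rule tendsto_sandwich[OF always_eventually le tendsto_const lim]) simp
qed

text \<open>With floor plus one, \<open>k m\<close> is the least natural number strictly above the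
  critical value, so the strict rejection rule becomes the event of a cluster with at least
  \<open>k m \<ge> 1\<close> sites.\<close>

lemma log_threshold:
  assumes "0 < \<kappa>"
  defines "k \<equiv> \<lambda>m. nat \<lfloor>\<kappa> * ln (real m)\<rfloor> + 1"
  shows "\<kappa> * ln (real m) \<le> real (k m)" "real (k m) \<le> \<kappa> * ln (real m) + 1"
    and "\<kappa> * ln (real m) < real n \<longleftrightarrow> k m \<le> n"
proof -
  let ?x = "\<kappa> * ln (real m)"
  have x: "0 \<le> ?x" using assms ln_real_nonneg by simp
  then have k: "real (k m) = real_of_int \<lfloor>?x\<rfloor> + 1" by (simp add: k_def)
  show "?x \<le> real (k m)" "real (k m) \<le> ?x + 1" unfolding k by linarith+
  have "?x < real n \<longleftrightarrow> \<lfloor>?x\<rfloor> < int n" by (simp add: floor_less_iff)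
  also have "\<dots> \<longleftrightarrow> k m \<le> n" using x by (simp add: k_def nat_less_iff Suc_le_eq)
  finally show "?x < real n \<longleftrightarrow> k m \<le> n" .
qed

subsection \<open>Hypercubes in the grid\<close>

lemma cube_mono:
  assumes "l \<le> m"
  shows "cube a l \<subseteq> cube a m"
  unfolding cube_def
proof (intro Collect_mono impI allI)
  fix v i assume "\<forall>i. v $ i \<in> {a $ i..<a $ i + int l}"
  then have "v $ i \<in> {a $ i..<a $ i + int l}" by blast
  then show "v $ i \<in> {a $ i..<a $ i + int m}" using assms by auto
qed

lemma grid_eq_cube: "grid m = cube (\<chi> i. 1) m"
proof -
  have "x < 1 + int m \<longleftrightarrow> x \<le> int m" for x by linarith
  then show ?thesis by (simp add: grid_def cube_def)
qed

lemma finite_grid [simp]: "finite (grid m)"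
  by (simp add: grid_eq_cube)

lemma card_grid: "card (grid m :: (int ^ 'd::finite) set) = m ^ CARD('d)"
  by (simp add: grid_eq_cube card_cube)

lemma floor_powr_bounds:
  assumes "1 \<le> m"
  shows "real (nat \<lfloor>real m powr \<alpha>\<rfloor>) \<le> real m powr \<alpha>" "real m powr \<alpha> - 1 \<le> real (nat \<lfloor>real m powr \<alpha>\<rfloor>)"
proof -
  have "0 \<le> \<lfloor>real m powr \<alpha>\<rfloor>" by simp
  then have "real (nat \<lfloor>real m powr \<alpha>\<rfloor>) = real_of_int \<lfloor>real m powr \<alpha>\<rfloor>" by simp
  then show "real (nat \<lfloor>real m powr \<alpha>\<rfloor>) \<le> real m powr \<alpha>" "real m powr \<alpha> - 1 \<le> real (nat \<lfloor>real m powr \<alpha>\<rfloor>)"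
    by linarith+
qed

lemma hypercubes_eq:
  "hypercubes \<alpha> m = {K. K \<subseteq> grid m \<and> (\<exists>a. K = cube a (nat \<lfloor>real m powr \<alpha>\<rfloor>))}"
  by (simp add: hypercubes_def cube_def)

lemma finite_hypercubes: "finite (hypercubes \<alpha> m)"
  by (rule finite_subset[of _ "Pow (grid m)"]) (auto simp: hypercubes_eq)

text \<open>Shows that the maximum in the risk is over a nonempty class, and supplies the single
  hypercube that suffices for lower bounds.\<close>

lemma corner_in_hypercubes:
  assumes "1 \<le> m" "\<alpha> \<le> 1"
  shows "cube (\<chi> i. 1) (nat \<lfloor>real m powr \<alpha>\<rfloor>) \<in> hypercubes \<alpha> m"
proof -
  have le: "real m powr \<alpha> \<le> real m powr 1" using assms by (intro powr_mono) auto
  have "real (nat \<lfloor>real m powr \<alpha>\<rfloor>) \<le> real m"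
    using order_trans[OF floor_powr_bounds(1)[OF assms(1), of \<alpha>] le] by simp
  then have "nat \<lfloor>real m powr \<alpha>\<rfloor> \<le> m" by (simp only: of_nat_le_iff)
  then have "cube (\<chi> i. 1) (nat \<lfloor>real m powr \<alpha>\<rfloor>) \<subseteq> grid m"
    unfolding grid_eq_cube by (intro cube_mono) simp
  then show ?thesis by (auto simp: hypercubes_eq)
qed

text \<open>\<open>cluster_risk D \<alpha> m p0 p1 c\<close> is the risk of the test that rejects if the largest open cluster
  exceeds \<open>c\<close>, in terms of the opening probabilities \<open>p0\<close> off the hypercube and \<open>p1\<close> on it.\<close>

definition cluster_risk :: "'d::finite itself \<Rightarrow> real \<Rightarrow> nat \<Rightarrow> real \<Rightarrow> real \<Rightarrow> real \<Rightarrow> real" where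
  "cluster_risk D \<alpha> m p0 p1 c =
     bprob (\<lambda>_. p0) (grid m :: (int ^ 'd) set) (\<lambda>\<omega>. c < real (largest_cluster \<omega>)) +
     (MAX K\<in>(hypercubes \<alpha> m :: (int ^ 'd) set set).
       bprob (\<lambda>v. if v \<in> K then p1 else p0) (grid m) (\<lambda>\<omega>. \<not> c < real (largest_cluster \<omega>)))"

lemma cluster_risk_ge:
  fixes D :: "'d::finite itself"
  assumes "K \<in> (hypercubes \<alpha> m :: (int ^ 'd) set set)"
  shows "bprob (\<lambda>_. p0) (grid m :: (int ^ 'd) set) (\<lambda>\<omega>. c < real (largest_cluster \<omega>)) +
     bprob (\<lambda>v. if v \<in> K then p1 else p0) (grid m) (\<lambda>\<omega>. \<not> c < real (largest_cluster \<omega>))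
    \<le> cluster_risk D \<alpha> m p0 p1 c"
  unfolding cluster_risk_def using assms finite_hypercubes[of \<alpha> m]
  by (intro add_left_mono Max_ge) auto

lemma cluster_risk_le:
  fixes D :: "'d::finite itself"
  assumes "1 \<le> m" "\<alpha> \<le> 1"
    and "\<And>K. K \<in> (hypercubes \<alpha> m :: (int ^ 'd) set set) \<Longrightarrow>
      bprob (\<lambda>v. if v \<in> K then p1 else p0) (grid m) (\<lambda>\<omega>. \<not> c < real (largest_cluster \<omega>)) \<le> B"
  shows "cluster_risk D \<alpha> m p0 p1 c
    \<le> bprob (\<lambda>_. p0) (grid m :: (int ^ 'd) set) (\<lambda>\<omega>. c < real (largest_cluster \<omega>)) + B"
proof -
  have "hypercubes \<alpha> m \<noteq> ({} :: (int ^ 'd) set set)" using corner_in_hypercubes[OF assms(1,2)] by blast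
  then show ?thesis
    unfolding cluster_risk_def using assms(3) finite_hypercubes[of \<alpha> m]
    by (intro add_left_mono) (subst Max_le_iff, auto)
qed

lemma zeta_nonneg: "0 < p \<Longrightarrow> 0 \<le> zeta TYPE('d::finite) p"
  using zeta_pos[of p, where 'd = 'd] zeta_supercritical[of p, where 'd = 'd]
  by (cases "p < p_crit TYPE('d)") auto

text \<open>One level \<kappa> ln m lies above the typical largest cluster of the grid at density
  \<open>p0\<close> and below that of a hypercube at density \<open>p1\<close>. The densities
  \<open>pm m\<close> enter by monotonicity only, and \<open>p1\<close> may be
  supercritical.\<close>

lemma cluster_risk_tendsto_0:
  assumes "0 < \<alpha>" "\<alpha> < 1" "0 < p0" "p0 < p_crit TYPE('d::finite)" "0 < p1" "p1 < 1"
    and "zeta TYPE('d) p1 < \<alpha> * zeta TYPE('d) p0"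
    and "eventually (\<lambda>m. p1 \<le> pm m \<and> pm m \<le> 1) sequentially"
  shows "\<exists>c. (\<lambda>m. cluster_risk TYPE('d) \<alpha> m p0 (pm m) (c m)) \<longlonglongrightarrow> 0"
proof -
  let ?D = "CARD('d)"
  let ?z0 = "zeta TYPE('d) p0" and ?z1 = "zeta TYPE('d) p1"
  have p01: "p0 \<le> 1" using assms(4) p_crit_le_1[where 'd = 'd] by simp
  obtain b1 where b1: "?z1 < b1" "b1 < \<alpha> * ?z0" using dense[OF assms(7)] by blast
  have b1pos: "0 < b1" using zeta_nonneg[OF assms(5), where 'd = 'd] b1 by simp
  have "b1 / \<alpha> < ?z0" using b1 assms(1) by (simp add: field_simps)
  then obtain \<beta> where \<beta>: "b1 / \<alpha> < \<beta>" "\<beta> < ?z0" using dense by blast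
  have \<beta>pos: "0 < \<beta>" using \<beta>(1) b1pos assms(1) by (meson divide_pos_pos less_trans)
  obtain b0 where b0: "\<beta> < b0" "b0 < ?z0" using dense[OF \<beta>(2)] by blast
  \<comment> \<open>The union bound has exponent d - b0 \<kappa>, negative since b0 > \<beta>; the
    packing bound requires b1 \<kappa> < \<alpha> d, which is b1 / \<alpha> < \<beta>.\<close>
  define \<kappa> where "\<kappa> = real ?D / \<beta>"
  have \<kappa>: "0 < \<kappa>" using \<beta>pos by (simp add: \<kappa>_def)
  define k where "k m = nat \<lfloor>\<kappa> * ln (real m)\<rfloor> + 1" for m
  note k = log_threshold[OF \<kappa>, folded k_def]
  define l where "l m = nat \<lfloor>real m powr \<alpha>\<rfloor>" for m
  let ?e0 = "\<lambda>m. real m powr real ?D * reach p0 (k m) (UNIV :: (int ^ 'd) set)"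
  let ?e1 = "\<lambda>m. exp (- (reach p1 (k m) (UNIV :: (int ^ 'd) set) * real (l m div (2 * k m + 1)) ^ ?D))"
  have e0: "?e0 \<longlonglongrightarrow> 0"
  proof (rule powr_times_tendsto_0[OF reach_le_exp_zeta[OF assms(3,4) b0(2)] _ _ \<kappa> k(1)])
    show "real ?D < b0 * \<kappa>" using b0 \<beta>pos by (simp add: \<kappa>_def field_simps)
  qed (use assms p01 b0 \<beta>pos in \<open>auto intro!: reach_bounds\<close>)
  have e1: "?e1 \<longlonglongrightarrow> 0"
  proof (rule exp_packing_tendsto_0[OF reach_ge_exp_zeta[OF assms(5,6) b1(1)] b1pos \<kappa> k(1,2)])
    show "b1 * \<kappa> < \<alpha> * real ?D" using \<beta>(1) \<beta>pos assms(1) by (simp add: \<kappa>_def field_simps)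
    show "eventually (\<lambda>m. 1 * real m powr \<alpha> - 1 \<le> real (l m)) sequentially"
      using eventually_ge_at_top[of 1] by eventually_elim (use floor_powr_bounds in \<open>simp add: l_def\<close>)
  qed auto
  have "(\<lambda>m. cluster_risk TYPE('d) \<alpha> m p0 (pm m) (\<kappa> * ln (real m))) \<longlonglongrightarrow> 0"
  proof (rule tendsto_sandwich[OF _ _ tendsto_const])
    show "(\<lambda>m. ?e0 m + ?e1 m) \<longlonglongrightarrow> 0" using tendsto_add[OF e0 e1] by simp
    show "eventually (\<lambda>m. cluster_risk TYPE('d) \<alpha> m p0 (pm m) (\<kappa> * ln (real m)) \<le> ?e0 m + ?e1 m) sequentially"
      using assms(8) eventually_ge_at_top[of 1]
    proof eventually_elim
      case (elim m)
      have "bprob (\<lambda>_. p0) (grid m :: (int ^ 'd) set) (\<lambda>\<omega>. \<kappa> * ln (real m) < real (largest_cluster \<omega>))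
          \<le> real (card (grid m :: (int ^ 'd) set)) * reach p0 (k m) (UNIV :: (int ^ 'd) set)"
        unfolding k(3) using assms(3) p01 by (intro bprob_le_largest) (auto simp: k_def)
      also have "real (card (grid m :: (int ^ 'd) set)) = real m powr real ?D"
        using elim(2) by (simp add: card_grid powr_realpow)
      finally have null: "bprob (\<lambda>_. p0) (grid m :: (int ^ 'd) set) (\<lambda>\<omega>. \<kappa> * ln (real m) < real (largest_cluster \<omega>)) \<le> ?e0 m" .
      have alt: "bprob (\<lambda>v. if v \<in> K then pm m else p0) (grid m) (\<lambda>\<omega>. \<not> \<kappa> * ln (real m) < real (largest_cluster \<omega>)) \<le> ?e1 m"
        if K: "K \<in> hypercubes \<alpha> m" for K :: "(int ^ 'd) set"
      proof -
        obtain a where Kg: "K \<subseteq> grid m" and a: "K = cube a (l m)"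
          using K by (auto simp: hypercubes_eq l_def)
        let ?pK = "\<lambda>v. if v \<in> K then pm m else p0"
        have "bprob ?pK (grid m) (\<lambda>\<omega>. largest_cluster \<omega> < k m) \<le> bprob ?pK K (\<lambda>\<omega>. largest_cluster \<omega> < k m)"
          using Kg elim(1) assms(3,5) p01 by (intro bprob_largest_less_superset) auto
        also have "\<dots> = bprob (\<lambda>_. pm m) K (\<lambda>\<omega>. largest_cluster \<omega> < k m)"
          by (rule bexp_cong_p) simp
        also have "\<dots> \<le> bprob (\<lambda>_. p1) K (\<lambda>\<omega>. largest_cluster \<omega> < k m)"
          using elim(1) assms(5) by (intro bprob_largest_less_antimono) (auto simp: a)
        also have "\<dots> \<le> ?e1 m"
          unfolding a using assms(5,6) by (intro bprob_cube_largest_less) auto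
        finally show ?thesis unfolding k(3) by (simp add: not_le)
      qed
      show ?case
        using cluster_risk_le[of m \<alpha> "pm m" p0 "\<kappa> * ln (real m)" "?e1 m" "TYPE('d)"] alt null elim(2) assms(2)
        by auto
    qed
    show "eventually (\<lambda>m. 0 \<le> cluster_risk TYPE('d) \<alpha> m p0 (pm m) (\<kappa> * ln (real m))) sequentially"
      using assms(8) eventually_ge_at_top[of 1]
    proof eventually_elim
      case (elim m)
      have "cube (\<chi> i. 1) (nat \<lfloor>real m powr \<alpha>\<rfloor>) \<in> (hypercubes \<alpha> m :: (int ^ 'd) set set)"
        using elim(2) assms(2) by (intro corner_in_hypercubes) auto
      from cluster_risk_ge[OF this] show ?case
        by (rule order_trans[rotated]) (use elim(1) assms(3,5) p01 in \<open>auto intro!: add_nonneg_nonneg bexp_nonneg\<close>)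
    qed
  qed
  then show ?thesis by (rule exI[where x = "\<lambda>m. \<kappa> * ln (real m)"])
qed

text \<open>The order of the rates is reversed, b0 < \<beta> < b1 / \<alpha>: at the level \<kappa>
  ln m, with probability tending to one, there is a large cluster away from the hypercube and none
  that meets it.\<close>

lemma cluster_risk_liminf_ge_1:
  assumes "0 < \<alpha>" "\<alpha> < 1" "0 < p0" "p0 < p_crit TYPE('d::finite)" "p0 \<le> p1" "p1 < p_crit TYPE('d)"
    and "\<alpha> * zeta TYPE('d) p0 < zeta TYPE('d) p1"
    and "eventually (\<lambda>m. p0 \<le> pm m \<and> pm m \<le> p1) sequentially"
  shows "1 \<le> liminf (\<lambda>m. ereal (cluster_risk TYPE('d) \<alpha> m p0 (pm m) (c m)))"
proof -
  let ?D = "CARD('d)"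
  let ?z0 = "zeta TYPE('d) p0" and ?z1 = "zeta TYPE('d) p1"
  have le1: "p0 \<le> 1" "p0 < 1" "p1 \<le> 1" "0 < p1"
    using assms p_crit_le_1[where 'd = 'd] by auto
  have z0: "0 < ?z0" using assms by (intro zeta_pos)
  obtain b1 where b1: "\<alpha> * ?z0 < b1" "b1 < ?z1" using dense[OF assms(7)] by blast
  have b1pos: "0 < b1" using b1(1) mult_pos_pos[OF assms(1) z0] by simp
  have "?z0 < b1 / \<alpha>" using b1 assms(1) by (simp add: field_simps)
  then obtain \<beta> where \<beta>: "?z0 < \<beta>" "\<beta> < b1 / \<alpha>" using dense by blast
  have \<beta>pos: "0 < \<beta>" using \<beta>(1) z0 by simp
  obtain b0 where b0: "?z0 < b0" "b0 < \<beta>" using dense[OF \<beta>(1)] by blast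
  define \<kappa> where "\<kappa> = real ?D / \<beta>"
  have \<kappa>: "0 < \<kappa>" using \<beta>pos by (simp add: \<kappa>_def)
  define k where "k m = nat \<lfloor>\<kappa> * ln (real m)\<rfloor> + 1" for m
  note k = log_threshold[OF \<kappa>, folded k_def]
  define l where "l m = nat \<lfloor>real m powr \<alpha>\<rfloor>" for m
  let ?e0 = "\<lambda>m. exp (- (reach p0 (k m) (UNIV :: (int ^ 'd) set) * real (m div 2 div (2 * k m + 1)) ^ ?D))"
  let ?e1 = "\<lambda>m. real m powr (\<alpha> * real ?D) * reach p1 (k m) (UNIV :: (int ^ 'd) set)"
  have e0: "?e0 \<longlonglongrightarrow> 0"
  proof (rule exp_packing_tendsto_0[OF reach_ge_exp_zeta[OF assms(3) le1(2) b0(1)] _ \<kappa> k(1,2)])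
    show "b0 * \<kappa> < 1 * real ?D" using b0 \<beta>pos by (simp add: \<kappa>_def field_simps)
    show "eventually (\<lambda>m. 1 / 2 * real m powr 1 - 1 \<le> real (m div 2)) sequentially"
    proof (intro always_eventually allI)
      fix m :: nat
      have "m \<le> 2 * (m div 2) + 1" by simp
      then have "real m \<le> real (2 * (m div 2) + 1)" by (rule of_nat_mono)
      then show "1 / 2 * real m powr 1 - 1 \<le> real (m div 2)" by simp
    qed
  qed (use b0 z0 in auto)
  have e1: "?e1 \<longlonglongrightarrow> 0"
  proof (rule powr_times_tendsto_0[OF reach_le_exp_zeta[OF le1(4) assms(6) b1(2)] _ b1pos \<kappa> k(1)])
    show "\<alpha> * real ?D < b1 * \<kappa>" using \<beta>(2) \<beta>pos assms(1) by (simp add: \<kappa>_def field_simps)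
  qed (use le1 in \<open>auto intro!: reach_bounds\<close>)
  have "(\<lambda>m. 1 - ?e0 m - ?e1 m) \<longlonglongrightarrow> 1 - 0 - 0" by (intro tendsto_diff tendsto_const e0 e1)
  then have lim: "(\<lambda>m. ereal (1 - ?e0 m - ?e1 m)) \<longlonglongrightarrow> 1" by (simp add: one_ereal_def)
  have ev: "eventually (\<lambda>m. ereal (1 - ?e0 m - ?e1 m) \<le> ereal (cluster_risk TYPE('d) \<alpha> m p0 (pm m) (c m))) sequentially"
  proof -
    have "filterlim (\<lambda>m. real m / 2 - real m powr \<alpha>) at_top sequentially"
      using assms(1,2) by real_asymp
    then have "eventually (\<lambda>m. 0 \<le> real m / 2 - real m powr \<alpha>) sequentially"
      unfolding filterlim_at_top by (rule spec)
    then show ?thesis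
      using assms(8) eventually_ge_at_top[of 1]
    proof eventually_elim
      case (elim m)
      \<comment> \<open>The worst case is at least as bad as the hypercube K in one corner. The
        opposite corner then holds a cube U of side \<open>m div 2\<close>, disjoint from K once
        \<open>m powr \<alpha> \<le> m / 2\<close>; it is large enough for the packing bound with
        full exponent d.\<close>
      define K :: "(int ^ 'd) set" where "K = cube (\<chi> i. 1) (l m)"
      define U :: "(int ^ 'd) set" where "U = cube (\<chi> i. 1 + int (m - m div 2)) (m div 2)"
      have K: "K \<in> hypercubes \<alpha> m"
        unfolding K_def l_def using elim(3) assms(2) by (intro corner_in_hypercubes) auto
      then have Kg: "K \<subseteq> grid m" by (simp add: hypercubes_eq)
      have ll: "real (l m) \<le> real m powr \<alpha>" using floor_powr_bounds(1)[OF elim(3)] by (simp add: l_def)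
      then have lm: "l m \<le> m - m div 2" using elim(1) by linarith
      have U: "U \<subseteq> grid m - K"
      proof
        fix v assume v: "v \<in> U"
        then have vi: "1 + int (m - m div 2) \<le> v $ i" "v $ i < 1 + int (m - m div 2) + int (m div 2)" for i
          by (auto simp: U_def cube_def)
        have "int (m - m div 2) + int (m div 2) = int m" by (simp flip: of_nat_add)
        then have "1 \<le> v $ i \<and> v $ i \<le> int m" for i using vi[of i] by linarith
        then have "v \<in> grid m" by (simp add: grid_def)
        moreover have "v \<notin> K"
        proof
          assume "v \<in> K"
          then have "v $ undefined < 1 + int (l m)" by (simp add: K_def cube_def)
          then show False using vi(1)[of undefined] lm by linarith
        qed
        ultimately show "v \<in> grid m - K" by simp
      qed
      have "bprob (\<lambda>_. p0) (grid m - K) (\<lambda>\<omega>. largest_cluster \<omega> < k m)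
          \<le> bprob (\<lambda>_. p0) U (\<lambda>\<omega>. largest_cluster \<omega> < k m)"
        using U assms(3) le1 by (intro bprob_largest_less_superset) auto
      also have "\<dots> \<le> ?e0 m"
        unfolding U_def using assms(3) le1 by (intro bprob_cube_largest_less) auto
      finally have 0: "bprob (\<lambda>_. p0) (grid m - K) (\<lambda>\<omega>. largest_cluster \<omega> < k m) \<le> ?e0 m" .
      have "real (card K) = real (l m) ^ ?D" by (simp add: K_def card_cube)
      also have "\<dots> \<le> (real m powr \<alpha>) ^ ?D" using ll by (intro power_mono) auto
      also have "\<dots> = real m powr (\<alpha> * real ?D)"
        using elim(3) by (simp add: powr_power mult.commute)
      finally have "real (card K) * reach (pm m) (k m) (UNIV :: (int ^ 'd) set) \<le> ?e1 m"
        using elim(2) assms(3) le1 by (intro mult_mono reach_mono_p reach_bounds) auto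
      then have "1 - ?e0 m - ?e1 m \<le> 1 - bprob (\<lambda>_. p0) (grid m - K) (\<lambda>\<omega>. largest_cluster \<omega> < k m)
          - real (card K) * reach (pm m) (k m) (UNIV :: (int ^ 'd) set)"
        using 0 by simp
      also have "\<dots> \<le> bprob (\<lambda>_. p0) (grid m :: (int ^ 'd) set) (\<lambda>\<omega>. c m < real (largest_cluster \<omega>))
          + bprob (\<lambda>v. if v \<in> K then pm m else p0) (grid m) (\<lambda>\<omega>. \<not> c m < real (largest_cluster \<omega>))"
        using Kg elim(2) assms(3) le1 by (intro error_sum_ge) auto
      also have "\<dots> \<le> cluster_risk TYPE('d) \<alpha> m p0 (pm m) (c m)" by (rule cluster_risk_ge[OF K])
      finally show ?case by simp
    qed
  qed
  have "1 = liminf (\<lambda>m. ereal (1 - ?e0 m - ?e1 m))"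
    using lim by (intro lim_imp_Liminf[symmetric]) auto
  also have "\<dots> \<le> liminf (\<lambda>m. ereal (cluster_risk TYPE('d) \<alpha> m p0 (pm m) (c m)))"
    using ev by (rule Liminf_mono)
  finally show ?thesis .
qed

section \<open>From observations to percolation, and the detection threshold\<close>

lemma risk_eq_cluster_risk:
  fixes F :: "real measure"
  assumes F: "real_distribution F" and int: "integrable F (\<lambda>x. exp (x * \<theta>))"
  shows "risk F \<theta> m (hypercubes \<alpha> m) (\<lambda>x :: int ^ 'd::finite \<Rightarrow> real. largest_open_cluster t m x > c)
    = cluster_risk TYPE('d) \<alpha> m (exceed_prob F 0 t) (exceed_prob F \<theta> t) c"
proof -
  interpret real_distribution F by (rule F)
  have pF: "prob_space F" by (rule prob_space_axioms)
  note pT = prob_space_tilted[OF F int]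
  have open_sites: "{v \<in> grid m. x v > t} = {v \<in> grid m. x v \<in> {t<..}}" for x :: "int ^ 'd \<Rightarrow> real"
    by auto
  have "measure (null_law F m) {x \<in> space (null_law F m). c < real (largest_cluster {v \<in> (grid m :: (int ^ 'd) set). x v \<in> {t<..}})}
      = bprob (\<lambda>_. measure F {t<..}) (grid m :: (int ^ 'd) set) (\<lambda>\<omega>. c < real (largest_cluster \<omega>))"
    unfolding null_law_def
    by (rule measure_PiM_pattern[where Q = "\<lambda>\<omega>. c < real (largest_cluster \<omega>)"]) (use pF in auto)
  moreover have "measure (alt_law F \<theta> m K) {x \<in> space (alt_law F \<theta> m K). \<not> c < real (largest_cluster {v \<in> grid m. x v \<in> {t<..}})}
      = bprob (\<lambda>v. if v \<in> K then exceed_prob F \<theta> t else exceed_prob F 0 t) (grid m) (\<lambda>\<omega>. \<not> c < real (largest_cluster \<omega>))"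
    for K :: "(int ^ 'd) set"
  proof -
    have "{x. x > t} = {t<..}" by auto
    then have eq: "measure (if v \<in> K then tilted F \<theta> else F) {t<..}
        = (if v \<in> K then exceed_prob F \<theta> t else exceed_prob F 0 t)" for v
      by (simp add: exceed_prob_0[OF F] exceed_prob_def[of F \<theta>])
    show ?thesis
      unfolding alt_law_def eq[symmetric]
      by (rule measure_PiM_pattern[where Q = "\<lambda>\<omega>. \<not> c < real (largest_cluster \<omega>)"])
        (use pF pT in \<open>auto simp: tilted_def\<close>)
  qed
  ultimately show ?thesis
    unfolding risk_def cluster_risk_def largest_open_cluster_def open_sites
    by (simp add: exceed_prob_0[OF F])
qed

text \<open>The bound \<open>\<theta>_inf\<close> is an extended real so that it may be infinite. A
  solution \<open>\<theta>_star\<close> is given, and its uniqueness is the first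
  conclusion.\<close>

theorem theorem1:
  fixes F\<^sub>0 :: "real measure" and \<theta>_inf :: ereal and \<theta> :: "nat \<Rightarrow> real"
    and \<alpha> t \<theta>_star :: real
  assumes F0: "real_distribution F\<^sub>0"
    and F0_finite_var: "integrable F\<^sub>0 (\<lambda>x. x\<^sup>2)"
    and F0_var_nonzero: "prob_space.variance F\<^sub>0 (\<lambda>x. x) \<noteq> 0"
    and theta_inf_pos: "0 < \<theta>_inf"
    and mgf_finite: "\<And>s. 0 \<le> s \<Longrightarrow> ereal s < \<theta>_inf \<Longrightarrow> integrable F\<^sub>0 (\<lambda>x. exp (x * s))"
    and alpha: "0 < \<alpha>" "\<alpha> < 1"
    and theta: "\<And>m. m \<ge> 1 \<Longrightarrow> 0 < \<theta> m" "\<And>m. m \<ge> 1 \<Longrightarrow> ereal (\<theta> m) < \<theta>_inf"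
    and t: "0 < exceed_prob F\<^sub>0 0 t" "exceed_prob F\<^sub>0 0 t < p_crit TYPE('d::finite)"
    and theta_star_range: "0 \<le> \<theta>_star" "ereal \<theta>_star < \<theta>_inf"
    and theta_star: "zeta TYPE('d) (exceed_prob F\<^sub>0 \<theta>_star t) = \<alpha> * zeta TYPE('d) (exceed_prob F\<^sub>0 0 t)"
  shows "(\<forall>s. 0 \<le> s \<and> ereal s < \<theta>_inf \<and>
              zeta TYPE('d) (exceed_prob F\<^sub>0 s t) = \<alpha> * zeta TYPE('d) (exceed_prob F\<^sub>0 0 t)
              \<longrightarrow> s = \<theta>_star) \<and>
         (liminf (\<lambda>m. ereal (\<theta> m)) > ereal \<theta>_star \<longrightarrow>
            stat_powerful F\<^sub>0 \<theta> (hypercubes \<alpha> :: nat \<Rightarrow> (int ^ 'd) set set)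
              (largest_open_cluster t)) \<and>
         (limsup (\<lambda>m. ereal (\<theta> m)) < ereal \<theta>_star \<longrightarrow>
            stat_powerless F\<^sub>0 \<theta> (hypercubes \<alpha> :: nat \<Rightarrow> (int ^ 'd) set set)
              (largest_open_cluster t))"
proof -
  let ?p = "\<lambda>s. exceed_prob F\<^sub>0 s t"
  let ?z = "\<lambda>s. zeta TYPE('d) (?p s)"
  have t1: "?p 0 < 1" using t(2) p_crit_le_1[where 'd = 'd] by simp
  have int0: "integrable F\<^sub>0 (\<lambda>x. exp (x * 0))" using theta_inf_pos by (intro mgf_finite) (auto simp: zero_ereal_def)
  have p_less: "0 < ?p s" "?p s < ?p s'" "?p s' < 1"
    if "0 \<le> s" "s < s'" "ereal s' < \<theta>_inf" for s s'
  proof -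
    have "ereal s < \<theta>_inf" using that by (meson less_ereal.simps(1) less_trans)
    then have "integrable F\<^sub>0 (\<lambda>x. exp (x * s))" "integrable F\<^sub>0 (\<lambda>x. exp (x * s'))"
      using that by (auto intro!: mgf_finite)
    then show "0 < ?p s" "?p s < ?p s'" "?p s' < 1"
      using exceed_prob_strict_mono[OF F0 _ _ that(2) t(1) t1] by auto
  qed
  have p_bounds: "?p 0 \<le> ?p s" "?p s < 1" if "0 \<le> s" "ereal s < \<theta>_inf" for s
    using p_less[of 0 s] that t1 by (cases "s = 0"; force)+
  have p_mono: "?p s \<le> ?p s'" if "0 \<le> s" "s \<le> s'" "ereal s' < \<theta>_inf" for s s'
    using p_less(2)[of s s'] that by (cases "s = s'") auto
  \<comment> \<open>Strictness needs only the smaller parameter to be subcritical: beyond the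
    critical point the rate drops from a positive value to 0.\<close>
  have z_less: "?z s' < ?z s"
    if s: "0 \<le> s" "s < s'" "ereal s' < \<theta>_inf" "?p s < p_crit TYPE('d)" for s s'
  proof (cases "?p s' < p_crit TYPE('d)")
    case True
    then show ?thesis using p_less[OF s(1-3)] by (intro zeta_strict_antimono)
  next
    case False
    then show ?thesis
      using zeta_supercritical[of "?p s'", where 'd = 'd] zeta_pos[OF p_less(1)[OF s(1-3)] s(4)] by simp
  qed
  have z0: "0 < ?z 0" using t by (intro zeta_pos)
  have star_sub: "?p \<theta>_star < p_crit TYPE('d)"
  proof (rule ccontr)
    assume "\<not> ?thesis"
    then have "?z \<theta>_star = 0" by (intro zeta_supercritical) simp
    then show False using theta_star alpha(1) z0 by simp
  qed
  \<comment> \<open>This holds only eventually, because the signal parameters are controlled from m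
    = 1 on.\<close>
  have risk_eq: "eventually (\<lambda>m. risk F\<^sub>0 (\<theta> m) m (hypercubes \<alpha> m)
        (\<lambda>x :: int ^ 'd \<Rightarrow> real. largest_open_cluster t m x > c m)
      = cluster_risk TYPE('d) \<alpha> m (?p 0) (?p (\<theta> m)) (c m)) sequentially" for c
    using eventually_ge_at_top[of 1]
  proof eventually_elim
    case (elim m)
    then show ?case using theta[OF elim] by (intro risk_eq_cluster_risk F0 mgf_finite) auto
  qed
  have "s = \<theta>_star" if s: "0 \<le> s" "ereal s < \<theta>_inf" "?z s = \<alpha> * ?z 0" for s
  proof (rule ccontr)
    assume "s \<noteq> \<theta>_star"
    then consider "s < \<theta>_star" | "\<theta>_star < s" by linarith
    then show False
    proof cases
      case 1
      have "?p s < p_crit TYPE('d)"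
        using p_less(2)[OF s(1) 1 theta_star_range(2)] star_sub by simp
      then show False using z_less[OF s(1) 1 theta_star_range(2)] s(3) theta_star by simp
    next
      case 2
      then show False using z_less[OF theta_star_range(1) 2 s(2) star_sub] s(3) theta_star by simp
    qed
  qed
  moreover have "stat_powerful F\<^sub>0 \<theta> (hypercubes \<alpha> :: nat \<Rightarrow> (int ^ 'd) set set) (largest_open_cluster t)"
    if lim: "liminf (\<lambda>m. ereal (\<theta> m)) > ereal \<theta>_star"
  proof -
    \<comment> \<open>An intermediate value serves as a constant signal. That y is real and below
      \<open>\<theta>_inf\<close> is read off from a single \<open>\<theta> M\<close> exceeding
      it.\<close>
    obtain y where y: "ereal \<theta>_star < y" "y < liminf (\<lambda>m. ereal (\<theta> m))" using dense[OF lim] by blast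
    have y_ev: "eventually (\<lambda>m. y < ereal (\<theta> m)) sequentially" using y(2) less_LiminfD by blast
    then obtain M where M: "1 \<le> M" "y < ereal (\<theta> M)"
      using eventually_happens'[OF sequentially_bot eventually_conj[OF eventually_ge_at_top[of 1] y_ev]] by blast
    obtain s where s: "y = ereal s" using y(1) M(2) by (cases y) auto
    have s_star: "\<theta>_star < s" and s0: "0 \<le> s" using y(1) s theta_star_range(1) by auto
    have s_inf: "ereal s < \<theta>_inf" using less_trans[OF M(2) theta(2)[OF M(1)]] s by simp
    note s_range = s_star s0 s_inf
    have "\<exists>c. (\<lambda>m. cluster_risk TYPE('d) \<alpha> m (?p 0) (?p (\<theta> m)) (c m)) \<longlonglongrightarrow> 0"
    proof (rule cluster_risk_tendsto_0[OF alpha t])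
      show "0 < ?p s" "?p s < 1" using p_less[OF theta_star_range(1) s_range(1,3)] p_bounds[OF s_range(2,3)] t(1) by auto
      show "?z s < \<alpha> * ?z 0"
        using z_less[OF theta_star_range(1) s_range(1,3) star_sub] theta_star by simp
      show "eventually (\<lambda>m. ?p s \<le> ?p (\<theta> m) \<and> ?p (\<theta> m) \<le> 1) sequentially"
        using y_ev eventually_ge_at_top[of 1]
      proof eventually_elim
        case (elim m)
        have th: "0 \<le> \<theta> m" "ereal (\<theta> m) < \<theta>_inf" using theta[OF elim(2)] by auto
        show ?case using p_mono[OF s_range(2) _ th(2)] p_bounds(2)[OF th] elim(1) s by auto
      qed
    qed
    then obtain c where "(\<lambda>m. cluster_risk TYPE('d) \<alpha> m (?p 0) (?p (\<theta> m)) (c m)) \<longlonglongrightarrow> 0" by blast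
    then show ?thesis
      unfolding stat_powerful_def asymp_powerful_def using tendsto_cong[OF risk_eq[of c]] by blast
  qed
  moreover have "stat_powerless F\<^sub>0 \<theta> (hypercubes \<alpha> :: nat \<Rightarrow> (int ^ 'd) set set) (largest_open_cluster t)"
    if lim: "limsup (\<lambda>m. ereal (\<theta> m)) < ereal \<theta>_star"
  proof -
    \<comment> \<open>Here some positive \<open>\<theta> M\<close> lies below y, which makes y real
      and nonnegative, while \<open>\<theta>_star\<close> keeps it below
      \<open>\<theta>_inf\<close>.\<close>
    obtain y where y: "limsup (\<lambda>m. ereal (\<theta> m)) < y" "y < ereal \<theta>_star" using dense[OF lim] by blast
    have y_ev: "eventually (\<lambda>m. ereal (\<theta> m) < y) sequentially" using y(1) Limsup_lessD by blast
    then obtain M where M: "1 \<le> M" "ereal (\<theta> M) < y"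
      using eventually_happens'[OF sequentially_bot eventually_conj[OF eventually_ge_at_top[of 1] y_ev]] by blast
    obtain s where s: "y = ereal s" using y(2) M(2) by (cases y) auto
    have s_range: "s < \<theta>_star" "0 \<le> s" using y(2) M s theta(1)[OF M(1)] by auto
    have s_inf: "ereal s < \<theta>_inf" using s_range(1) theta_star_range(2) by (meson less_ereal.simps(1) less_trans)
    have s_sub: "?p s < p_crit TYPE('d)"
      using p_less(2)[OF s_range(2,1) theta_star_range(2)] star_sub by simp
    have ev: "eventually (\<lambda>m. ?p 0 \<le> ?p (\<theta> m) \<and> ?p (\<theta> m) \<le> ?p s) sequentially"
      using y_ev eventually_ge_at_top[of 1]
    proof eventually_elim
      case (elim m)
      have th: "0 \<le> \<theta> m" "ereal (\<theta> m) < \<theta>_inf" using theta[OF elim(2)] by auto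
      show ?case using p_mono[OF th(1) _ s_inf] p_bounds(1)[OF th] elim(1) s by auto
    qed
    have zs: "\<alpha> * ?z 0 < ?z s"
      using z_less[OF s_range(2,1) theta_star_range(2) s_sub] theta_star by simp
    have "1 \<le> liminf (\<lambda>m. ereal (risk F\<^sub>0 (\<theta> m) m (hypercubes \<alpha> m)
        (\<lambda>x :: int ^ 'd \<Rightarrow> real. largest_open_cluster t m x > c m)))" for c
    proof -
      have "1 \<le> liminf (\<lambda>m. ereal (cluster_risk TYPE('d) \<alpha> m (?p 0) (?p (\<theta> m)) (c m)))"
        by (rule cluster_risk_liminf_ge_1[OF alpha t p_bounds(1)[OF s_range(2) s_inf] s_sub zs ev])
      also have "\<dots> = liminf (\<lambda>m. ereal (risk F\<^sub>0 (\<theta> m) m (hypercubes \<alpha> m)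
        (\<lambda>x :: int ^ 'd \<Rightarrow> real. largest_open_cluster t m x > c m)))"
      proof (rule Liminf_eq)
        show "eventually (\<lambda>m. ereal (cluster_risk TYPE('d) \<alpha> m (?p 0) (?p (\<theta> m)) (c m))
          = ereal (risk F\<^sub>0 (\<theta> m) m (hypercubes \<alpha> m)
              (\<lambda>x :: int ^ 'd \<Rightarrow> real. largest_open_cluster t m x > c m))) sequentially"
          using risk_eq[of c] by eventually_elim simp
      qed
      finally show ?thesis .
    qed
    then show ?thesis unfolding stat_powerless_def asymp_powerless_def by blast
  qed
  ultimately show ?thesis by blast
qed

end
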